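(* Let $\mathfrak g$ be a simple Lie algebra of rank $r$, with any choice of linear ordering $\beta_1<\dots<\beta_m$ of its positive roots and of generators $F_{\beta_l}\in\mathfrak n_{\beta_l}$. For $l=1,\dots,m$, let the content of $F_{\beta_l}$ be $k^{(l)}\in\mathbb N^r$. Then there exist rational functions $\eta_{\beta_l}$ in the variables $(t^{(i)}_j)_{1\le i\le r,\ j=1,\dots,k^{(l)}_i}$, symmetric under $G_{k^{(l)}}$, such that for every $p=(p_1,\dots,p_m)\in\mathbb N^m$ $$\omega_p=\frac1{\prod_l p_l!}\cdot\overbrace{\eta_{\beta_1}*\dots*\eta_{\beta_1}}^{p_1}*\overbrace{\eta_{\beta_2}*\dots*\eta_{\beta_2}}^{p_2}*\dots*\overbrace{\eta_{\beta_m}*\dots*\eta_{\beta_m}}^{p_m}.$$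
   Context: $\mathbb N=\{0,1,2,\dots\}$. For $k\in\mathbb N^r$ put $|k|=\sum_i k_i$ and consider variables $t^{(i)}_j$ ($1\le i\le r$, $1\le j\le k_i$). $G_k=\prod_i\Sigma_{k_i}$ permutes the variables with the same upper index, $\operatorname{Sym}_k x=\sum_{\pi\in G_k}\pi\cdot x$, and $dV_k=dt^{(1)}_1\wedge\dots\wedge dt^{(1)}_{k_1}\wedge\dots\wedge dt^{(r)}_1\wedge\dots\wedge dt^{(r)}_{k_r}$. Star product (associative and commutative): for rational functions $f$ in the variables for $k$ (symmetric under $G_k$) and $g$ in the variables for $l$ (symmetric under $G_l$), $$f*g=\frac1{\prod_i k_i!\,l_i!}\operatorname{Sym}_{k+l}\Big(f(t^{(1)}_1,\dots,t^{(1)}_{k_1},\dots,t^{(r)}_1,\dots,t^{(r)}_{k_r})\cdot g(t^{(1)}_{k_1+1},\dots,t^{(1)}_{k_1+l_1},\dots,t^{(r)}_{k_r+1},\dots,t^{(r)}_{k_r+l_r})\Big).$$ The empty product is the constant $1$. $U_r$ is the free associative $\mathbb C$-algebra on $\tilde f_1,\dots,\tilde f_r$, and $U_r[k]$ is its part of multidegree $k$. For $J:\{1,\dots,|k|\}\to\{1,\dots,r\}$ with $\#J^{-1}(i)=k_i$ put $\tilde f_J=\tilde f_{J(|k|)}\cdots\tilde f_{J(1)}$, and identify variables $t_1,\dots,t_{|k|}$ with the $t^{(i)}_j$ by $t_u=t^{(J(u))}_{c(u)}$, where $c$ restricted to $J^{-1}(i)$ is the increasing bijection onto $\{1,\dots,k_i\}$.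 The canonical differential form is $\Omega_k=\sum_J\operatorname{Sym}_k\big(\prod_{u=1}^{|k|}\frac1{t_u-t_{u-1}}\big)dV_k\otimes\tilde f_J$ (with $t_0=0$; in each summand the identification is given by $J$). $\mathfrak g=\mathfrak n_-\oplus\mathfrak h\oplus\mathfrak n_+$ is the Cartan decomposition. $U(\mathfrak n_-)$ is generated by the Chevalley generators $f_1,\dots,f_r$ subject to the Serre relations, and $q:U_r\to U(\mathfrak n_-)$ is the quotient map $\tilde f_i\mapsto f_i$. An element has content $k$ if it lies in $q(U_r[k])$. Put $\Omega^{\mathfrak g}_k=(\mathrm{id}\otimes q)\Omega_k$. $\mathfrak n_-=\bigoplus_\beta\mathfrak n_\beta$ is the decomposition into one-dimensional weight spaces labelled by the positive roots, $F_\beta$ is a generator of $\mathfrak n_\beta$, and $F^p=F_{\beta_1}^{p_1}\cdots F_{\beta_m}^{p_m}$, $p\in\mathbb N^m$, is the corresponding Poincaré–Birkhoff–Witt basis of $U(\mathfrak n_-)$. The rational functions $\omega_p$ are defined by $\Omega^{\mathfrak g}_k=\sum_p\omega_p\,dV_k\otimes F^p$, where for each $k$ the sum is over all $p$ such that $F^p$ has content $k$. *)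

theory Defs
  imports
    Complex_Main
    "HOL-Library.FuncSet"
    "HOL-Library.Poly_Mapping"
    "HOL-Library.Product_Lexorder"
    "HOL-Computational_Algebra.Fraction_Field"
    "HOL-Combinatorics.Permutations"
begin

section \<open>Rational functions and the star product\<close>

text \<open>Elements of \<open>\<nat>\<^sup>n\<close>, indexed by \<open>1, \<dots>, n\<close> and extended by zero.\<close>

definition nvec :: "nat \<Rightarrow> (nat \<Rightarrow> nat) set" where
  "nvec n = {k. \<forall>i. i \<notin> {1..n} \<longrightarrow> k i = 0}"

text \<open>The pair \<open>(i, j)\<close> stands for the variable \<open>t\<close> with upper index \<open>i\<close> and lower index \<open>j\<close>.
  A polynomial is a finitely supported family of coefficients indexed by monomials, and a monomial
  is a finitely supported family of exponents. The field \<open>rfun\<close> contains the rational functions in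
  all these variables; those in a given set of variables are singled out by \<open>ratfuns\<close>.\<close>

type_synonym var = "nat \<times> nat"
type_synonym mpoly = "(var \<Rightarrow>\<^sub>0 nat) \<Rightarrow>\<^sub>0 complex"
type_synonym rfun = "mpoly fract"

definition mpolys :: "var set \<Rightarrow> mpoly set" where
  "mpolys V = {P. \<forall>m \<in> Poly_Mapping.keys P. Poly_Mapping.keys m \<subseteq> V}"

definition ratfuns :: "var set \<Rightarrow> rfun set" where
  "ratfuns V = {Fract P Q | P Q. P \<in> mpolys V \<and> Q \<in> mpolys V \<and> Q \<noteq> 0}"

definition rconst :: "complex \<Rightarrow> rfun" where
  "rconst c = Fract (Poly_Mapping.single 0 c) 1"

definition rvar :: "var \<Rightarrow> rfun" where
  "rvar v = Fract (Poly_Mapping.single (Poly_Mapping.single v 1) 1) 1"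

text \<open>Substitution of the variable \<open>\<sigma> v\<close> for each variable \<open>v\<close>. On rational functions it is
  meaningful for injective \<open>\<sigma>\<close>, the only case in which it is used.\<close>

definition rename_monom :: "(var \<Rightarrow> var) \<Rightarrow> (var \<Rightarrow>\<^sub>0 nat) \<Rightarrow> (var \<Rightarrow>\<^sub>0 nat)" where
  "rename_monom \<sigma> m =
     (\<Sum>v \<in> Poly_Mapping.keys m. Poly_Mapping.single (\<sigma> v) (Poly_Mapping.lookup m v))"

definition rename_mpoly :: "(var \<Rightarrow> var) \<Rightarrow> mpoly \<Rightarrow> mpoly" where
  "rename_mpoly \<sigma> P =
     (\<Sum>m \<in> Poly_Mapping.keys P.
        Poly_Mapping.single (rename_monom \<sigma> m) (Poly_Mapping.lookup P m))"

definition rename :: "(var \<Rightarrow> var) \<Rightarrow> rfun \<Rightarrow> rfun" where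
  "rename \<sigma> x =
     (THE y. \<exists>P Q. Q \<noteq> 0 \<and> x = Fract P Q \<and> y = Fract (rename_mpoly \<sigma> P) (rename_mpoly \<sigma> Q))"

definition vars :: "nat \<Rightarrow> (nat \<Rightarrow> nat) \<Rightarrow> var set" where
  "vars r k = {(i, j). i \<in> {1..r} \<and> j \<in> {1..k i}}"

definition G :: "nat \<Rightarrow> (nat \<Rightarrow> nat) \<Rightarrow> (var \<Rightarrow> var) set" where
  "G r k = {\<pi>. \<pi> permutes vars r k \<and> (\<forall>v. fst (\<pi> v) = fst v)}"

definition Sym :: "nat \<Rightarrow> (nat \<Rightarrow> nat) \<Rightarrow> rfun \<Rightarrow> rfun" where
  "Sym r k x = (\<Sum>\<pi> \<in> G r k. rename \<pi> x)"

definition star :: "nat \<Rightarrow> (nat \<Rightarrow> nat) \<Rightarrow> (nat \<Rightarrow> nat) \<Rightarrow> rfun \<Rightarrow> rfun \<Rightarrow> rfun" where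
  "star r k l f g =
     Sym r (\<lambda>i. k i + l i) (f * rename (\<lambda>(i, j). (i, k i + j)) g) /
     of_nat (\<Prod>i = 1..r. fact (k i) * fact (l i))"

text \<open>Iterated star product of a list of functions, each tagged with the \<open>k\<close> in whose variables it
  is considered.\<close>

fun star_list :: "nat \<Rightarrow> ((nat \<Rightarrow> nat) \<times> rfun) list \<Rightarrow> rfun" where
  "star_list r [] = 1"
| "star_list r ((k, f) # xs) = star r k (\<lambda>i. \<Sum>(l, g) \<leftarrow> xs. l i) f (star_list r xs)"


section \<open>Free associative algebras\<close>

text \<open>The free monoid, written additively so that \<^typ>\<open>'a \<Rightarrow>\<^sub>0 'k\<close> provides its monoid algebra.\<close>

datatype 'a fmon = Wd (letters: "'a list")

instantiation fmon :: (type) monoid_add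
begin

definition zero_fmon :: "'a fmon" where
  "zero_fmon = Wd []"

definition plus_fmon :: "'a fmon \<Rightarrow> 'a fmon \<Rightarrow> 'a fmon" where
  "plus_fmon u v = Wd (letters u @ letters v)"

instance
  by standard (simp_all add: zero_fmon_def plus_fmon_def)

end

text \<open>The free associative algebra over \<open>'k\<close> on the letters \<open>'a\<close>.\<close>

type_synonym ('a, 'k) falg = "'a fmon \<Rightarrow>\<^sub>0 'k"

definition gen :: "'a \<Rightarrow> ('a, 'k::zero_neq_one) falg" where
  "gen x = Poly_Mapping.single (Wd [x]) 1"

definition free_alg :: "'a set \<Rightarrow> ('a, 'k::zero) falg set" where
  "free_alg N = {x. \<forall>w \<in> Poly_Mapping.keys x. set (letters w) \<subseteq> N}"

text \<open>The two-sided ideal of \<open>free_alg N\<close> generated by \<open>R\<close>.\<close>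

inductive_set ideal_gen :: "'a set \<Rightarrow> ('a, 'k::comm_ring_1) falg set \<Rightarrow> ('a, 'k) falg set"
  for N R where
  ideal_base: "x \<in> R \<Longrightarrow> x \<in> ideal_gen N R"
| ideal_zero: "0 \<in> ideal_gen N R"
| ideal_add: "x \<in> ideal_gen N R \<Longrightarrow> y \<in> ideal_gen N R \<Longrightarrow> x + y \<in> ideal_gen N R"
| ideal_left: "a \<in> free_alg N \<Longrightarrow> x \<in> ideal_gen N R \<Longrightarrow> a * x \<in> ideal_gen N R"
| ideal_right: "a \<in> free_alg N \<Longrightarrow> x \<in> ideal_gen N R \<Longrightarrow> x * a \<in> ideal_gen N R"

text \<open>The \<open>'k\<close>-linear algebra homomorphism sending the letter \<open>a\<close> to the letter \<open>h a\<close>.\<close>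

definition map_letters :: "('a \<Rightarrow> 'b) \<Rightarrow> ('a, 'k::comm_monoid_add) falg \<Rightarrow> ('b, 'k) falg" where
  "map_letters h x =
     (\<Sum>w \<in> Poly_Mapping.keys x.
        Poly_Mapping.single (map_fmon h w) (Poly_Mapping.lookup x w))"

text \<open>For \<open>T\<close> the free complex algebra, \<open>rfun \<otimes> T\<close> is the free algebra over \<^typ>\<open>rfun\<close>, and
  \<open>tens f x\<close> is \<open>f \<otimes> x\<close>. For a subspace \<open>I\<close> of \<open>T\<close>, \<open>tens_sub I\<close> is the image of \<open>rfun \<otimes> I\<close>, so
  that \<open>rfun \<otimes> (T / I)\<close> is \<open>rfun \<otimes> T\<close> modulo \<open>tens_sub I\<close>.\<close>

definition tens :: "rfun \<Rightarrow> ('a, complex) falg \<Rightarrow> ('a, rfun) falg" where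
  "tens f x = Poly_Mapping.map (\<lambda>c. f * rconst c) x"

definition tens_sub :: "('a, complex) falg set \<Rightarrow> ('a, rfun) falg set" where
  "tens_sub I = {(\<Sum>x \<in> S. tens (\<phi> x) x) | S \<phi>. finite S \<and> S \<subseteq> I}"


section \<open>The canonical differential form\<close>

text \<open>\<open>multideg r k\<close> is the part of multidegree \<open>k\<close> of the free complex algebra on the letters
  \<open>1, \<dots>, r\<close>.\<close>

definition multideg :: "nat \<Rightarrow> (nat \<Rightarrow> nat) \<Rightarrow> (nat, complex) falg set" where
  "multideg r k = {u \<in> free_alg {1..r}.
     \<forall>w \<in> Poly_Mapping.keys u. \<forall>i \<in> {1..r}. count_list (letters w) i = k i}"

definition size_of :: "nat \<Rightarrow> (nat \<Rightarrow> nat) \<Rightarrow> nat" where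
  "size_of r k = (\<Sum>i = 1..r. k i)"

definition Js :: "nat \<Rightarrow> (nat \<Rightarrow> nat) \<Rightarrow> (nat \<Rightarrow> nat) set" where
  "Js r k = {J \<in> {1..size_of r k} \<rightarrow>\<^sub>E {1..r}.
     \<forall>i \<in> {1..r}. card {u \<in> {1..size_of r k}. J u = i} = k i}"

text \<open>The variable \<open>t\<^sub>u\<close> under the identification given by \<open>J\<close>; the lower index is the position of
  \<open>u\<close> in the fibre of \<open>J\<close> through \<open>u\<close>.\<close>

definition tvar :: "(nat \<Rightarrow> nat) \<Rightarrow> nat \<Rightarrow> rfun" where
  "tvar J u = (if u = 0 then 0 else rvar (J u, card {v \<in> {1..u}. J v = J u}))"

text \<open>Forms in the variables for \<open>k\<close> of top degree are rational multiples of \<open>dV\<^sub>k\<close>, and are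
  represented here by their coefficient with respect to \<open>dV\<^sub>k\<close>.\<close>

definition Omega :: "nat \<Rightarrow> (nat \<Rightarrow> nat) \<Rightarrow> (nat, rfun) falg" where
  "Omega r k =
     (\<Sum>J \<in> Js r k.
        Poly_Mapping.single (Wd (map J (rev [1..<Suc (size_of r k)])))
          (Sym r k (\<Prod>u = 1..size_of r k. 1 / (tvar J u - tvar J (u - 1)))))"


section \<open>Simple Lie algebras\<close>

locale lie_algebra = vector_space scale
  for scale :: "complex \<Rightarrow> 'g::ab_group_add \<Rightarrow> 'g" +
  fixes br :: "'g \<Rightarrow> 'g \<Rightarrow> 'g"
  assumes br_add_left: "br (x + y) z = br x z + br y z"
    and br_add_right: "br x (y + z) = br x y + br x z"
    and br_scale_left: "br (scale c x) y = scale c (br x y)"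
    and br_scale_right: "br x (scale c y) = scale c (br x y)"
    and br_self: "br x x = 0"
    and jacobi: "br x (br y z) + br y (br z x) + br z (br x y) = 0"

locale simple_lie_algebra = lie_algebra +
  assumes finite_dim: "\<exists>B. finite B \<and> span B = UNIV"
    and nonabelian: "\<exists>x y. br x y \<noteq> 0"
    and only_trivial_ideals:
      "\<And>I. subspace I \<Longrightarrow> (\<And>x y. y \<in> I \<Longrightarrow> br x y \<in> I) \<Longrightarrow> I = {0} \<or> I = UNIV"

text \<open>Cartan subalgebras, in the form appropriate to a complex semisimple Lie algebra: maximal
  commutative, with diagonalizable adjoint action.\<close>

definition cartan_subalgebra ::
    "(complex \<Rightarrow> 'g::ab_group_add \<Rightarrow> 'g) \<Rightarrow> ('g \<Rightarrow> 'g \<Rightarrow> 'g) \<Rightarrow> 'g set \<Rightarrow> bool" where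
  "cartan_subalgebra scale br h \<longleftrightarrow>
     module.subspace scale h \<and>
     (\<forall>x \<in> h. \<forall>y \<in> h. br x y = 0) \<and>
     (\<forall>x. (\<forall>y \<in> h. br y x = 0) \<longrightarrow> x \<in> h) \<and>
     (\<forall>y \<in> h. module.span scale {x. \<exists>c. br y x = scale c x} = UNIV)"

definition root_space ::
    "(complex \<Rightarrow> 'g::ab_group_add \<Rightarrow> 'g) \<Rightarrow> ('g \<Rightarrow> 'g \<Rightarrow> 'g) \<Rightarrow> 'g set \<Rightarrow> ('g \<Rightarrow> complex) \<Rightarrow> 'g set"
  where "root_space scale br h \<alpha> = {x. \<forall>y \<in> h. br y x = scale (\<alpha> y) x}"

text \<open>Linear functionals on \<open>h\<close> are functions that are \<open>undefined\<close> outside \<open>h\<close>, so that distinct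
  roots are distinct as HOL functions.\<close>

definition dual_space :: "(complex \<Rightarrow> 'g::ab_group_add \<Rightarrow> 'g) \<Rightarrow> 'g set \<Rightarrow> ('g \<Rightarrow> complex) set" where
  "dual_space scale h = {\<alpha> \<in> extensional h.
     (\<forall>x \<in> h. \<forall>y \<in> h. \<alpha> (x + y) = \<alpha> x + \<alpha> y) \<and> (\<forall>c. \<forall>x \<in> h. \<alpha> (scale c x) = c * \<alpha> x)}"

definition roots ::
    "(complex \<Rightarrow> 'g::ab_group_add \<Rightarrow> 'g) \<Rightarrow> ('g \<Rightarrow> 'g \<Rightarrow> 'g) \<Rightarrow> 'g set \<Rightarrow> ('g \<Rightarrow> complex) set"
  where "roots scale br h =
    {\<alpha> \<in> dual_space scale h. (\<exists>y \<in> h. \<alpha> y \<noteq> 0) \<and> (\<exists>x \<in> root_space scale br h \<alpha>. x \<noteq> 0)}"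

text \<open>\<open>\<alpha> 1, \<dots>, \<alpha> r\<close> are simple roots: linearly independent roots such that every root is an
  integral combination of them with coefficients all nonnegative or all nonpositive.\<close>

definition simple_roots ::
    "(complex \<Rightarrow> 'g::ab_group_add \<Rightarrow> 'g) \<Rightarrow> ('g \<Rightarrow> 'g \<Rightarrow> 'g) \<Rightarrow> 'g set \<Rightarrow> nat \<Rightarrow>
      (nat \<Rightarrow> 'g \<Rightarrow> complex) \<Rightarrow> bool"
  where "simple_roots scale br h r \<alpha> \<longleftrightarrow>
    (\<forall>i \<in> {1..r}. \<alpha> i \<in> roots scale br h) \<and>
    (\<forall>c :: nat \<Rightarrow> complex. (\<forall>y \<in> h. (\<Sum>i = 1..r. c i * \<alpha> i y) = 0) \<longrightarrow> (\<forall>i \<in> {1..r}. c i = 0)) \<and>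
    (\<forall>\<beta> \<in> roots scale br h. \<exists>c :: nat \<Rightarrow> nat.
       (\<forall>y \<in> h. \<beta> y = (\<Sum>i = 1..r. of_nat (c i) * \<alpha> i y)) \<or>
       (\<forall>y \<in> h. \<beta> y = - (\<Sum>i = 1..r. of_nat (c i) * \<alpha> i y)))"

definition positive_roots ::
    "(complex \<Rightarrow> 'g::ab_group_add \<Rightarrow> 'g) \<Rightarrow> ('g \<Rightarrow> 'g \<Rightarrow> 'g) \<Rightarrow> 'g set \<Rightarrow> nat \<Rightarrow>
      (nat \<Rightarrow> 'g \<Rightarrow> complex) \<Rightarrow> ('g \<Rightarrow> complex) set"
  where "positive_roots scale br h r \<alpha> =
    {\<beta> \<in> roots scale br h. \<exists>c :: nat \<Rightarrow> nat. \<forall>y \<in> h. \<beta> y = (\<Sum>i = 1..r. of_nat (c i) * \<alpha> i y)}"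

text \<open>The weight space of \<open>n\<^sub>-\<close> labelled by the positive root \<open>\<beta>\<close> has weight \<open>- \<beta>\<close>.\<close>

definition n_beta ::
    "(complex \<Rightarrow> 'g::ab_group_add \<Rightarrow> 'g) \<Rightarrow> ('g \<Rightarrow> 'g \<Rightarrow> 'g) \<Rightarrow> 'g set \<Rightarrow> ('g \<Rightarrow> complex) \<Rightarrow> 'g set"
  where "n_beta scale br h \<beta> = root_space scale br h (\<lambda>y. - \<beta> y)"

definition n_minus ::
    "(complex \<Rightarrow> 'g::ab_group_add \<Rightarrow> 'g) \<Rightarrow> ('g \<Rightarrow> 'g \<Rightarrow> 'g) \<Rightarrow> 'g set \<Rightarrow> nat \<Rightarrow>
      (nat \<Rightarrow> 'g \<Rightarrow> complex) \<Rightarrow> 'g set"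
  where "n_minus scale br h r \<alpha> =
    module.span scale (\<Union>\<beta> \<in> positive_roots scale br h r \<alpha>. n_beta scale br h \<beta>)"

text \<open>The normalization makes \<open>[e\<^sub>i, f\<^sub>i]\<close> the coroot of \<open>\<alpha>\<^sub>i\<close>.\<close>

definition chevalley_generators ::
    "(complex \<Rightarrow> 'g::ab_group_add \<Rightarrow> 'g) \<Rightarrow> ('g \<Rightarrow> 'g \<Rightarrow> 'g) \<Rightarrow> 'g set \<Rightarrow> nat \<Rightarrow>
      (nat \<Rightarrow> 'g \<Rightarrow> complex) \<Rightarrow> (nat \<Rightarrow> 'g) \<Rightarrow> (nat \<Rightarrow> 'g) \<Rightarrow> bool"
  where "chevalley_generators scale br h r \<alpha> e f \<longleftrightarrow>
    (\<forall>i \<in> {1..r}.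
       e i \<in> root_space scale br h (\<alpha> i) \<and>
       f i \<in> root_space scale br h (\<lambda>y. - \<alpha> i y) \<and>
       \<alpha> i (br (e i) (f i)) = 2)"


section \<open>The enveloping algebra\<close>

text \<open>The universal enveloping algebra of a Lie subalgebra \<open>N\<close> is \<open>free_alg N\<close> modulo
  \<open>uea_ideal scale br N\<close>. (For \<open>N = n\<^sub>-\<close> this is, by a theorem of Serre, the algebra
  generated by \<open>f\<^sub>1, \<dots>, f\<^sub>r\<close> subject to the Serre relations.) The first two kinds of relations
  turn the free algebra on the set \<open>N\<close> into the tensor algebra of the vector space \<open>N\<close>.\<close>

definition uea_relations ::
    "(complex \<Rightarrow> 'g::ab_group_add \<Rightarrow> 'g) \<Rightarrow> ('g \<Rightarrow> 'g \<Rightarrow> 'g) \<Rightarrow> 'g set \<Rightarrow> ('g, complex) falg set"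
  where "uea_relations scale br N =
    {gen (x + y) - (gen x + gen y) | x y. x \<in> N \<and> y \<in> N} \<union>
    {gen (scale c x) - Poly_Mapping.single 0 c * gen x | c x. x \<in> N} \<union>
    {gen x * gen y - gen y * gen x - gen (br x y) | x y. x \<in> N \<and> y \<in> N}"

definition uea_ideal ::
    "(complex \<Rightarrow> 'g::ab_group_add \<Rightarrow> 'g) \<Rightarrow> ('g \<Rightarrow> 'g \<Rightarrow> 'g) \<Rightarrow> 'g set \<Rightarrow> ('g, complex) falg set"
  where "uea_ideal scale br N = ideal_gen N (uea_relations scale br N)"

text \<open>The class of \<open>x\<close> in \<open>U(N)\<close> lies in the image of the part of multidegree \<open>k\<close> under
  the homomorphism \<open>q\<close> sending the \<open>i\<close>-th free generator to \<open>f i\<close>.\<close>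

definition has_content ::
    "(complex \<Rightarrow> 'g::ab_group_add \<Rightarrow> 'g) \<Rightarrow> ('g \<Rightarrow> 'g \<Rightarrow> 'g) \<Rightarrow> 'g set \<Rightarrow> nat \<Rightarrow> (nat \<Rightarrow> 'g) \<Rightarrow>
      ('g, complex) falg \<Rightarrow> (nat \<Rightarrow> nat) \<Rightarrow> bool"
  where "has_content scale br N r f x k \<longleftrightarrow>
    (\<exists>u \<in> multideg r k. x - map_letters f u \<in> uea_ideal scale br N)"

definition pbw_monomial :: "nat \<Rightarrow> (nat \<Rightarrow> 'g) \<Rightarrow> (nat \<Rightarrow> nat) \<Rightarrow> ('g, complex) falg" where
  "pbw_monomial m F p = prod_list (map (\<lambda>l. gen (F l) ^ p l) [1..<Suc m])"

text \<open>The family \<open>\<omega>\<close> satisfies \<open>(id \<otimes> q) \<Omega>\<^sub>k = \<Sum>\<^sub>p \<omega>\<^sub>p dV\<^sub>k \<otimes> F\<^sup>p\<close> for every \<open>k\<close>, as an equation in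
  \<open>rfun \<otimes> U(N)\<close>.\<close>

definition pbw_expansion ::
    "(complex \<Rightarrow> 'g::ab_group_add \<Rightarrow> 'g) \<Rightarrow> ('g \<Rightarrow> 'g \<Rightarrow> 'g) \<Rightarrow> 'g set \<Rightarrow> nat \<Rightarrow> (nat \<Rightarrow> 'g) \<Rightarrow>
      nat \<Rightarrow> (nat \<Rightarrow> 'g) \<Rightarrow> ((nat \<Rightarrow> nat) \<Rightarrow> rfun) \<Rightarrow> bool"
  where "pbw_expansion scale br N r f m F \<omega> \<longleftrightarrow>
    (\<forall>k \<in> nvec r.
       map_letters f (Omega r k) -
       (\<Sum>p \<in> {p \<in> nvec m. has_content scale br N r f (pbw_monomial m F p) k}.
          tens (\<omega> p) (pbw_monomial m F p))
       \<in> tens_sub (uea_ideal scale br N))"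

end

theory Submission
  imports Defs "HOL-Combinatorics.Multiset_Permutations"
begin

text \<open>Summing \<open>\<Prod> 1 / (t\<^sub>u - t\<^sub>u\<^sub>-\<^sub>1)\<close> over orderings of the variables turns products into shuffles, so
  the generating series of the forms \<open>\<Omega>\<^sub>k\<close> is group-like with respect to the star product and the
  unshuffle coproduct of \<open>U\<^sub>r\<close>, hence also in \<open>U(n\<^sub>-)\<close>. As the \<open>F\<^sub>\<beta>\<close> are primitive, the coefficients
  of a group-like element in a PBW basis satisfy \<open>\<omega>\<^sub>a * \<omega>\<^sub>b = (a + b choose a) \<omega>\<^sub>a\<^sub>+\<^sub>b\<close>, which gives
  the product formula with \<open>\<eta>\<^sub>\<beta> = \<omega>\<close> at the unit vectors. Everything is phrased dually, with functionals
  on words that vanish on the ideal of the enveloping algebra: the coproduct becomes a convolution of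
  functionals, and convolution products of matrix coefficients of the adjoint representation show
  that the PBW monomials are linearly independent.\<close>


section \<open>Linear extension to finitely supported families\<close>

text \<open>The equation defining the \<open>\<omega> p\<close> lives in a quotient, so coefficients
  can be read off only by functionals that vanish on the ideal. The functionals dual to PBW
  monomials are constructed only up to a given length \<open>n\<close>: then finitely many exponent
  vectors matter and finite-dimensional duality produces them. Nothing is lost, because a PBW
  monomial of multidegree \<open>k\<close> has at most \<open>size_of r k\<close> factors. Two facts
  about the concrete setting shape the rest. The generators \<open>F l\<close> must be nonzero,
  although being a root is a statement about the weight space of \<beta> and not about that of
  -\<beta>; the Killing form settles this. And the content of a monomial, which is an existential
  statement, must be pinned down, which is done by comparing weights. For the rational functions the
  common language is a sum over orderings of variables: both the star product and the convolution
  then become sums over subsets of the variables, and the factorials in the star product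
  disappear.\<close>

definition lin_ext :: "('a \<Rightarrow> 'b \<Rightarrow> 'c::comm_monoid_add) \<Rightarrow> ('a \<Rightarrow>\<^sub>0 'b::comm_monoid_add) \<Rightarrow> 'c" where
  "lin_ext g x = (\<Sum>w \<in> Poly_Mapping.keys x. g w (Poly_Mapping.lookup x w))"

text \<open>Additivity in the coefficient is all that the extension needs, so one set of lemmas
  covers pushforward along a map of indices and evaluation of functionals over
  \<open>complex\<close> as well as over \<open>rfun\<close>.\<close>

locale additive_family =
  fixes g :: "'a \<Rightarrow> 'b::comm_monoid_add \<Rightarrow> 'c::comm_monoid_add"
  assumes fam_zero [simp]: "g w 0 = 0"
    and fam_add: "g w (a + b) = g w a + g w b"
begin

text \<open>Cancellation can make the support of a sum smaller than the union of the supports;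
  summing over a larger finite set is harmless because \<open>g w 0 = 0\<close>.\<close>

lemma lin_ext_superset:
  assumes "finite S" "Poly_Mapping.keys x \<subseteq> S"
  shows "lin_ext g x = (\<Sum>w \<in> S. g w (Poly_Mapping.lookup x w))"
  unfolding lin_ext_def
  by (rule sum.mono_neutral_left) (use assms in \<open>auto simp: in_keys_iff\<close>)

lemma lin_ext_add: "lin_ext g (x + y) = lin_ext g x + lin_ext g y"
proof -
  let ?S = "Poly_Mapping.keys x \<union> Poly_Mapping.keys y"
  have "lin_ext g (x + y) = (\<Sum>w \<in> ?S. g w (Poly_Mapping.lookup (x + y) w))"
    by (rule lin_ext_superset) (auto dest: subsetD[OF keys_add])
  also have "\<dots> = lin_ext g x + lin_ext g y"
    by (simp add: lookup_add fam_add sum.distrib lin_ext_superset[of ?S])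
  finally show ?thesis .
qed

lemma lin_ext_zero [simp]: "lin_ext g 0 = 0"
  by (simp add: lin_ext_def)

lemma lin_ext_single [simp]: "lin_ext g (Poly_Mapping.single w c) = g w c"
  by (simp add: lin_ext_def)

lemma lin_ext_sum: "lin_ext g (sum X S) = (\<Sum>i \<in> S. lin_ext g (X i))"
  by (induction S rule: infinite_finite_induct) (simp_all add: lin_ext_add)

end

lemma lin_ext_diff:
  fixes g :: "'a \<Rightarrow> 'b::ab_group_add \<Rightarrow> 'c::ab_group_add"
  assumes "additive_family g"
  shows "lin_ext g (x - y) = lin_ext g x - lin_ext g y"
proof -
  interpret additive_family g by fact
  have "lin_ext g (x - y) + lin_ext g y = lin_ext g x"
    by (simp flip: lin_ext_add)
  then show ?thesis
    by (simp add: eq_diff_eq)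
qed

lemma poly_mapping_sum_single:
  "(\<Sum>w \<in> Poly_Mapping.keys x. Poly_Mapping.single w (Poly_Mapping.lookup x w)) = x"
  by (rule poly_mapping_eqI)
    (auto simp: lookup_sum lookup_single when_def in_keys_iff)

lemma poly_mapping_single_induct [case_names single sum]:
  assumes "\<And>w c. P (Poly_Mapping.single w c)"
    and "\<And>x y. P x \<Longrightarrow> P y \<Longrightarrow> P (x + y)"
  shows "P (x :: 'a \<Rightarrow>\<^sub>0 'b::comm_monoid_add)"
proof -
  have "P (\<Sum>w \<in> S. Poly_Mapping.single w (Poly_Mapping.lookup x w))" for S
  proof (induction S rule: infinite_finite_induct)
    case (insert w S)
    then show ?case using assms by simp
  \<comment> \<open>The base case is \<open>0 = single undefined 0\<close>.\<close>
  qed (use assms(1)[of undefined 0] in simp_all)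
  from this[of "Poly_Mapping.keys x"] show ?thesis
    by (simp add: poly_mapping_sum_single)
qed

text \<open>Renaming in monomials, renaming in polynomials (a pushforward along a pushforward) and
  substitution of letters all have this form, so multiplicativity and injectivity are shown only
  once.\<close>

definition push :: "('a \<Rightarrow> 'b) \<Rightarrow> ('a \<Rightarrow>\<^sub>0 'c::comm_monoid_add) \<Rightarrow> ('b \<Rightarrow>\<^sub>0 'c)" where
  "push h = lin_ext (\<lambda>w. Poly_Mapping.single (h w))"

lemma rename_monom_push: "rename_monom \<sigma> = push \<sigma>"
  by (simp add: fun_eq_iff rename_monom_def push_def lin_ext_def)

lemma rename_mpoly_push: "rename_mpoly \<sigma> = push (push \<sigma>)"
  by (simp add: fun_eq_iff rename_mpoly_def push_def lin_ext_def rename_monom_push)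

lemma map_letters_push: "map_letters h = push (map_fmon h)"
  by (simp add: fun_eq_iff map_letters_def push_def lin_ext_def)

interpretation push: additive_family "\<lambda>w. Poly_Mapping.single (h w)" for h
  by standard (simp_all add: single_add)

lemmas push_add = push.lin_ext_add[folded push_def]
lemmas push_zero = push.lin_ext_zero[folded push_def]
lemmas push_single = push.lin_ext_single[folded push_def]
lemmas push_sum = push.lin_ext_sum[folded push_def]

lemma push_mult:
  assumes "\<And>a b. h (a + b) = h a + h b"
  shows "push h (x * y) = push h x * push h (y :: _ \<Rightarrow>\<^sub>0 _::semiring_0)"
proof (induction x rule: poly_mapping_single_induct)
  case (single w c)
  show ?case
    by (induction y rule: poly_mapping_single_induct)
      (simp_all add: push_single push_add mult_single assms distrib_left)
qed (simp_all add: push_add distrib_right)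

lemma lookup_push:
  assumes "inj h"
  shows "Poly_Mapping.lookup (push h x) (h w) = Poly_Mapping.lookup x w"
proof (induction x rule: poly_mapping_single_induct)
  case (single v c)
  show ?case
    using assms by (simp add: push_single lookup_single when_def inj_eq)
qed (simp add: push_add lookup_add)

lemma inj_push:
  assumes "inj h"
  shows "inj (push h :: _ \<Rightarrow> _ \<Rightarrow>\<^sub>0 'c::comm_monoid_add)"
  by (rule injI, rule poly_mapping_eqI) (metis lookup_push[OF assms])

lemma keys_push: "Poly_Mapping.keys (push h x) \<subseteq> h ` Poly_Mapping.keys x"
  unfolding push_def lin_ext_def
  by (rule order.trans[OF keys_sum]) auto


section \<open>Renaming of variables\<close>

lemma rename_mpoly_hom:
  shows rename_mpoly_add: "rename_mpoly \<sigma> (P + Q) = rename_mpoly \<sigma> P + rename_mpoly \<sigma> Q"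
    and rename_mpoly_mult: "rename_mpoly \<sigma> (P * Q) = rename_mpoly \<sigma> P * rename_mpoly \<sigma> Q"
    and rename_mpoly_zero: "rename_mpoly \<sigma> 0 = 0"
    and rename_mpoly_one: "rename_mpoly \<sigma> 1 = 1"
  by (simp_all add: rename_mpoly_push push_add push_mult push_zero push_single
      flip: single_one)

lemma rename_mpoly_eq_0_iff:
  assumes "inj \<sigma>"
  shows "rename_mpoly \<sigma> P = 0 \<longleftrightarrow> P = 0"
  using inj_eq[OF inj_push[OF inj_push[OF assms]], of P 0]
  by (simp add: rename_mpoly_push push_zero)

text \<open>Independence of the chosen fraction: equality of fractions is an equation between
  polynomials, which a homomorphism preserves, and injectivity of \<open>\<sigma>\<close> keeps
  denominators nonzero.\<close>

lemma rename_Fract: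
  assumes "inj \<sigma>" "Q \<noteq> 0"
  shows "rename \<sigma> (Fract P Q) = Fract (rename_mpoly \<sigma> P) (rename_mpoly \<sigma> Q)"
  unfolding rename_def
proof (rule the_equality)
  fix y
  assume "\<exists>P' Q'. Q' \<noteq> 0 \<and> Fract P Q = Fract P' Q' \<and>
    y = Fract (rename_mpoly \<sigma> P') (rename_mpoly \<sigma> Q')"
  then obtain P' Q' where *: "Q' \<noteq> 0" "Fract P Q = Fract P' Q'"
    "y = Fract (rename_mpoly \<sigma> P') (rename_mpoly \<sigma> Q')"
    by blast
  then have "P * Q' = P' * Q"
    using assms by (simp add: eq_fract)
  then have "rename_mpoly \<sigma> P * rename_mpoly \<sigma> Q' = rename_mpoly \<sigma> P' * rename_mpoly \<sigma> Q"
    by (simp flip: rename_mpoly_mult)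
  then show "y = Fract (rename_mpoly \<sigma> P) (rename_mpoly \<sigma> Q)"
    using * assms by (simp add: eq_fract rename_mpoly_eq_0_iff)
qed (use assms in blast)

lemma rename_hom:
  assumes "inj \<sigma>"
  shows rename_add: "rename \<sigma> (x + y) = rename \<sigma> x + rename \<sigma> y"
    and rename_mult: "rename \<sigma> (x * y) = rename \<sigma> x * rename \<sigma> y"
    and rename_uminus: "rename \<sigma> (- x) = - rename \<sigma> x"
    and rename_inverse: "rename \<sigma> (inverse x) = inverse (rename \<sigma> x)"
proof -
  obtain P Q P' Q' where x: "x = Fract P Q" "Q \<noteq> 0" and y: "y = Fract P' Q'" "Q' \<noteq> 0"
    by (metis Fract_cases)
  note simps = x(1) y(1) rename_Fract[OF assms] x(2) y(2) rename_mpoly_hom rename_mpoly_eq_0_iff[OF assms]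
  show "rename \<sigma> (x + y) = rename \<sigma> x + rename \<sigma> y" "rename \<sigma> (x * y) = rename \<sigma> x * rename \<sigma> y"
    by (simp_all add: simps)
  have "rename_mpoly \<sigma> (- P) = - rename_mpoly \<sigma> P"
    by (metis add.left_inverse eq_neg_iff_add_eq_0 rename_mpoly_add rename_mpoly_zero)
  then show "rename \<sigma> (- x) = - rename \<sigma> x"
    by (simp add: simps)
  have "rename \<sigma> 0 = 0"
    by (simp add: Zero_fract_def rename_Fract[OF assms] rename_mpoly_hom)
  then show "rename \<sigma> (inverse x) = inverse (rename \<sigma> x)"
    by (cases "P = 0") (simp_all add: simps fract_collapse)
qed

lemma rename_const:
  assumes "inj \<sigma>"
  shows rename_zero: "rename \<sigma> 0 = 0"
    and rename_one: "rename \<sigma> 1 = 1"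
    and rename_rconst: "rename \<sigma> (rconst c) = rconst c"
    and rename_rvar: "rename \<sigma> (rvar v) = rvar (\<sigma> v)"
  by (simp_all add: Zero_fract_def One_fract_def rconst_def rvar_def rename_Fract[OF assms]
      rename_mpoly_zero rename_mpoly_one)
    (simp_all add: rename_mpoly_push push_single push_zero)

lemma rename_diff: "inj \<sigma> \<Longrightarrow> rename \<sigma> (x - y) = rename \<sigma> x - rename \<sigma> y"
  using rename_add[of \<sigma> x "- y"] by (simp add: rename_uminus)

lemma rename_divide: "inj \<sigma> \<Longrightarrow> rename \<sigma> (x / y) = rename \<sigma> x / rename \<sigma> y"
  by (simp add: divide_inverse rename_mult rename_inverse)

lemma rename_sum: "inj \<sigma> \<Longrightarrow> rename \<sigma> (sum X S) = (\<Sum>i \<in> S. rename \<sigma> (X i))"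
  by (induction S rule: infinite_finite_induct) (simp_all add: rename_const rename_add)

lemma inj_rvar: "inj rvar"
proof (rule injI)
  fix v w assume "rvar v = rvar w"
  then have "Poly_Mapping.single (Poly_Mapping.single v (1 :: nat)) (1 :: complex) =
      Poly_Mapping.single (Poly_Mapping.single w 1) 1"
    by (simp add: rvar_def eq_fract)
  from arg_cong[OF this, of Poly_Mapping.keys]
  have "Poly_Mapping.single v (1 :: nat) = Poly_Mapping.single w 1"
    by simp
  from arg_cong[OF this, of Poly_Mapping.keys] show "v = w"
    by simp
qed

lemma rvar_neq_0: "rvar v \<noteq> 0"
proof
  assume "rvar v = 0"
  then have "Poly_Mapping.single (Poly_Mapping.single v (1 :: nat)) (1 :: complex) = 0"
    by (simp add: rvar_def Zero_fract_def eq_fract)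
  from arg_cong[OF this, of Poly_Mapping.keys] show False
    by simp
qed

lemma rconst_hom:
  shows rconst_add: "rconst (a + b) = rconst a + rconst b"
    and rconst_mult: "rconst (a * b) = rconst a * rconst b"
    and rconst_zero: "rconst 0 = 0"
    and rconst_one: "rconst 1 = 1"
  by (simp_all add: rconst_def Zero_fract_def One_fract_def single_add mult_single)

lemma rconst_sum: "rconst (sum X S) = (\<Sum>i \<in> S. rconst (X i))"
  by (induction S rule: infinite_finite_induct) (simp_all add: rconst_hom)

lemma rconst_of_nat: "rconst (of_nat n) = of_nat n"
  by (induction n) (simp_all add: rconst_hom)

text \<open>Factorials are divided out in the star product and in the final formula, so positive
  integers must be nonzero in \<open>rfun\<close>.\<close>

instance fract :: ("{idom, ring_char_0}") field_char_0
  by standard (simp add: inj_on_def of_nat_fract eq_fract)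


section \<open>Rational functions in given variables\<close>

lemma mpolys_one: "1 \<in> mpolys V"
  by (simp add: mpolys_def)

lemma mpolys_single: "Poly_Mapping.keys m \<subseteq> V \<Longrightarrow> Poly_Mapping.single m c \<in> mpolys V"
  by (simp add: mpolys_def)

lemma mpolys_add: "P \<in> mpolys V \<Longrightarrow> Q \<in> mpolys V \<Longrightarrow> P + Q \<in> mpolys V"
  unfolding mpolys_def by (blast dest: subsetD[OF keys_add])

lemma mpolys_uminus: "P \<in> mpolys V \<Longrightarrow> - P \<in> mpolys V"
  by (simp add: mpolys_def in_keys_iff)

lemma mpolys_mult:
  assumes "P \<in> mpolys V" "Q \<in> mpolys V"
  shows "P * Q \<in> mpolys V"
  unfolding mpolys_def
proof (intro CollectI ballI)
  fix m assume "m \<in> Poly_Mapping.keys (P * Q)"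
  then obtain a b where "m = a + b" "a \<in> Poly_Mapping.keys P" "b \<in> Poly_Mapping.keys Q"
    using keys_mult[of P Q] by blast
  then show "Poly_Mapping.keys m \<subseteq> V"
    using assms keys_add[of a b] unfolding mpolys_def by blast
qed

lemma ratfuns_rvar: "v \<in> V \<Longrightarrow> rvar v \<in> ratfuns V"
  unfolding ratfuns_def rvar_def
  by (intro CollectI exI conjI refl) (auto simp: mpolys_one intro!: mpolys_single)

lemma ratfuns_rconst: "rconst c \<in> ratfuns V"
  unfolding ratfuns_def rconst_def
  by (intro CollectI exI conjI refl) (auto simp: mpolys_one intro!: mpolys_single)

lemma ratfuns_add: "x \<in> ratfuns V \<Longrightarrow> y \<in> ratfuns V \<Longrightarrow> x + y \<in> ratfuns V"
  unfolding ratfuns_def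
  by (clarsimp, intro exI conjI, rule refl) (auto intro!: mpolys_add mpolys_mult)

lemma ratfuns_mult: "x \<in> ratfuns V \<Longrightarrow> y \<in> ratfuns V \<Longrightarrow> x * y \<in> ratfuns V"
  unfolding ratfuns_def
  by (clarsimp, intro exI conjI, rule refl) (auto intro!: mpolys_mult)

lemma ratfuns_uminus: "x \<in> ratfuns V \<Longrightarrow> - x \<in> ratfuns V"
  unfolding ratfuns_def
  by (clarsimp, intro exI conjI, rule refl) (auto intro!: mpolys_uminus)

lemma ratfuns_diff: "x \<in> ratfuns V \<Longrightarrow> y \<in> ratfuns V \<Longrightarrow> x - y \<in> ratfuns V"
  using ratfuns_add[of x V "- y"] by (simp add: ratfuns_uminus)

lemma ratfuns_inverse:
  assumes "x \<in> ratfuns V"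
  shows "inverse x \<in> ratfuns V"
proof -
  obtain P Q where x: "x = Fract P Q" "P \<in> mpolys V" "Q \<in> mpolys V" "Q \<noteq> 0"
    using assms unfolding ratfuns_def by blast
  show ?thesis
  proof (cases "P = 0")
    case True
    then show ?thesis
      using ratfuns_rconst[of 0 V] by (simp add: x(1) rconst_zero fract_collapse)
  next
    case False
    then show ?thesis
      using x unfolding ratfuns_def by auto
  qed
qed

lemma ratfuns_sum: "(\<And>i. i \<in> S \<Longrightarrow> X i \<in> ratfuns V) \<Longrightarrow> sum X S \<in> ratfuns V"
  using ratfuns_rconst[of 0 V]
  by (induction S rule: infinite_finite_induct) (simp_all add: rconst_zero ratfuns_add)


section \<open>Functionals on words and the shuffle product\<close>

text \<open>\<open>conv\<close> is the product of functionals dual to the unshuffle coproduct, for which the letters are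
  primitive.\<close>

fun conv :: "('a list \<Rightarrow> complex) \<Rightarrow> ('a list \<Rightarrow> complex) \<Rightarrow> 'a list \<Rightarrow> complex" where
  "conv \<phi> \<psi> [] = \<phi> [] * \<psi> []"
| "conv \<phi> \<psi> (x # w) = conv (\<lambda>u. \<phi> (x # u)) \<psi> w + conv \<phi> (\<lambda>u. \<psi> (x # u)) w"

lemma conv_map: "conv \<phi> \<psi> (map h w) = conv (\<phi> \<circ> map h) (\<psi> \<circ> map h) w"
  by (induction w arbitrary: \<phi> \<psi>) (simp_all add: o_def)

text \<open>The recursion of \<open>conv\<close> decides for each letter whether it goes to the left
  or to the right factor. If the positions are named by distinct elements \<open>vs\<close>, such a
  sequence of choices is a subset; the labels \<open>h\<close> may repeat.\<close>

lemma conv_distinct: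
  assumes "distinct vs"
  shows "conv \<phi> \<psi> (map h vs) =
    (\<Sum>A \<in> Pow (set vs). \<phi> (map h (filter (\<lambda>v. v \<in> A) vs)) * \<psi> (map h (filter (\<lambda>v. v \<notin> A) vs)))"
  using assms
proof (induction vs arbitrary: \<phi> \<psi>)
  case (Cons v vs)
  let ?s = "\<lambda>\<phi> \<psi> us A. \<phi> (map h (filter (\<lambda>v. v \<in> A) us)) * \<psi> (map h (filter (\<lambda>v. v \<notin> A) us))"
  have v: "v \<notin> set vs"
    using Cons.prems by simp
  have inj: "inj_on (insert v) (Pow (set vs))"
    using v by (auto simp: inj_on_def)
  have eq: "filter (\<lambda>u. u = v \<or> u \<in> A) vs = filter (\<lambda>u. u \<in> A) vs"
    "filter (\<lambda>u. u \<noteq> v \<and> u \<notin> A) vs = filter (\<lambda>u. u \<notin> A) vs" for A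
    using v by (auto intro!: filter_cong)
  have "sum (?s \<phi> \<psi> (v # vs)) (Pow (set (v # vs))) =
      sum (?s \<phi> \<psi> (v # vs)) (Pow (set vs)) + sum (?s \<phi> \<psi> (v # vs)) (insert v ` Pow (set vs))"
    using v by (auto simp: Pow_insert intro!: sum.union_disjoint)
  also have "sum (?s \<phi> \<psi> (v # vs)) (insert v ` Pow (set vs)) =
      (\<Sum>A \<in> Pow (set vs). ?s \<phi> \<psi> (v # vs) (insert v A))"
    using inj by (simp only: sum.reindex o_def)
  also have "\<dots> = (\<Sum>A \<in> Pow (set vs). ?s (\<lambda>u. \<phi> (h v # u)) \<psi> vs A)"
    by (rule sum.cong) (simp_all add: eq)
  also have "sum (?s \<phi> \<psi> (v # vs)) (Pow (set vs)) = (\<Sum>A \<in> Pow (set vs). ?s \<phi> (\<lambda>u. \<psi> (h v # u)) vs A)"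
    using v by (intro sum.cong) auto
  finally show ?case
    using Cons by (simp add: add.commute)
qed simp

text \<open>The starting value \<open>a\<close> is 0 in the canonical form; it is kept free because
  the value of a variable that has been split off takes its place.\<close>

fun chain :: "('v \<Rightarrow> 'k::field) \<Rightarrow> 'k \<Rightarrow> 'v list \<Rightarrow> 'k" where
  "chain x a [] = 1"
| "chain x a (v # vs) = 1 / (x v - a) * chain x (x v) vs"

text \<open>By induction on the first letter of the shuffle, from
  \<open>1 / (y - x) * (1 / (x - a) - 1 / (y - a)) = 1 / ((x - a) * (y - a))\<close>.\<close>

lemma chain_shuffle:
  assumes "inj x" "distinct us" "distinct vs" "set us \<inter> set vs = {}" "a \<notin> x ` (set us \<union> set vs)"
  shows "(\<Sum>ws \<in> shuffles us vs. chain x a ws) = chain x a us * chain x a vs"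
  using assms
proof (induction us vs arbitrary: a rule: shuffles.induct)
  case (3 u us v vs)
  have ne: "x v \<noteq> x u" "x u \<noteq> a" "x v \<noteq> a"
    using "3.prems" by (auto simp: inj_eq)
  have "(\<Sum>ws \<in> shuffles (u # us) (v # vs). chain x a ws) =
      (\<Sum>ws \<in> (#) u ` shuffles us (v # vs). chain x a ws) +
      (\<Sum>ws \<in> (#) v ` shuffles (u # us) vs. chain x a ws)"
    unfolding shuffles.simps by (rule sum.union_disjoint) (use "3.prems" in auto)
  also have "\<dots> = (\<Sum>ws \<in> shuffles us (v # vs). chain x a (u # ws)) +
      (\<Sum>ws \<in> shuffles (u # us) vs. chain x a (v # ws))"
    by (simp add: sum.reindex)
  also have "\<dots> = 1 / (x u - a) * (\<Sum>ws \<in> shuffles us (v # vs). chain x (x u) ws) +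
      1 / (x v - a) * (\<Sum>ws \<in> shuffles (u # us) vs. chain x (x v) ws)"
    by (simp only: chain.simps sum_distrib_left)
  also have "(\<Sum>ws \<in> shuffles us (v # vs). chain x (x u) ws) =
      chain x (x u) us * chain x (x u) (v # vs)"
    by (rule "3.IH") (use "3.prems" in \<open>auto simp: inj_eq\<close>)
  also have "(\<Sum>ws \<in> shuffles (u # us) vs. chain x (x v) ws) =
      chain x (x v) (u # us) * chain x (x v) vs"
    by (rule "3.IH") (use "3.prems" in \<open>auto simp: inj_eq\<close>)
  also have "1 / (x u - a) * (chain x (x u) us * chain x (x u) (v # vs)) +
      1 / (x v - a) * (chain x (x v) (u # us) * chain x (x v) vs) =
      chain x (x u) us * chain x (x v) vs *
      (1 / ((x u - a) * (x v - x u)) + 1 / ((x v - a) * (x u - x v)))"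
    by (simp add: distrib_left)
  also have "1 / ((x u - a) * (x v - x u)) + 1 / ((x v - a) * (x u - x v)) =
      1 / ((x u - a) * (x v - a))"
    using ne by (simp add: divide_simps) (simp add: algebra_simps)
  finally show ?case
    by simp
qed simp_all

text \<open>A summand of \<open>Sym\<^sub>k\<close> and \<open>J\<close> together amount to an ordering of all variables.\<close>

definition ordering_sum :: "var set \<Rightarrow> (nat list \<Rightarrow> complex) \<Rightarrow> rfun" where
  "ordering_sum V \<phi> = (\<Sum>vs \<in> permutations_of_set V. chain rvar 0 vs * rconst (\<phi> (rev (map fst vs))))"

text \<open>This is the group-like property. For fixed \<open>A\<close>, an ordering of
  \<open>V\<close> amounts to orderings of \<open>A\<close> and of \<open>V - A\<close> together
  with a shuffle of the two. The words depend only on the two partial orderings, so the sum over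
  shuffles factorizes by \<open>chain_shuffle\<close>.\<close>

lemma ordering_sum_conv:
  assumes "finite V"
  shows "ordering_sum V (conv \<phi> \<psi>) = (\<Sum>A \<in> Pow V. ordering_sum A \<phi> * ordering_sum (V - A) \<psi>)"
proof -
  let ?\<phi> = "\<lambda>vs. rconst (\<phi> (rev (map fst vs)))" and ?\<psi> = "\<lambda>vs. rconst (\<psi> (rev (map fst vs)))"
  have *: "(\<Sum>vs \<in> permutations_of_set V. chain rvar 0 vs *
        (?\<phi> (filter (\<lambda>v. v \<in> A) vs) * ?\<psi> (filter (\<lambda>v. v \<notin> A) vs))) =
      ordering_sum A \<phi> * ordering_sum (V - A) \<psi>" if A: "A \<subseteq> V" for A
  proof -
    have shuf: "filter (\<lambda>v. v \<in> A) vs = as" "filter (\<lambda>v. v \<notin> A) vs = bs"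
      if "as \<in> permutations_of_set A" "bs \<in> permutations_of_set (V - A)" "vs \<in> shuffles as bs" for as bs vs
    proof -
      have "set as = A" "set bs = V - A"
        using that by (simp_all add: permutations_of_setD)
      then show "filter (\<lambda>v. v \<in> A) vs = as" "filter (\<lambda>v. v \<notin> A) vs = bs"
        using filter_shuffles_disjoint1[of as bs vs] that by auto
    qed
    have "ordering_sum A \<phi> * ordering_sum (V - A) \<psi> =
        (\<Sum>p \<in> permutations_of_set A \<times> permutations_of_set (V - A).
          (chain rvar 0 (fst p) * chain rvar 0 (snd p)) * (?\<phi> (fst p) * ?\<psi> (snd p)))"
      unfolding ordering_sum_def
      by (simp add: sum_product sum.cartesian_product case_prod_beta mult_ac)
    also have "\<dots> = (\<Sum>p \<in> permutations_of_set A \<times> permutations_of_set (V - A).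
        \<Sum>vs \<in> shuffles (fst p) (snd p). chain rvar 0 vs * (?\<phi> (fst p) * ?\<psi> (snd p)))"
    proof (rule sum.cong[OF refl])
      fix p assume "p \<in> permutations_of_set A \<times> permutations_of_set (V - A)"
      then have "set (fst p) \<inter> set (snd p) = {}" "distinct (fst p)" "distinct (snd p)"
        by (auto simp: permutations_of_set_def)
      then have "chain rvar 0 (fst p) * chain rvar 0 (snd p) =
          (\<Sum>vs \<in> shuffles (fst p) (snd p). chain rvar 0 vs)"
        using rvar_neq_0 by (intro chain_shuffle[symmetric] inj_rvar) (auto simp: eq_commute[of 0])
      then show "chain rvar 0 (fst p) * chain rvar 0 (snd p) * (?\<phi> (fst p) * ?\<psi> (snd p)) =
          (\<Sum>vs \<in> shuffles (fst p) (snd p). chain rvar 0 vs * (?\<phi> (fst p) * ?\<psi> (snd p)))"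
        by (simp only: sum_distrib_right)
    qed
    also have "\<dots> = (\<Sum>(p, vs) \<in> (SIGMA p:permutations_of_set A \<times> permutations_of_set (V - A).
        shuffles (fst p) (snd p)). chain rvar 0 vs * (?\<phi> (fst p) * ?\<psi> (snd p)))"
      by (subst sum.Sigma) (auto simp: case_prod_beta)
    also have "\<dots> = (\<Sum>vs \<in> permutations_of_set V. chain rvar 0 vs *
        (?\<phi> (filter (\<lambda>v. v \<in> A) vs) * ?\<psi> (filter (\<lambda>v. v \<notin> A) vs)))"
    proof (rule sum.reindex_bij_witness[of _
          "\<lambda>vs. ((filter (\<lambda>v. v \<in> A) vs, filter (\<lambda>v. v \<notin> A) vs), vs)" snd])
      fix t assume "t \<in> (SIGMA p:permutations_of_set A \<times> permutations_of_set (V - A). shuffles (fst p) (snd p))"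
      then obtain as bs vs where t: "t = ((as, bs), vs)" "as \<in> permutations_of_set A"
        "bs \<in> permutations_of_set (V - A)" "vs \<in> shuffles as bs"
        by auto
      show "((filter (\<lambda>v. v \<in> A) (snd t), filter (\<lambda>v. v \<notin> A) (snd t)), snd t) = t"
        using t shuf by simp
      have "set as = A" "set bs = V - A" "distinct as" "distinct bs"
        using t by (simp_all add: permutations_of_set_def)
      then show "snd t \<in> permutations_of_set V"
        using t(1,4) A set_shuffles[OF t(4)] distinct_disjoint_shuffles[OF _ _ _ t(4)]
        by (auto intro!: permutations_of_setI)
      show "chain rvar 0 (snd t) *
          (?\<phi> (filter (\<lambda>v. v \<in> A) (snd t)) * ?\<psi> (filter (\<lambda>v. v \<notin> A) (snd t))) =
          (case t of (p, vs) \<Rightarrow> chain rvar 0 vs * (?\<phi> (fst p) * ?\<psi> (snd p)))"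
        using t shuf by simp
    next
      fix vs assume "vs \<in> permutations_of_set V"
      then show "((filter (\<lambda>v. v \<in> A) vs, filter (\<lambda>v. v \<notin> A) vs), vs) \<in>
          (SIGMA p:permutations_of_set A \<times> permutations_of_set (V - A). shuffles (fst p) (snd p))"
        using A partition_in_shuffles[of vs "\<lambda>v. v \<in> A"]
        by (auto simp: permutations_of_set_def)
    qed simp
    finally show ?thesis
      by simp
  qed
  have "ordering_sum V (conv \<phi> \<psi>) = (\<Sum>vs \<in> permutations_of_set V. \<Sum>A \<in> Pow V.
      chain rvar 0 vs * (?\<phi> (filter (\<lambda>v. v \<in> A) vs) * ?\<psi> (filter (\<lambda>v. v \<notin> A) vs)))"
    unfolding ordering_sum_def
  proof (rule sum.cong[OF refl])
    fix vs assume vs: "vs \<in> permutations_of_set V"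
    \<comment> \<open>Words are read from the last variable to the first, matching the reversed
      order of the factors in the monomial of \<open>J\<close>; filtering commutes with this
      reversal.\<close>
    then have "conv \<phi> \<psi> (map fst (rev vs)) = (\<Sum>A \<in> Pow V.
        \<phi> (map fst (filter (\<lambda>v. v \<in> A) (rev vs))) * \<psi> (map fst (filter (\<lambda>v. v \<notin> A) (rev vs))))"
      by (subst conv_distinct) (auto simp: permutations_of_set_def)
    then show "chain rvar 0 vs * rconst (conv \<phi> \<psi> (rev (map fst vs))) = (\<Sum>A \<in> Pow V.
        chain rvar 0 vs * (?\<phi> (filter (\<lambda>v. v \<in> A) vs) * ?\<psi> (filter (\<lambda>v. v \<notin> A) vs)))"
      by (simp add: rev_map[symmetric] rconst_sum rconst_mult sum_distrib_left flip: rev_filter)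
  qed
  also have "\<dots> = (\<Sum>A \<in> Pow V. \<Sum>vs \<in> permutations_of_set V.
      chain rvar 0 vs * (?\<phi> (filter (\<lambda>v. v \<in> A) vs) * ?\<psi> (filter (\<lambda>v. v \<notin> A) vs)))"
    by (rule sum.swap)
  finally show ?thesis
    by (simp add: *)
qed

lemma rename_chain:
  assumes "inj \<sigma>"
  shows "rename \<sigma> (chain rvar a vs) = chain rvar (rename \<sigma> a) (map \<sigma> vs)"
  using assms by (induction vs arbitrary: a)
    (simp_all add: rename_const rename_mult rename_divide rename_diff)

text \<open>A renaming that fixes upper indices permutes the orderings and leaves the words
  untouched. This gives both the symmetry of the resulting functions and their behaviour under
  \<open>Sym\<close>.\<close>

lemma rename_ordering_sum:
  assumes "inj \<sigma>" "\<And>v. fst (\<sigma> v) = fst v"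
  shows "rename \<sigma> (ordering_sum V \<phi>) = ordering_sum (\<sigma> ` V) \<phi>"
proof -
  have "permutations_of_set (\<sigma> ` V) = map \<sigma> ` permutations_of_set V"
  proof (intro subset_antisym subsetI)
    fix ws assume "ws \<in> permutations_of_set (\<sigma> ` V)"
    then have ws: "set ws = \<sigma> ` V" "distinct ws"
      by (auto dest: permutations_of_setD)
    have "ws = map \<sigma> (map (inv \<sigma>) ws)"
      using ws(1) by (auto simp: f_inv_into_f intro!: map_idI[symmetric])
    moreover have "map (inv \<sigma>) ws \<in> permutations_of_set V"
      using ws assms(1) by (auto intro!: permutations_of_setI inj_on_inv_into
          simp: distinct_map image_image)
    ultimately show "ws \<in> map \<sigma> ` permutations_of_set V"
      by blast
  next
    fix ws assume "ws \<in> map \<sigma> ` permutations_of_set V"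
    then show "ws \<in> permutations_of_set (\<sigma> ` V)"
      using assms(1) by (auto simp: permutations_of_set_def distinct_map intro: inj_on_subset[OF _ subset_UNIV])
  qed
  moreover have "fst \<circ> \<sigma> = fst"
    using assms(2) by auto
  moreover have "inj_on (map \<sigma>) S" for S
    using assms(1) by (auto intro: inj_on_subset[OF inj_mapI])
  ultimately show ?thesis
    using assms(1)
    by (simp add: ordering_sum_def sum.reindex rename_sum rename_mult rename_chain rename_const)
qed

lemma ratfuns_ordering_sum: "ordering_sum V \<phi> \<in> ratfuns V"
proof -
  have "chain rvar a vs \<in> ratfuns V" if "a \<in> ratfuns V" "set vs \<subseteq> V" for a vs
    using that
  proof (induction vs arbitrary: a)
    case Nil
    then show ?case
      using ratfuns_rconst[of 1 V] by (simp add: rconst_one)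
  next
    case (Cons v vs)
    then show ?case
      by (auto intro!: ratfuns_mult ratfuns_inverse ratfuns_diff ratfuns_rvar simp: divide_inverse)
  qed
  moreover have "0 \<in> ratfuns V"
    using ratfuns_rconst[of 0 V] by (simp add: rconst_zero)
  ultimately show ?thesis
    unfolding ordering_sum_def
    by (auto intro!: ratfuns_sum ratfuns_mult ratfuns_rconst simp: permutations_of_set_def)
qed


section \<open>Colour-preserving permutations and the star product\<close>

text \<open>The colour map is arbitrary, not just the upper index: colouring by the pair of upper
  index and membership in a subset turns stabilizers into groups of the same kind.\<close>

definition colour_perms :: "('v \<Rightarrow> 'c) \<Rightarrow> 'v set \<Rightarrow> ('v \<Rightarrow> 'v) set" where
  "colour_perms c V = {\<pi>. \<pi> permutes V \<and> (\<forall>v. c (\<pi> v) = c v)}"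

lemma G_colour_perms: "G r k = colour_perms fst (vars r k)"
  by (simp add: G_def colour_perms_def)

lemma finite_colour_perms: "finite V \<Longrightarrow> finite (colour_perms c V)"
  by (rule finite_subset[OF _ finite_permutations]) (auto simp: colour_perms_def)

text \<open>A permutation of \<open>insert a V\<close> is a permutation of \<open>V\<close> followed
  by a transposition involving \<open>a\<close>; the transposition preserves colours exactly when
  the image of \<open>a\<close> has the colour of \<open>a\<close>.\<close>

lemma colour_perms_insert:
  assumes "a \<notin> V"
  shows "colour_perms c (insert a V) =
    (\<lambda>(b, p). transpose a b \<circ> p) ` ({b \<in> insert a V. c b = c a} \<times> colour_perms c V)"
    (is "_ = ?f ` ?S")
proof (intro subset_antisym subsetI)
  fix \<pi> assume \<pi>: "\<pi> \<in> colour_perms c (insert a V)"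
  then have "\<pi> \<in> {\<pi>. \<pi> permutes insert a V}" and c: "\<And>v. c (\<pi> v) = c v"
    by (auto simp: colour_perms_def)
  then obtain b p where b: "b \<in> insert a V" and p: "p permutes V" and eq: "\<pi> = transpose a b \<circ> p"
    unfolding permutes_insert image_iff by (metis (no_types, lifting) case_prodD case_prodE mem_Collect_eq split_conv)
  have "\<pi> a = b"
    using permutes_not_in[OF p] assms eq by simp
  then have cb: "c b = c a"
    using c[of a] by simp
  have t: "c (transpose a b v) = c v" for v
    using cb by (simp add: transpose_def)
  have "c (p v) = c v" for v
    using c[of v] t by (simp add: eq)
  then show "\<pi> \<in> ?f ` ?S"
    using b p cb eq by (auto simp: colour_perms_def intro!: image_eqI[of _ _ "(b, p)"])
next
  fix \<pi> assume "\<pi> \<in> ?f ` ?S"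
  then obtain b p where b: "b \<in> insert a V" "c b = c a" and p: "p permutes V" "\<And>v. c (p v) = c v"
    and eq: "\<pi> = transpose a b \<circ> p"
    by (auto simp: colour_perms_def)
  have t: "c (transpose a b v) = c v" for v
    using b by (simp add: transpose_def)
  have "\<pi> permutes insert a V"
    unfolding eq by (rule permutes_compose[OF permutes_subset[OF p(1) subset_insertI] permutes_swap_id])
      (use b in auto)
  then show "\<pi> \<in> colour_perms c (insert a V)"
    using p t by (simp add: colour_perms_def eq)
qed

text \<open>Adding a point \<open>a\<close> multiplies the count by the number of possible images of
  \<open>a\<close>, which is the new size of its colour class. Colours in \<open>D\<close> that do
  not occur contribute \<open>fact 0\<close>.\<close>

lemma card_colour_perms:
  assumes "finite V" "finite D" "c ` V \<subseteq> D"
  shows "card (colour_perms c V) = (\<Prod>d \<in> D. fact (card {v \<in> V. c v = d}))"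
  using assms
proof (induction V rule: finite_induct)
  case empty
  have "colour_perms c {} = {id}"
    by (auto simp: colour_perms_def)
  then show ?case
    by simp
next
  case (insert a V)
  let ?n = "\<lambda>V d. card {v \<in> V. c v = d}"
  have inj: "inj_on (\<lambda>(b, p). transpose a b \<circ> p) ({b \<in> insert a V. c b = c a} \<times> colour_perms c V)"
  proof (rule inj_onI, clarsimp simp: colour_perms_def)
    fix b p b' p'
    assume *: "transpose a b \<circ> p = transpose a b' \<circ> p'" and "p permutes V" "p' permutes V"
    then have "p a = a" "p' a = a"
      using insert.hyps(2) by (auto dest: permutes_not_in)
    then have b: "b = b'"
      using fun_cong[OF *, of a] by simp
    have "p v = p' v" for v
      using fun_cong[OF *, of v] unfolding b o_apply by (rule transpose_eq_imp_eq)
    then show "b = b' \<and> p = p'"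
      using b by auto
  qed
  have "{b \<in> insert a V. c b = c a} = insert a {b \<in> V. c b = c a}"
    by auto
  then have eq: "?n (insert a V) (c a) = Suc (?n V (c a))"
    using insert.hyps by simp
  moreover have "card (colour_perms c (insert a V)) =
      card {b \<in> insert a V. c b = c a} * card (colour_perms c V)"
    unfolding colour_perms_insert[OF insert.hyps(2)] card_image[OF inj] by (rule card_cartesian_product)
  ultimately have "card (colour_perms c (insert a V)) =
      Suc (?n V (c a)) * (\<Prod>d \<in> D. fact (?n V d))"
    using insert.IH insert.prems by (simp only: insert_subset image_insert)
  also have "(\<Prod>d \<in> D. fact (?n V d)) = fact (?n V (c a)) * (\<Prod>d \<in> D - {c a}. fact (?n V d))"
    using insert.prems by (intro prod.remove) auto
  also have "Suc (?n V (c a)) * \<dots> = fact (?n (insert a V) (c a)) * (\<Prod>d \<in> D - {c a}. fact (?n (insert a V) d))"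
  proof -
    have "{v \<in> insert a V. c v = d} = {v \<in> V. c v = d}" if "d \<in> D - {c a}" for d
      using that by auto
    then have prod: "(\<Prod>d \<in> D - {c a}. fact (?n (insert a V) d)) = (\<Prod>d \<in> D - {c a}. fact (?n V d))"
      by (intro prod.cong refl) simp
    show ?thesis
      unfolding eq prod by (simp only: fact_Suc of_nat_id mult.assoc)
  qed
  also have "\<dots> = (\<Prod>d \<in> D. fact (?n (insert a V) d))"
    using insert.prems by (intro prod.remove[symmetric]) auto
  finally show ?case .
qed

lemma colour_bij_exists:
  assumes "finite A" "finite B" "\<And>d. card {v \<in> A. c v = d} = card {v \<in> B. c v = d}"
  shows "\<exists>g. bij_betw g A B \<and> (\<forall>v \<in> A. c (g v) = c v)"
proof -
  have "\<exists>g. bij_betw g {v \<in> A. c v = d} {v \<in> B. c v = d}" for d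
    by (rule finite_same_card_bij) (use assms in auto)
  then obtain g where g: "\<And>d. bij_betw (g d) {v \<in> A. c v = d} {v \<in> B. c v = d}"
    by metis
  have gv: "g (c v) v \<in> B \<and> c (g (c v) v) = c v" if "v \<in> A" for v
    using bij_betwE[OF g, of "c v"] that by auto
  have "bij_betw (\<lambda>v. g (c v) v) A B"
  proof (rule bij_betw_imageI)
    show "inj_on (\<lambda>v. g (c v) v) A"
    proof (rule inj_onI)
      fix v w assume vw: "v \<in> A" "w \<in> A" and eq: "g (c v) v = g (c w) w"
      then have "c v = c w"
        using gv by metis
      then show "v = w"
        using inj_onD[OF bij_betw_imp_inj_on[OF g, of "c v"], of v w] vw eq by simp
    qed
    show "(\<lambda>v. g (c v) v) ` A = B"
    proof (intro subset_antisym subsetI)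
      fix b assume "b \<in> B"
      then have "b \<in> g (c b) ` {v \<in> A. c v = c b}"
        using bij_betw_imp_surj_on[OF g, of "c b"] by auto
      then obtain v where "b = g (c b) v" "v \<in> A" "c v = c b"
        by auto
      then show "b \<in> (\<lambda>v. g (c v) v) ` A"
        by (intro image_eqI[of _ _ v]) simp_all
    qed (use gv in auto)
  qed
  then show ?thesis
    using gv by blast
qed

text \<open>Subsets with equally many points of each colour have complements with the same property,
  so colour-preserving bijections of the subsets and of the complements can be combined.\<close>

lemma colour_perms_transitive:
  assumes "finite V" "A \<subseteq> V" "B \<subseteq> V" "\<And>d. card {v \<in> A. c v = d} = card {v \<in> B. c v = d}"
  shows "\<exists>\<pi> \<in> colour_perms c V. \<pi> ` A = B"
proof -
  have fin: "finite A" "finite B"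
    using assms by (auto intro: finite_subset)
  obtain g where g: "bij_betw g A B" "\<And>v. v \<in> A \<Longrightarrow> c (g v) = c v"
    using colour_bij_exists[OF fin assms(4)] by blast
  have "card {v \<in> V - A. c v = d} = card {v \<in> V - B. c v = d}" for d
  proof -
    have "{v \<in> V - A. c v = d} = {v \<in> V. c v = d} - {v \<in> A. c v = d}"
      "{v \<in> V - B. c v = d} = {v \<in> V. c v = d} - {v \<in> B. c v = d}"
      by auto
    moreover have "{v \<in> A. c v = d} \<subseteq> {v \<in> V. c v = d}" "{v \<in> B. c v = d} \<subseteq> {v \<in> V. c v = d}"
      using assms by auto
    ultimately show ?thesis
      using fin assms(4)[of d] by (simp add: card_Diff_subset)
  qed
  then obtain g' where g': "bij_betw g' (V - A) (V - B)" "\<And>v. v \<in> V - A \<Longrightarrow> c (g' v) = c v"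
    using colour_bij_exists[of "V - A" "V - B" c] assms(1) by auto
  define \<pi> where "\<pi> v = (if v \<in> A then g v else if v \<in> V then g' v else v)" for v
  have "bij_betw \<pi> A B"
    using g(1) by (rule bij_betw_cong[THEN iffD1, rotated]) (simp add: \<pi>_def)
  moreover have "bij_betw \<pi> (V - A) (V - B)"
    using g'(1) by (rule bij_betw_cong[THEN iffD1, rotated]) (simp add: \<pi>_def)
  ultimately have "bij_betw \<pi> (A \<union> (V - A)) (B \<union> (V - B))"
    by (rule bij_betw_combine) auto
  moreover have "A \<union> (V - A) = V" "B \<union> (V - B) = V"
    using assms by auto
  ultimately have "\<pi> permutes V"
    using assms(2) by (intro bij_imp_permutes) (auto simp: \<pi>_def)
  moreover have "c (\<pi> v) = c v" for v
    using g(2) g'(2) by (simp add: \<pi>_def)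
  moreover have "\<pi> ` A = B"
    using \<open>bij_betw \<pi> A B\<close> by (rule bij_betw_imp_surj_on)
  ultimately show ?thesis
    by (auto simp: colour_perms_def)
qed

text \<open>Orbit counting: the orbit of \<open>A\<close> consists of the subsets with the same
  number of elements of each colour, and each of them is hit as often as the stabilizer of
  \<open>A\<close> has elements.\<close>

lemma sum_colour_perms_image:
  fixes F :: "'v set \<Rightarrow> 'k::comm_semiring_1"
  assumes "finite V" "A \<subseteq> V" "finite D" "c ` V \<subseteq> D"
  shows "(\<Sum>\<pi> \<in> colour_perms c V. F (\<pi> ` A)) =
    of_nat ((\<Prod>d \<in> D. fact (card {v \<in> A. c v = d})) * (\<Prod>d \<in> D. fact (card {v \<in> V - A. c v = d}))) *
    (\<Sum>B \<in> {B. B \<subseteq> V \<and> (\<forall>d. card {v \<in> B. c v = d} = card {v \<in> A. c v = d})}. F B)"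
    (is "_ = of_nat ?N * sum F ?T")
proof -
  let ?P = "colour_perms c V"
  have fin: "finite ?P"
    using assms(1) by (rule finite_colour_perms)
  have stab: "card {\<pi> \<in> ?P. \<pi> ` A = A} = ?N"
  proof -
    have "\<pi> ` A = A \<longleftrightarrow> (\<forall>v. \<pi> v \<in> A \<longleftrightarrow> v \<in> A)" if "\<pi> permutes V" for \<pi>
    proof
      assume "\<pi> ` A = A"
      then show "\<forall>v. \<pi> v \<in> A \<longleftrightarrow> v \<in> A"
        using inj_image_mem_iff[OF permutes_inj[OF that], of _ A] by auto
    next
      assume *: "\<forall>v. \<pi> v \<in> A \<longleftrightarrow> v \<in> A"
      show "\<pi> ` A = A"
      proof (intro subset_antisym subsetI)
        fix v assume "v \<in> A"
        then show "v \<in> \<pi> ` A"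
          using *[rule_format, of "inv \<pi> v"] permutes_inverses(1)[OF that]
          by (intro image_eqI[of _ _ "inv \<pi> v"]) simp_all
      qed (use * in auto)
    qed
    \<comment> \<open>Preserving \<open>A\<close> as a set means preserving a second colour,
      membership in \<open>A\<close>.\<close>
    then have "{\<pi> \<in> ?P. \<pi> ` A = A} = colour_perms (\<lambda>v. (c v, v \<in> A)) V"
      by (auto simp: colour_perms_def)
    then have "card {\<pi> \<in> ?P. \<pi> ` A = A} =
        (\<Prod>d \<in> D \<times> {True, False}. fact (card {v \<in> V. (c v, v \<in> A) = d}))"
      using assms by (simp only:) (rule card_colour_perms, auto)
    also have "\<dots> = (\<Prod>d \<in> D. fact (card {v \<in> V. c v = d \<and> v \<in> A}) * fact (card {v \<in> V. c v = d \<and> v \<notin> A}))"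
      using prod.Sigma[of D "\<lambda>_. {True, False}" "\<lambda>d t. fact (card {v \<in> V. (c v, v \<in> A) = (d, t)}) :: nat"]
        assms(3) by (simp add: case_prod_beta prod_eq_iff)
    also have "\<dots> = ?N"
      unfolding prod.distrib using assms(2)
      by (intro arg_cong2[of _ _ _ _ "(*)"] prod.cong arg_cong[of _ _ fact] arg_cong[of _ _ card]) auto
    finally show ?thesis .
  qed
  have type: "card {v \<in> \<pi> ` A. c v = d} = card {v \<in> A. c v = d}" if "\<pi> \<in> ?P" for \<pi> d
  proof -
    have "{v \<in> \<pi> ` A. c v = d} = \<pi> ` {v \<in> A. c v = d}"
      using that by (auto simp: colour_perms_def)
    then show ?thesis
      using that by (auto simp: colour_perms_def intro!: card_image inj_on_subset[OF permutes_inj])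
  qed
  have image: "(\<lambda>\<pi>. \<pi> ` A) ` ?P = ?T"
  proof (intro subset_antisym subsetI)
    fix B assume "B \<in> ?T"
    then show "B \<in> (\<lambda>\<pi>. \<pi> ` A) ` ?P"
      using colour_perms_transitive[of V A B c] assms by fastforce
  next
    fix B assume "B \<in> (\<lambda>\<pi>. \<pi> ` A) ` ?P"
    then obtain \<pi> where \<pi>: "\<pi> \<in> ?P" "B = \<pi> ` A"
      by blast
    then have "B \<subseteq> V"
      using assms(2) permutes_image[of \<pi> V] by (auto simp: colour_perms_def)
    then show "B \<in> ?T"
      using type \<pi> by auto
  qed
  have fibre: "card {\<pi> \<in> ?P. \<pi> ` A = B} = ?N" if "B \<in> ?T" for B
  proof -
    obtain \<pi>0 where \<pi>0: "\<pi>0 \<in> ?P" "\<pi>0 ` A = B"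
      using \<open>B \<in> ?T\<close> image by (metis (no_types, lifting) image_iff)
    then have perm: "\<pi>0 permutes V" and c: "\<And>v. c (\<pi>0 v) = c v"
      by (auto simp: colour_perms_def)
    have cinv: "c (inv \<pi>0 v) = c v" for v
      using c[of "inv \<pi>0 v"] perm by (simp add: permutes_inverses)
    \<comment> \<open>The permutations carrying \<open>A\<close> to \<open>B\<close> form a coset of
      the stabilizer of \<open>A\<close>.\<close>
    have "bij_betw (\<lambda>\<pi>. \<pi>0 \<circ> \<pi>) {\<pi> \<in> ?P. \<pi> ` A = A} {\<pi> \<in> ?P. \<pi> ` A = B}"
    proof (rule bij_betw_byWitness[where f' = "\<lambda>\<pi>. inv \<pi>0 \<circ> \<pi>"])
      show "(\<circ>) \<pi>0 ` {\<pi> \<in> ?P. \<pi> ` A = A} \<subseteq> {\<pi> \<in> ?P. \<pi> ` A = B}"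
      proof (rule image_subsetI)
        fix \<pi> assume "\<pi> \<in> {\<pi> \<in> ?P. \<pi> ` A = A}"
        then show "\<pi>0 \<circ> \<pi> \<in> {\<pi> \<in> ?P. \<pi> ` A = B}"
          unfolding mem_Collect_eq image_comp[symmetric] using \<pi>0(2) perm c
          by (simp add: colour_perms_def permutes_compose)
      qed
      have inv: "inv \<pi>0 ` B = A"
        using \<pi>0(2) perm by (auto simp: permutes_inverses image_image)
      show "(\<circ>) (inv \<pi>0) ` {\<pi> \<in> ?P. \<pi> ` A = B} \<subseteq> {\<pi> \<in> ?P. \<pi> ` A = A}"
      proof (rule image_subsetI)
        fix \<pi> assume "\<pi> \<in> {\<pi> \<in> ?P. \<pi> ` A = B}"
        then show "inv \<pi>0 \<circ> \<pi> \<in> {\<pi> \<in> ?P. \<pi> ` A = A}"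
          unfolding mem_Collect_eq image_comp[symmetric] using inv perm cinv
          by (simp add: colour_perms_def permutes_compose permutes_inv)
      qed
    qed (use perm in \<open>auto simp: fun_eq_iff permutes_inverses\<close>)
    then show ?thesis
      using stab by (simp add: bij_betw_same_card)
  qed
  have "(\<Sum>\<pi> \<in> ?P. F (\<pi> ` A)) = (\<Sum>B \<in> ?T. \<Sum>\<pi> \<in> {\<pi> \<in> ?P. \<pi> ` A = B}. F (\<pi> ` A))"
    using sum.image_gen[OF fin, of "\<lambda>\<pi>. F (\<pi> ` A)" "\<lambda>\<pi>. \<pi> ` A"] image by simp
  also have "\<dots> = (\<Sum>B \<in> ?T. of_nat ?N * F B)"
  proof (rule sum.cong[OF refl])
    fix B assume B: "B \<in> ?T"
    have "(\<Sum>\<pi> \<in> {\<pi> \<in> ?P. \<pi> ` A = B}. F (\<pi> ` A)) = (\<Sum>\<pi> \<in> {\<pi> \<in> ?P. \<pi> ` A = B}. F B)"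
      by (rule sum.cong) auto
    then show "(\<Sum>\<pi> \<in> {\<pi> \<in> ?P. \<pi> ` A = B}. F (\<pi> ` A)) = of_nat ?N * F B"
      using fibre[OF B] by simp
  qed
  finally show ?thesis
    by (simp add: sum_distrib_left)
qed

section \<open>Star products as sums over subsets of the variables\<close>

lemma finite_vars: "finite (vars r k)"
proof -
  have "vars r k = (SIGMA i:{1..r}. {1..k i})"
    by (auto simp: vars_def)
  then show ?thesis
    by simp
qed

definition multiplicity_of :: "var set \<Rightarrow> nat \<Rightarrow> nat" where
  "multiplicity_of A i = card {v \<in> A. fst v = i}"

lemma multiplicity_of_vars: "k \<in> nvec r \<Longrightarrow> multiplicity_of (vars r k) = k"
proof
  fix i assume k: "k \<in> nvec r"
  have "{v \<in> vars r k. fst v = i} = (if i \<in> {1..r} then Pair i ` {1..k i} else {})"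
    by (auto simp: vars_def)
  then show "multiplicity_of (vars r k) i = k i"
    using k by (auto simp: multiplicity_of_def card_image inj_on_def nvec_def)
qed

text \<open>The denominator in the star product is the order of the stabilizer of
  \<open>vars r k\<close> in the group for \<open>k + l\<close>, so the symmetrization becomes a sum
  over subsets without any factor. Its terms are those of multidegree \<open>k\<close> in
  \<open>ordering_sum_conv\<close>.\<close>

lemma star_ordering_sum:
  assumes k: "k \<in> nvec r" and l: "l \<in> nvec r"
  defines "V \<equiv> vars r (\<lambda>i. k i + l i)"
  shows "star r k l (ordering_sum (vars r k) \<phi>) (ordering_sum (vars r l) \<psi>) =
    (\<Sum>A \<in> {A \<in> Pow V. multiplicity_of A = k}. ordering_sum A \<phi> * ordering_sum (V - A) \<psi>)"
proof -
  let ?shift = "\<lambda>(i, j). (i, k i + j)" and ?A = "vars r k"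
  let ?F = "\<lambda>A. ordering_sum A \<phi> * ordering_sum (V - A) \<psi>"
  have AV: "?A \<subseteq> V"
    by (auto simp: V_def vars_def)
  have shift: "inj ?shift" "\<And>v. fst (?shift v) = fst v"
    by (auto simp: inj_on_def)
  \<comment> \<open>The renaming in the star product moves the variables of the right factor onto
    the complement of those of the left factor.\<close>
  have "?shift ` vars r l = V - ?A"
  proof (intro subset_antisym subsetI)
    fix v assume v: "v \<in> V - ?A"
    obtain i j where "v = (i, j)"
      by fastforce
    then show "v \<in> ?shift ` vars r l"
      using v by (auto simp: V_def vars_def intro!: image_eqI[of _ _ "(i, j - k i)"])
  qed (auto simp: V_def vars_def)
  then have g: "rename ?shift (ordering_sum (vars r l) \<psi>) = ordering_sum (V - ?A) \<psi>"
    using rename_ordering_sum[OF shift] by simp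
  have F: "rename \<pi> (?F ?A) = ?F (\<pi> ` ?A)" if \<pi>: "\<pi> \<in> colour_perms fst V" for \<pi>
  proof -
    have "inj \<pi>" "\<And>v. fst (\<pi> v) = fst v" "\<pi> ` V = V"
      using \<pi> by (auto simp: colour_perms_def permutes_inj permutes_image)
    then show ?thesis
      by (simp add: rename_mult rename_ordering_sum image_set_diff)
  qed
  have fin: "finite V"
    by (simp add: V_def finite_vars)
  have cardA: "card {v \<in> ?A. fst v = i} = k i" for i
    using multiplicity_of_vars[OF k] by (simp add: multiplicity_of_def fun_eq_iff)
  have cardB: "card {v \<in> V - ?A. fst v = i} = l i" for i
  proof -
    have "card {v \<in> V. fst v = i} = k i + l i"
      using multiplicity_of_vars[of "\<lambda>i. k i + l i" r] k l
      by (simp add: multiplicity_of_def fun_eq_iff V_def nvec_def)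
    moreover have "{v \<in> V - ?A. fst v = i} = {v \<in> V. fst v = i} - {v \<in> ?A. fst v = i}"
      by auto
    moreover have "{v \<in> ?A. fst v = i} \<subseteq> {v \<in> V. fst v = i}"
      using AV by auto
    ultimately show ?thesis
      using cardA[of i] finite_vars[of r k] by (simp add: card_Diff_subset)
  qed
  have "Sym r (\<lambda>i. k i + l i) (?F ?A) = (\<Sum>\<pi> \<in> colour_perms fst V. ?F (\<pi> ` ?A))"
    unfolding Sym_def G_colour_perms V_def[symmetric] by (rule sum.cong) (simp_all add: F)
  also have "\<dots> = of_nat (\<Prod>i = 1..r. fact (k i) * fact (l i)) *
      (\<Sum>A \<in> {A \<in> Pow V. multiplicity_of A = k}. ?F A)"
  proof -
    have "fst ` V \<subseteq> {1..r}"
      by (auto simp: V_def vars_def)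
    from sum_colour_perms_image[OF fin AV _ this, of ?F] show ?thesis
      unfolding cardA cardB by (simp add: prod.distrib multiplicity_of_def fun_eq_iff)
  qed
  finally have sym: "Sym r (\<lambda>i. k i + l i) (?F ?A) = of_nat (\<Prod>i = 1..r. fact (k i) * fact (l i)) *
      (\<Sum>A \<in> {A \<in> Pow V. multiplicity_of A = k}. ?F A)" .
  have "of_nat (\<Prod>i = 1..r. fact (k i) * fact (l i)) \<noteq> (0 :: rfun)"
    unfolding of_nat_eq_0_iff by simp
  then show ?thesis
    unfolding star_def g sym by (rule nonzero_mult_div_cancel_left)
qed


section \<open>Functionals on enveloping algebras\<close>

definition word_ext :: "('a list \<Rightarrow> complex) \<Rightarrow> ('a, complex) falg \<Rightarrow> complex" where
  "word_ext \<phi> = lin_ext (\<lambda>w c. c * \<phi> (letters w))"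

text \<open>The scalar extension of \<open>word_ext\<close>: it can be applied to identities in the
  tensor product of \<open>rfun\<close> with an enveloping algebra.\<close>

definition word_ext_rfun :: "('a list \<Rightarrow> complex) \<Rightarrow> ('a, rfun) falg \<Rightarrow> rfun" where
  "word_ext_rfun \<phi> = lin_ext (\<lambda>w c. c * rconst (\<phi> (letters w)))"

interpretation word_ext: additive_family "\<lambda>w c :: complex. c * \<phi> (letters w)" for \<phi>
  by standard (simp_all add: distrib_right)

interpretation word_ext_rfun: additive_family "\<lambda>w c. c * rconst (\<phi> (letters w))" for \<phi>
  by standard (simp_all add: distrib_right)

lemmas word_ext_add = word_ext.lin_ext_add[folded word_ext_def]
lemmas word_ext_zero = word_ext.lin_ext_zero[folded word_ext_def]
lemmas word_ext_single = word_ext.lin_ext_single[folded word_ext_def]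
lemmas word_ext_diff = lin_ext_diff[OF word_ext.additive_family_axioms, folded word_ext_def]
lemmas word_ext_rfun_single = word_ext_rfun.lin_ext_single[folded word_ext_rfun_def]
lemmas word_ext_rfun_sum = word_ext_rfun.lin_ext_sum[folded word_ext_rfun_def]
lemmas word_ext_rfun_diff = lin_ext_diff[OF word_ext_rfun.additive_family_axioms, folded word_ext_rfun_def]

lemma word_ext_rfun_tens: "word_ext_rfun \<phi> (tens f x) = f * rconst (word_ext \<phi> x)"
proof -
  have lookup: "Poly_Mapping.lookup (tens f x) w = f * rconst (Poly_Mapping.lookup x w)" for w
    by (simp add: tens_def Poly_Mapping.map.rep_eq when_def rconst_zero)
  then have keys: "Poly_Mapping.keys (tens f x) \<subseteq> Poly_Mapping.keys x"
    by (auto simp: in_keys_iff rconst_zero)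
  show ?thesis
    unfolding word_ext_rfun_def word_ext_rfun.lin_ext_superset[OF finite_keys keys]
    by (simp add: lookup word_ext_def lin_ext_def rconst_sum rconst_mult sum_distrib_left mult.assoc)
qed

lemma word_ext_mult_left:
  "word_ext \<phi> (Poly_Mapping.single w c * x) = c * word_ext (\<lambda>u. \<phi> (letters w @ u)) x"
  by (induction x rule: poly_mapping_single_induct)
    (simp_all add: mult_single word_ext_single word_ext_add distrib_left plus_fmon_def mult.assoc)

lemma word_ext_mult_right:
  "word_ext \<phi> (x * Poly_Mapping.single w c) = c * word_ext (\<lambda>u. \<phi> (u @ letters w)) x"
  by (induction x rule: poly_mapping_single_induct)
    (simp_all add: mult_single word_ext_single word_ext_add distrib_left distrib_right plus_fmon_def mult_ac)

lemma conv_linear: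
  shows "conv (\<lambda>u. \<phi> u + \<phi>' u) \<psi> w = conv \<phi> \<psi> w + conv \<phi>' \<psi> w"
    and "conv \<psi> (\<lambda>u. \<phi> u + \<phi>' u) w = conv \<psi> \<phi> w + conv \<psi> \<phi>' w"
    and "conv (\<lambda>u. \<phi> u - \<phi>' u) \<psi> w = conv \<phi> \<psi> w - conv \<phi>' \<psi> w"
    and "conv \<psi> (\<lambda>u. \<phi> u - \<phi>' u) w = conv \<psi> \<phi> w - conv \<psi> \<phi>' w"
    and "conv (\<lambda>u. c * \<phi> u) \<psi> w = c * conv \<phi> \<psi> w"
    and "conv \<psi> (\<lambda>u. c * \<phi> u) w = c * conv \<psi> \<phi> w"
  by (induction w arbitrary: \<phi> \<phi>' \<psi>) (simp_all add: algebra_simps)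

context lie_algebra
begin

lemma br_antisym: "br x y = - br y x"
proof -
  have "br x y + br y x = br (x + y) (x + y)"
    unfolding br_add_left br_add_right by (simp add: br_self)
  then show ?thesis
    by (simp add: br_self eq_neg_iff_add_eq_0)
qed

lemma br_zero [simp]: "br 0 x = 0" "br x 0 = 0"
  using br_add_left[of 0 0 x] br_add_right[of x 0 0] by simp_all

lemma br_minus: "br (- x) y = - br x y" "br x (- y) = - br x y"
  using br_add_left[of x "- x" y] br_add_right[of x y "- y"] by (simp_all add: eq_neg_iff_add_eq_0 add.commute)

lemma br_diff: "br (x - y) z = br x z - br y z" "br x (y - z) = br x y - br x z"
  using br_add_left[of x "- y" z] br_add_right[of x y "- z"] by (simp_all add: br_minus)

text \<open>The Jacobi identity in the form that the adjoint action is a representation.\<close>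

lemma br_br: "br (br x y) z = br x (br y z) - br y (br x z)"
proof -
  have "br z (br x y) = - (br x (br y z) + br y (br z x))"
    using jacobi[of x y z] by (simp only: eq_neg_iff_add_eq_0 add.commute)
  then show ?thesis
    using br_antisym[of "br x y" z] br_antisym[of z x] by (simp add: br_minus)
qed

lemma br_derivation: "br y (br x z) = br (br y x) z + br x (br y z)"
  by (simp add: br_br)

text \<open>A functional on words is the restriction of a linear functional on \<open>U(g)\<close> if and only if it
  respects the defining relations inside every word.\<close>

definition uea_functional :: "('g list \<Rightarrow> complex) \<Rightarrow> bool" where
  "uea_functional \<phi> \<longleftrightarrow> (\<forall>a b x y c.
     \<phi> (a @ (x + y) # b) = \<phi> (a @ x # b) + \<phi> (a @ y # b) \<and>
     \<phi> (a @ scale c x # b) = c * \<phi> (a @ x # b) \<and>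
     \<phi> (a @ br x y # b) = \<phi> (a @ x # y # b) - \<phi> (a @ y # x # b))"

lemma uea_functionalI:
  assumes "\<And>a b x y. \<phi> (a @ (x + y) # b) = \<phi> (a @ x # b) + \<phi> (a @ y # b)"
    and "\<And>a b x c. \<phi> (a @ scale c x # b) = c * \<phi> (a @ x # b)"
    and "\<And>a b x y. \<phi> (a @ br x y # b) = \<phi> (a @ x # y # b) - \<phi> (a @ y # x # b)"
  shows "uea_functional \<phi>"
  using assms by (simp add: uea_functional_def)

lemma uea_functionalD:
  assumes "uea_functional \<phi>"
  shows "\<phi> (a @ (x + y) # b) = \<phi> (a @ x # b) + \<phi> (a @ y # b)"
    and "\<phi> (a @ scale c x # b) = c * \<phi> (a @ x # b)"
    and "\<phi> (a @ br x y # b) = \<phi> (a @ x # y # b) - \<phi> (a @ y # x # b)"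
  using assms by (simp_all add: uea_functional_def)

lemmas uea_functional_hdD = uea_functionalD[where a = "[]", simplified]

lemma uea_functional_Cons:
  assumes "uea_functional \<phi>"
  shows "uea_functional (\<lambda>u. \<phi> (x # u))"
  by (rule uea_functionalI) (simp_all only: uea_functionalD[OF assms] flip: append_Cons)

lemma uea_functional_add:
  assumes "uea_functional \<phi>" "uea_functional \<psi>"
  shows "uea_functional (\<lambda>u. \<phi> u + \<psi> u)"
  by (rule uea_functionalI)
    (simp_all add: uea_functionalD[OF assms(1)] uea_functionalD[OF assms(2)] algebra_simps)

lemma uea_functional_scale:
  assumes "uea_functional \<phi>"
  shows "uea_functional (\<lambda>u. c * \<phi> u)"
  by (rule uea_functionalI) (simp_all add: uea_functionalD[OF assms] algebra_simps)

lemma uea_functional_counit: "uea_functional (\<lambda>u. if u = [] then 1 else 0)"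
  by (rule uea_functionalI) simp_all

text \<open>Letters are primitive, so in the difference of \<open>x # y\<close> and
  \<open>y # x\<close> the mixed terms, with \<open>x\<close> and \<open>y\<close> in different
  factors, cancel and a bracket behaves like a primitive letter. In other words, the defining ideal
  is compatible with the coproduct.\<close>

lemma uea_functional_conv:
  assumes "uea_functional \<phi>" "uea_functional \<psi>"
  shows "uea_functional (conv \<phi> \<psi>)"
proof (rule uea_functionalI)
  fix a b x y c
  show "conv \<phi> \<psi> (a @ (x + y) # b) = conv \<phi> \<psi> (a @ x # b) + conv \<phi> \<psi> (a @ y # b)"
    using assms
  proof (induction a arbitrary: \<phi> \<psi>)
    case Nil
    show ?case
      by (simp add: uea_functional_hdD[OF Nil(1)] uea_functional_hdD[OF Nil(2)] conv_linear)
  qed (simp add: uea_functional_Cons)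
  show "conv \<phi> \<psi> (a @ scale c x # b) = c * conv \<phi> \<psi> (a @ x # b)"
    using assms
  proof (induction a arbitrary: \<phi> \<psi>)
    case Nil
    show ?case
      by (simp add: uea_functional_hdD[OF Nil(1)] uea_functional_hdD[OF Nil(2)] conv_linear distrib_left)
  qed (simp add: uea_functional_Cons distrib_left)
  show "conv \<phi> \<psi> (a @ br x y # b) = conv \<phi> \<psi> (a @ x # y # b) - conv \<phi> \<psi> (a @ y # x # b)"
    using assms
  proof (induction a arbitrary: \<phi> \<psi>)
    case Nil
    show ?case
      by (simp add: uea_functional_hdD[OF Nil(1)] uea_functional_hdD[OF Nil(2)] conv_linear)
  qed (simp add: uea_functional_Cons)
qed

text \<open>These are the matrix coefficients of the adjoint representation: a word acts by the
  product of the operators of its letters.\<close>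

lemma uea_functional_adjoint:
  assumes "\<And>u v. \<xi> (u + v) = \<xi> u + \<xi> v" "\<And>c u. \<xi> (scale c u) = c * \<xi> u"
  shows "uea_functional (\<lambda>w. \<xi> (foldr br w v))"
proof -
  have "foldr br a (x + y) = foldr br a x + foldr br a y" "foldr br a (scale c x) = scale c (foldr br a x)"
    "foldr br a (x - y) = foldr br a x - foldr br a y" for a x y c
    by (induction a) (simp_all add: br_add_right br_scale_right br_diff)
  moreover have "\<xi> (x - y) = \<xi> x - \<xi> y" for x y
    using assms(1)[of "x - y" y] by (simp add: algebra_simps)
  ultimately show ?thesis
    using assms by (intro uea_functionalI) (simp_all add: br_add_left br_scale_left br_br)
qed

text \<open>The transpose of the derivation of the tensor algebra extending \<open>ad y\<close>.\<close>

fun lie_deriv :: "'g \<Rightarrow> ('g list \<Rightarrow> complex) \<Rightarrow> 'g list \<Rightarrow> complex" where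
  "lie_deriv y \<phi> [] = 0"
| "lie_deriv y \<phi> (x # w) = \<phi> (br y x # w) + lie_deriv y (\<lambda>u. \<phi> (x # u)) w"

lemma lie_deriv_linear:
  shows "lie_deriv y (\<lambda>u. \<phi> u + \<phi>' u) w = lie_deriv y \<phi> w + lie_deriv y \<phi>' w"
    and "lie_deriv y (\<lambda>u. \<phi> u - \<phi>' u) w = lie_deriv y \<phi> w - lie_deriv y \<phi>' w"
    and "lie_deriv y (\<lambda>u. c * \<phi> u) w = c * lie_deriv y \<phi> w"
  by (induction w arbitrary: \<phi> \<phi>') (simp_all add: algebra_simps)

text \<open>The derivation extending \<open>ad y\<close> maps defining relations to combinations of
  defining relations; for the bracket relation this is the Jacobi identity. With \<open>y\<close> in
  the Cartan subalgebra the operation detects weights.\<close>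

lemma uea_functional_lie_deriv:
  assumes "uea_functional \<phi>"
  shows "uea_functional (lie_deriv y \<phi>)"
proof (rule uea_functionalI)
  fix a b x z c
  show "lie_deriv y \<phi> (a @ (x + z) # b) = lie_deriv y \<phi> (a @ x # b) + lie_deriv y \<phi> (a @ z # b)"
    using assms
  proof (induction a arbitrary: \<phi>)
    case Nil
    show ?case
      by (simp only: append_Nil lie_deriv.simps br_add_right uea_functional_hdD(1)[OF Nil] lie_deriv_linear) simp
  next
    case (Cons u a)
    note IH = Cons.IH[OF uea_functional_Cons[OF Cons.prems], of u]
    show ?case
      using uea_functionalD(1)[OF Cons.prems, of "br y u # a"]
      by (simp only: append_Cons lie_deriv.simps IH) simp
  qed
  show "lie_deriv y \<phi> (a @ scale c x # b) = c * lie_deriv y \<phi> (a @ x # b)"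
    using assms
  proof (induction a arbitrary: \<phi>)
    case Nil
    show ?case
      by (simp only: append_Nil lie_deriv.simps br_scale_right uea_functional_hdD(2)[OF Nil]
          lie_deriv_linear distrib_left)
  next
    case (Cons u a)
    note IH = Cons.IH[OF uea_functional_Cons[OF Cons.prems], of u]
    show ?case
      using uea_functionalD(2)[OF Cons.prems, of "br y u # a"]
      by (simp only: append_Cons lie_deriv.simps IH distrib_left)
  qed
  show "lie_deriv y \<phi> (a @ br x z # b) = lie_deriv y \<phi> (a @ x # z # b) - lie_deriv y \<phi> (a @ z # x # b)"
    using assms
  proof (induction a arbitrary: \<phi>)
    case Nil
    have "\<phi> (br y (br x z) # b) = \<phi> (br (br y x) z # b) + \<phi> (br x (br y z) # b)"
      by (simp only: uea_functional_hdD(1)[OF Nil] br_derivation[of y x z])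
    moreover have "lie_deriv y (\<lambda>u. \<phi> (br x z # u)) b =
        lie_deriv y (\<lambda>u. \<phi> (x # z # u)) b - lie_deriv y (\<lambda>u. \<phi> (z # x # u)) b"
      by (simp only: uea_functional_hdD(3)[OF Nil] lie_deriv_linear)
    ultimately show ?case
      by (simp only: append_Nil lie_deriv.simps uea_functional_hdD(3)[OF Nil]) simp
  next
    case (Cons u a)
    note IH = Cons.IH[OF uea_functional_Cons[OF Cons.prems], of u]
    show ?case
      using uea_functionalD(3)[OF Cons.prems, of "br y u # a"]
      by (simp only: append_Cons lie_deriv.simps IH) simp
  qed
qed

lemma word_ext_uea_ideal:
  assumes "uea_functional \<phi>" "x \<in> uea_ideal scale br N"
  shows "word_ext \<phi> x = 0"
proof -
  \<comment> \<open>The induction over the ideal needs arbitrary surrounding words \<open>a\<close>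
    and \<open>b\<close>, since multiplication from either side enlarges them.\<close>
  have "word_ext (\<lambda>w. \<phi> (a @ w @ b)) x = 0" for a b
    using assms(2) unfolding uea_ideal_def
  proof (induction arbitrary: a b rule: ideal_gen.induct)
    case (ideal_base x)
    then show ?case
      using uea_functionalD[OF assms(1), of a _ _ b]
      by (auto simp: uea_relations_def gen_def word_ext_diff word_ext_add word_ext_single mult_single
          plus_fmon_def zero_fmon_def)
  next
    case ideal_zero
    then show ?case by (rule word_ext_zero)
  next
    case (ideal_add x y)
    then show ?case by (simp add: word_ext_add)
  next
    case (ideal_left p x)
    show ?case
    proof (induction p rule: poly_mapping_single_induct)
      case (single w c)
      show ?case
        using ideal_left.IH[of "a @ letters w" b] by (simp add: word_ext_mult_left)
    qed (simp add: word_ext_add distrib_right)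
  next
    case (ideal_right p x)
    show ?case
    proof (induction p rule: poly_mapping_single_induct)
      case (single w c)
      show ?case
        using ideal_right.IH[of a "letters w @ b"] by (simp add: word_ext_mult_right)
    qed (simp add: word_ext_add distrib_left)
  qed
  from this[of "[]" "[]"] show ?thesis
    by simp
qed

lemma word_ext_rfun_uea_ideal:
  assumes "uea_functional \<phi>" "X \<in> tens_sub (uea_ideal scale br N)"
  shows "word_ext_rfun \<phi> X = 0"
proof -
  obtain S \<rho> where X: "X = (\<Sum>x \<in> S. tens (\<rho> x) x)" and S: "S \<subseteq> uea_ideal scale br N"
    using assms(2) by (auto simp: tens_sub_def)
  have "word_ext \<phi> x = 0" if "x \<in> S" for x
    using word_ext_uea_ideal[OF assms(1)] S that by blast
  then show ?thesis
    unfolding X by (simp add: word_ext_rfun_sum word_ext_rfun_tens rconst_zero)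
qed

end

text \<open>Finite-dimensional duality: a space of functions on a finite set that is annihilated by
  no nonzero linear form realizes every function on that set. It turns separation properties into
  the existence of dual functionals.\<close>

lemma dual_family_exists:
  fixes S :: "('i \<Rightarrow> 'k::field) set"
  assumes "finite I"
    and sep: "\<And>c. (\<And>s. s \<in> S \<Longrightarrow> (\<Sum>i \<in> I. c i * s i) = 0) \<Longrightarrow> (\<And>i. i \<in> I \<Longrightarrow> c i = 0)"
    and zero: "(\<lambda>i. 0) \<in> S"
    and comb: "\<And>s t c. s \<in> S \<Longrightarrow> t \<in> S \<Longrightarrow> (\<lambda>i. s i + c * t i) \<in> S"
  shows "\<exists>s \<in> S. \<forall>i \<in> I. s i = t i"
  using assms(1) sep
proof (induction I arbitrary: t rule: finite_induct)
  case empty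
  then show ?case using zero by blast
next
  case (insert n I)
  note sep = insert.prems
  have "\<exists>s \<in> S. \<forall>i \<in> I. s i = t i" for t
  proof (rule insert.IH)
    fix c i assume *: "\<And>s. s \<in> S \<Longrightarrow> (\<Sum>i \<in> I. c i * s i) = 0" and i: "i \<in> I"
    have "(c(n := 0)) i = 0"
    proof (rule sep[of "c(n := 0)" i])
      fix s assume "s \<in> S"
      have "(\<Sum>i \<in> insert n I. (c(n := 0)) i * s i) = (\<Sum>i \<in> I. c i * s i)"
        using insert.hyps by (auto intro!: sum.cong)
      then show "(\<Sum>i \<in> insert n I. (c(n := 0)) i * s i) = 0"
        using *[OF \<open>s \<in> S\<close>] by simp
    qed (use i in simp)
    then show "c i = 0"
      using i insert.hyps by (auto split: if_splits)
  qed
  then have "\<forall>t. \<exists>s. s \<in> S \<and> (\<forall>i \<in> I. s i = t i)"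
    by blast
  then obtain dual where dual: "\<And>t. dual t \<in> S" "\<And>t i. i \<in> I \<Longrightarrow> dual t i = t i"
    by metis
  \<comment> \<open>The form \<open>?c\<close> expresses that the value at \<open>n\<close> is
    determined by the values on \<open>I\<close> through the elements dual to the points of
    \<open>I\<close>. Its coefficient at \<open>n\<close> is 1, so it cannot annihilate
    \<open>S\<close>.\<close>
  let ?e = "\<lambda>j i. if i = j then 1 else 0"
  let ?c = "\<lambda>i. if i = n then 1 else - dual (?e i) n"
  have "\<exists>s \<in> S. (\<Sum>i \<in> insert n I. ?c i * s i) \<noteq> 0"
  proof (rule ccontr)
    assume "\<not> ?thesis"
    then have "?c n = 0"
      by (intro sep[of ?c n]) auto
    then show False by simp
  qed
  then obtain s where s: "s \<in> S" "(\<Sum>i \<in> insert n I. ?c i * s i) \<noteq> 0"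
    by blast
  have sum_S: "(\<lambda>i. \<Sum>j \<in> J. a j * f j i) \<in> S" if "finite J" "\<And>j. j \<in> J \<Longrightarrow> f j \<in> S" for a f and J :: "'i set"
    using that
  proof (induction J rule: finite_induct)
    case empty
    then show ?case using zero by simp
  next
    case (insert j J)
    then show ?case
      using comb[of "\<lambda>i. \<Sum>j \<in> J. a j * f j i" "f j" "a j"] by (simp add: add.commute)
  qed
  \<comment> \<open>Removing from \<open>s\<close> its part along the dual elements leaves an
    element of \<open>S\<close> that vanishes on \<open>I\<close>; its value at \<open>n\<close> is
    the nonzero value of the form \<open>?c\<close> at \<open>s\<close>.\<close>
  define z where "z i = s i + (-1) * (\<Sum>j \<in> I. s j * dual (?e j) i)" for i
  have "(\<lambda>i. \<Sum>j \<in> I. s j * dual (?e j) i) \<in> S"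
    by (rule sum_S) (use insert.hyps dual(1) in auto)
  from comb[OF s(1) this, of "-1"] have "z \<in> S"
    unfolding z_def .
  have zI: "z i = 0" if "i \<in> I" for i
  proof -
    have "(\<Sum>j \<in> I. s j * dual (?e j) i) = (\<Sum>j \<in> I. if i = j then s j else 0)"
      using that dual(2) by (intro sum.cong) auto
    then show ?thesis
      using that insert.hyps by (simp add: z_def)
  qed
  have "(\<Sum>i \<in> insert n I. ?c i * s i) = s n + (\<Sum>i \<in> I. - dual (?e i) n * s i)"
    using insert.hyps by (simp, intro sum.cong) auto
  also have "\<dots> = z n"
    by (simp add: z_def sum_negf mult.commute)
  finally have zn: "z n \<noteq> 0"
    using s(2) by simp
  define u where "u i = dual t i + ((t n - dual t n) / z n) * z i" for i
  have "u \<in> S"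
    unfolding u_def by (rule comb[OF dual(1)[of t] \<open>z \<in> S\<close>, of "(t n - dual t n) / z n"])
  moreover have "u i = t i" if "i \<in> insert n I" for i
  proof (cases "i = n")
    case True
    show ?thesis
      unfolding True u_def using zn by simp
  next
    case False
    then have "i \<in> I"
      using that by simp
    then show ?thesis
      by (simp only: u_def zI dual(2) mult_zero_right add_0_right)
  qed
  ultimately show ?case
    by blast
qed


section \<open>Dual functionals of PBW monomials\<close>

text \<open>A convolution at \<open>w\<close> is a sum of products over the ways of splitting
  \<open>w\<close> into complementary subwords, and every such pair has \<open>w\<close> among its
  shuffles.\<close>

lemma conv_eq_0:
  assumes "\<And>u v. w \<in> shuffles u v \<Longrightarrow> \<phi> u * \<psi> v = 0"
  shows "conv \<phi> \<psi> w = 0"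
  using assms
proof (induction w arbitrary: \<phi> \<psi>)
  case (Cons x w)
  have "conv (\<lambda>u. \<phi> (x # u)) \<psi> w = 0" "conv \<phi> (\<lambda>u. \<psi> (x # u)) w = 0"
    by (intro Cons.IH Cons.prems Cons_in_shuffles_leftI Cons_in_shuffles_rightI; assumption)+
  then show ?case
    by simp
qed simp

lemma conv_only_Nil:
  assumes "\<And>u v. w \<in> shuffles u v \<Longrightarrow> u \<noteq> [] \<Longrightarrow> \<phi> u * \<psi> v = 0"
  shows "conv \<phi> \<psi> w = \<phi> [] * \<psi> w"
  using assms
proof (induction w arbitrary: \<phi> \<psi>)
  case (Cons x w)
  have "conv (\<lambda>u. \<phi> (x # u)) \<psi> w = 0"
    by (intro conv_eq_0 Cons.prems Cons_in_shuffles_leftI) simp_all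
  moreover have "conv \<phi> (\<lambda>u. \<psi> (x # u)) w = \<phi> [] * \<psi> (x # w)"
    by (intro Cons.IH Cons.prems Cons_in_shuffles_rightI; assumption)
  ultimately show ?case
    by simp
qed simp

text \<open>Splittings with one letter on the left correspond to positions, not to letters, so a
  repeated letter is counted repeatedly; this is the origin of the multiplicities below.\<close>

lemma conv_only_singleton:
  assumes "\<And>u v. w \<in> shuffles u v \<Longrightarrow> length u \<noteq> 1 \<Longrightarrow> \<phi> u * \<psi> v = 0"
  shows "conv \<phi> \<psi> w = (\<Sum>i<length w. \<phi> [w ! i] * \<psi> (take i w @ drop (Suc i) w))"
  using assms
proof (induction w arbitrary: \<phi> \<psi>)
  case Nil
  then show ?case
    using Nil[of "[]" "[]"] by simp
next
  case (Cons x w)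
  have "conv (\<lambda>u. \<phi> (x # u)) \<psi> w = \<phi> [x] * \<psi> w"
    by (intro conv_only_Nil Cons.prems Cons_in_shuffles_leftI) simp_all
  moreover have "conv \<phi> (\<lambda>u. \<psi> (x # u)) w =
      (\<Sum>i<length w. \<phi> [w ! i] * \<psi> (x # take i w @ drop (Suc i) w))"
    by (intro Cons.IH Cons.prems Cons_in_shuffles_rightI; assumption)
  ultimately show ?case
    by (simp add: sum.lessThan_Suc_shift del: sum.lessThan_Suc)
qed

text \<open>Removing an occurrence of \<open>l\<close> leaves the letter counts \<open>b\<close>
  exactly if \<open>w\<close> has one more \<open>l\<close> than \<open>b\<close> prescribes and
  agrees otherwise; \<open>l\<close> then occurs \<open>Suc (b l)\<close> times, which gives the
  factor.\<close>

lemma sum_delete_letter: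
  assumes \<phi>: "\<And>x. x \<in> set w \<Longrightarrow> \<phi> [x] = (if x = l then 1 else 0)"
    and \<psi>: "\<And>i. i < length w \<Longrightarrow>
      \<psi> (take i w @ drop (Suc i) w) = (if count_list (take i w @ drop (Suc i) w) = b then c else 0)"
  shows "(\<Sum>i<length w. \<phi> [w ! i] * \<psi> (take i w @ drop (Suc i) w)) =
    (if count_list w = b(l := Suc (b l)) then of_nat (Suc (b l)) * c else (0 :: complex))"
proof -
  have iff: "count_list (take i w @ drop (Suc i) w) = b \<longleftrightarrow> count_list w = b(l := Suc (b l))"
    if "i < length w" "w ! i = l" for i
  proof -
    have "count_list w = count_list (take i w @ l # drop (Suc i) w)"
      using id_take_nth_drop[OF that(1)] that(2) by simp
    also have "\<dots> = (count_list (take i w @ drop (Suc i) w))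
        (l := Suc (count_list (take i w @ drop (Suc i) w) l))"
      by (auto simp: fun_eq_iff)
    finally show ?thesis
      by (auto simp: fun_eq_iff)
  qed
  have "(\<Sum>i<length w. \<phi> [w ! i] * \<psi> (take i w @ drop (Suc i) w)) =
      (\<Sum>i<length w. if w ! i = l then (if count_list w = b(l := Suc (b l)) then c else 0) else 0)"
    using \<phi> \<psi> iff by (intro sum.cong refl) auto
  also have "\<dots> = (\<Sum>i | i < length w \<and> w ! i = l. if count_list w = b(l := Suc (b l)) then c else 0)"
    by (simp add: sum.inter_filter[symmetric])
  also have "\<dots> = of_nat (count_list w l) * (if count_list w = b(l := Suc (b l)) then c else 0)"
    by (simp add: count_list_eq_length_filter length_filter_conv_card eq_commute[of l])
  also have "\<dots> = (if count_list w = b(l := Suc (b l)) then of_nat (Suc (b l)) * c else 0)"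
    by simp
  finally show ?thesis .
qed

lemma count_list_eq_imp_mset_eq: "count_list u = count_list v \<Longrightarrow> mset u = mset v"
  by (rule multiset_eqI) (simp add: count_mset)

text \<open>The dual functionals are controlled on sorted words only; splitting a sorted word does
  not leave this class.\<close>

lemma sorted_shuffles:
  assumes "w \<in> shuffles u v" "sorted w"
  shows "sorted u \<and> sorted v"
  using assms
proof (induction u v arbitrary: w rule: shuffles.induct)
  case (3 x xs y ys)
  from 3(3) consider w' where "w = x # w'" "w' \<in> shuffles xs (y # ys)"
    | w' where "w = y # w'" "w' \<in> shuffles (x # xs) ys"
    by auto
  then show ?case
  proof cases
    case 1
    then show ?thesis
      using "3.IH"(1)[OF 1(2)] 3(4) set_shuffles[OF 1(2)] by auto
  next
    case 2
    then show ?thesis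
      using "3.IH"(2)[OF 2(2)] 3(4) set_shuffles[OF 2(2)] by auto
  qed
qed auto

section \<open>Exponent vectors as sorted words of indices\<close>

definition pbw_word :: "nat \<Rightarrow> (nat \<Rightarrow> nat) \<Rightarrow> nat list" where
  "pbw_word m p = concat (map (\<lambda>l. replicate (p l) l) [1..<Suc m])"

lemma count_list_pbw_word:
  fixes m :: nat
  shows "p \<in> nvec m \<Longrightarrow> count_list (pbw_word m p) = p"
proof
  fix i :: nat
  assume p: "p \<in> nvec m"
  have "count_list (replicate n a) i = (if a = i then n else 0)" for n and a :: nat
    by (induction n) auto
  moreover have "count_list (concat ls) i = (\<Sum>l\<leftarrow>ls. count_list l i)" for ls :: "nat list list"
    by (induction ls) auto
  ultimately have "count_list (pbw_word m p) i = (\<Sum>l\<leftarrow>[1..<Suc m]. if l = i then p l else 0)"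
    by (simp add: pbw_word_def o_def del: upt_Suc)
  also have "\<dots> = (\<Sum>l \<in> {1..m}. if l = i then p l else 0)"
    by (subst sum_list_distinct_conv_sum_set) (auto simp: atLeastLessThanSuc_atLeastAtMost simp del: upt_Suc)
  also have "\<dots> = p i"
    using p by (auto simp: nvec_def)
  finally show "count_list (pbw_word m p) i = p i" .
qed

lemma set_pbw_word: "set (pbw_word m p) \<subseteq> {1..m}"
  by (auto simp: pbw_word_def)

lemma length_pbw_word: "length (pbw_word m p) = (\<Sum>l = 1..m. p l)"
  by (simp add: pbw_word_def length_concat o_def sum_list_distinct_conv_sum_set
      atLeastLessThanSuc_atLeastAtMost del: upt_Suc)

lemma sorted_pbw_word: "sorted (pbw_word m p)"
proof -
  have "sorted (concat (map (\<lambda>l. replicate (p l) l) ls))" if "sorted ls" for ls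
    using that by (induction ls) (auto simp: sorted_append sorted_replicate)
  then show ?thesis
    by (simp add: pbw_word_def del: upt_Suc)
qed

lemma count_list_nvec: "set w \<subseteq> {1..m} \<Longrightarrow> count_list w \<in> nvec m"
  unfolding nvec_def by (auto simp: count_list_0_iff)

lemma pbw_word_count_list:
  assumes "sorted w" "set w \<subseteq> {1..m}"
  shows "pbw_word m (count_list w) = w"
  using count_list_pbw_word[OF count_list_nvec[OF assms(2)]] assms(1) sorted_pbw_word
  by (metis count_list_eq_imp_mset_eq properties_for_sort)

lemma sum_count_list:
  fixes m :: nat
  assumes "set w \<subseteq> {1..m}"
  shows "(\<Sum>l = 1..m. count_list w l) = length w"
  using sum_count_set[OF assms] by simp

lemma pbw_monomial_word: "pbw_monomial m F p = Poly_Mapping.single (Wd (map F (pbw_word m p))) 1"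
proof -
  have power: "gen x ^ n = (Poly_Mapping.single (Wd (replicate n x)) 1 :: ('a, complex) falg)" for x :: 'a and n
    by (induction n) (simp_all add: gen_def mult_single plus_fmon_def zero_fmon_def flip: single_one)
  have "prod_list (map (\<lambda>l. gen (F l) ^ p l) ls) = (Poly_Mapping.single (Wd (map F (concat (map (\<lambda>l. replicate (p l) l) ls)))) 1
      :: ('a, complex) falg)" for F :: "nat \<Rightarrow> 'a" and ls
    by (induction ls) (simp_all add: power mult_single plus_fmon_def zero_fmon_def flip: single_one)
  then show ?thesis
    by (simp only: pbw_monomial_def pbw_word_def)
qed

lemma finite_nvec_bounded: "finite {p \<in> nvec m. (\<Sum>l = 1..m. p l) \<le> n}"
proof (rule finite_subset)
  show "{p \<in> nvec m. (\<Sum>l = 1..m. p l) \<le> n} \<subseteq> {p. \<forall>l. (l \<in> {1..m} \<longrightarrow> p l \<in> {..n}) \<and> (l \<notin> {1..m} \<longrightarrow> p l = 0)}"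
  proof clarify
    fix p l assume p: "p \<in> nvec m" "(\<Sum>l = 1..m. p l) \<le> n"
    have "p l \<le> (\<Sum>l = 1..m. p l)" if "l \<in> {1..m}"
      using that by (intro member_le_sum) auto
    then show "(l \<in> {1..m} \<longrightarrow> p l \<in> {..n}) \<and> (l \<notin> {1..m} \<longrightarrow> p l = 0)"
      using p by (auto simp: nvec_def)
  qed
qed (rule finite_set_of_finite_funs, auto)

context lie_algebra
begin

text \<open>Products of functionals dual to the \<open>F l\<close> are triangular with respect to PBW monomials, because
  the letters are primitive; this yields their linear independence in characteristic zero.\<close>

lemma primitive_products:
  fixes m :: nat
  assumes prim: "\<And>l. l \<in> {1..m} \<Longrightarrow> uea_functional (prim l)" "\<And>l. l \<in> {1..m} \<Longrightarrow> prim l [] = 0"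
      "\<And>l j. l \<in> {1..m} \<Longrightarrow> j \<in> {1..m} \<Longrightarrow> prim l [F j] = (if j = l then 1 else 0)"
    and "set ls \<subseteq> {1..m}"
  shows "\<exists>\<phi> c. uea_functional \<phi> \<and> c \<noteq> 0 \<and> (\<forall>ws. set ws \<subseteq> {1..m} \<longrightarrow> length ws \<le> length ls \<longrightarrow>
    \<phi> (map F ws) = (if count_list ws = count_list ls then c else 0))"
  using assms(4)
proof (induction ls)
  case Nil
  show ?case
    by (intro exI[of _ "\<lambda>u. if u = [] then 1 else 0"] exI[of _ 1]) (simp add: uea_functional_counit)
next
  case (Cons l ls)
  then obtain \<phi> c where \<phi>: "uea_functional \<phi>" "c \<noteq> 0"
    and val: "\<And>ws. set ws \<subseteq> {1..m} \<Longrightarrow> length ws \<le> length ls \<Longrightarrow>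
      \<phi> (map F ws) = (if count_list ws = count_list ls then c else 0)"
    by auto
  have l: "l \<in> {1..m}"
    using Cons.prems by simp
  have "conv (prim l) \<phi> (map F ws) =
      (if count_list ws = count_list (l # ls) then of_nat (Suc (count_list ls l)) * c else 0)"
    if ws: "set ws \<subseteq> {1..m}" "length ws \<le> Suc (length ls)" for ws
  proof -
    have "(prim l \<circ> map F) u * (\<phi> \<circ> map F) v = 0" if uv: "ws \<in> shuffles u v" "length u \<noteq> 1" for u v
    proof (cases "u = []")
      case True
      then show ?thesis
        using prim(2)[OF l] by simp
    next
      case False
      \<comment> \<open>A left part of two or more letters leaves fewer letters on the right than
        \<open>ls\<close> has, and there \<open>\<phi>\<close> vanishes because the letter counts
        differ.\<close>
      then have "length u \<ge> 2"
        using uv(2) by (cases u) (auto simp: Suc_le_eq)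
      then have "length v < length ls"
        using length_shuffles[OF uv(1)] ws(2) by simp
      moreover from this have "count_list v \<noteq> count_list ls"
        using count_list_eq_imp_mset_eq mset_eq_length by fastforce
      moreover have "set v \<subseteq> {1..m}"
        using set_shuffles[OF uv(1)] ws(1) by auto
      ultimately show ?thesis
        using val[of v] by simp
    qed
    then have "conv (prim l) \<phi> (map F ws) = (\<Sum>i<length ws. (prim l \<circ> map F) [ws ! i] *
        (\<phi> \<circ> map F) (take i ws @ drop (Suc i) ws))"
      unfolding conv_map by (rule conv_only_singleton)
    also have "\<dots> = (if count_list ws = (count_list ls)(l := Suc (count_list ls l))
        then of_nat (Suc (count_list ls l)) * c else 0)"
    proof (rule sum_delete_letter)
      fix i assume i: "i < length ws"
      have "set (take i ws @ drop (Suc i) ws) \<subseteq> {1..m}"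
        using ws(1) set_take_subset[of i ws] set_drop_subset[of "Suc i" ws] by auto
      moreover have "length (take i ws @ drop (Suc i) ws) \<le> length ls"
        using i ws(2) by simp
      ultimately show "(\<phi> \<circ> map F) (take i ws @ drop (Suc i) ws) =
          (if count_list (take i ws @ drop (Suc i) ws) = count_list ls then c else 0)"
        using val unfolding o_apply by blast
    qed (use prim(3)[OF l] ws(1) in auto)
    also have "(count_list ls)(l := Suc (count_list ls l)) = count_list (l # ls)"
      by (auto simp: fun_eq_iff)
    finally show ?thesis .
  qed
  moreover have "uea_functional (conv (prim l) \<phi>)"
    using prim(1)[OF l] \<phi>(1) by (rule uea_functional_conv)
  moreover have "of_nat (Suc (count_list ls l)) * c \<noteq> 0"
    using \<phi>(2) of_nat_neq_0 by simp
  ultimately show ?case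
    unfolding length_Cons by blast
qed

text \<open>Suppose a linear form annihilates the values of all functionals at the PBW monomials of
  length at most \<open>n\<close>. The product of primitives belonging to a longest monomial in its
  support vanishes at the rest of the support, so the coefficient of that monomial is zero. Hence
  duality applies; the bound \<open>n\<close> keeps the set of exponent vectors finite.\<close>

lemma pbw_dual_exists:
  fixes m :: nat
  assumes prim: "\<And>l. l \<in> {1..m} \<Longrightarrow> uea_functional (prim l)" "\<And>l. l \<in> {1..m} \<Longrightarrow> prim l [] = 0"
      "\<And>l j. l \<in> {1..m} \<Longrightarrow> j \<in> {1..m} \<Longrightarrow> prim l [F j] = (if j = l then 1 else 0)"
  shows "\<exists>\<phi>. uea_functional \<phi> \<and> (\<forall>ws. set ws \<subseteq> {1..m} \<longrightarrow> sorted ws \<longrightarrow> length ws \<le> n \<longrightarrow>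
    \<phi> (map F ws) = (if count_list ws = b then 1 else 0))"
proof -
  define I where "I = {p \<in> nvec m. (\<Sum>l = 1..m. p l) \<le> n}"
  define S where "S = (\<lambda>\<phi> p. \<phi> (map F (pbw_word m p))) ` Collect uea_functional"
  have "\<exists>s \<in> S. \<forall>p \<in> I. s p = (if p = b then 1 else 0)"
  proof (rule dual_family_exists)
    show "finite I"
      unfolding I_def by (rule finite_nvec_bounded)
    have "uea_functional (\<lambda>u. 0)"
      by (rule uea_functionalI) simp_all
    then show "(\<lambda>p. 0) \<in> S"
      unfolding S_def by (intro image_eqI[of _ _ "\<lambda>u. 0"]) auto
    fix s t c assume "s \<in> S" "t \<in> S"
    then obtain \<phi> \<psi> where \<phi>: "uea_functional \<phi>" "s = (\<lambda>p. \<phi> (map F (pbw_word m p)))"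
      and \<psi>: "uea_functional \<psi>" "t = (\<lambda>p. \<psi> (map F (pbw_word m p)))"
      unfolding S_def by auto
    show "(\<lambda>i. s i + c * t i) \<in> S"
      unfolding S_def \<phi>(2) \<psi>(2)
      by (rule image_eqI[of _ _ "\<lambda>u. \<phi> u + c * \<psi> u"])
        (auto intro: uea_functional_add[OF \<phi>(1) uea_functional_scale[OF \<psi>(1)]])
  next
    fix c p
    assume ann: "\<And>s. s \<in> S \<Longrightarrow> (\<Sum>p \<in> I. c p * s p) = 0" and "p \<in> I"
    show "c p = 0"
    proof (rule ccontr)
      assume "c p \<noteq> 0"
      let ?size = "\<lambda>p. \<Sum>l = 1..m. p l"
      let ?K = "{p \<in> I. c p \<noteq> 0}"
      have "finite ?K"
        by (rule finite_subset[OF _ finite_nvec_bounded[of m n]]) (auto simp: I_def)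
      moreover have "p \<in> ?K"
        using \<open>p \<in> I\<close> \<open>c p \<noteq> 0\<close> by simp
      ultimately have "Max (?size ` ?K) \<in> ?size ` ?K"
        by (intro Max_in) auto
      \<comment> \<open>Maximal size is needed because \<open>primitive_products\<close> controls a
        functional only on words that are not longer than the one it is built from.\<close>
      then obtain q where "q \<in> ?K" "Max (?size ` ?K) = ?size q"
        by (elim imageE)
      then have q: "q \<in> ?K" "\<And>p. p \<in> ?K \<Longrightarrow> ?size p \<le> ?size q"
        using \<open>finite ?K\<close> Max_ge[of "?size ` ?K"] by simp_all
      obtain \<phi> d where \<phi>: "uea_functional \<phi>" "d \<noteq> 0"
        and val: "\<And>ws. set ws \<subseteq> {1..m} \<Longrightarrow> length ws \<le> length (pbw_word m q) \<Longrightarrow>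
          \<phi> (map F ws) = (if count_list ws = count_list (pbw_word m q) then d else 0)"
        using primitive_products[of m prim F "pbw_word m q", OF prim set_pbw_word] by auto
      have "(\<Sum>p \<in> I. c p * \<phi> (map F (pbw_word m p))) = (\<Sum>p \<in> I. if p = q then c q * d else 0)"
      proof (rule sum.cong[OF refl])
        fix p assume p: "p \<in> I"
        show "c p * \<phi> (map F (pbw_word m p)) = (if p = q then c q * d else 0)"
        proof (cases "c p = 0")
          case True
          then show ?thesis using q(1) by auto
        next
          case False
          then have "\<phi> (map F (pbw_word m p)) = (if p = q then d else 0)"
            using val[OF set_pbw_word, of p] q p by (simp add: length_pbw_word count_list_pbw_word I_def)
          then show ?thesis by simp
        qed
      qed
      also have "\<dots> = c q * d"
        using q(1) finite_nvec_bounded by (simp add: I_def)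
      also have "(\<Sum>p \<in> I. c p * \<phi> (map F (pbw_word m p))) = 0"
        using \<phi>(1) by (intro ann) (auto simp: S_def)
      finally show False
        using q(1) \<phi>(2) by simp
    qed
  qed
  then obtain \<phi> where \<phi>: "uea_functional \<phi>"
    "\<And>p. p \<in> I \<Longrightarrow> \<phi> (map F (pbw_word m p)) = (if p = b then 1 else 0)"
    unfolding S_def by auto
  have "\<phi> (map F ws) = (if count_list ws = b then 1 else 0)"
    if ws: "set ws \<subseteq> {1..m}" "sorted ws" "length ws \<le> n" for ws
  proof -
    have "count_list ws \<in> I"
      unfolding I_def using ws count_list_nvec sum_count_list by auto
    from \<phi>(2)[OF this] show ?thesis
      using pbw_word_count_list[OF ws(2,1)] by simp
  qed
  then show ?thesis
    using \<phi>(1) by blast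
qed

end

text \<open>The dual form of the coproduct of a PBW monomial: parts of a sorted word are sorted, so
  every splitting yields PBW monomials again, and the dual functionals multiply like divided powers.
  Parts are not longer than the word, so the bound \<open>n\<close> is inherited.\<close>

lemma conv_pbw_dual:
  fixes m :: nat
  assumes l: "l \<in> {1..m}"
    and \<phi>: "\<And>ws. set ws \<subseteq> {1..m} \<Longrightarrow> sorted ws \<Longrightarrow> length ws \<le> n \<Longrightarrow>
      \<phi> (map F ws) = (if count_list ws = (\<lambda>j. if j = l then 1 else 0) then 1 else 0)"
    and \<psi>: "\<And>ws. set ws \<subseteq> {1..m} \<Longrightarrow> sorted ws \<Longrightarrow> length ws \<le> n \<Longrightarrow>
      \<psi> (map F ws) = (if count_list ws = b then 1 else 0)"
    and ws: "set ws \<subseteq> {1..m}" "sorted ws" "length ws \<le> n"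
  shows "conv \<phi> \<psi> (map F ws) = (if count_list ws = b(l := Suc (b l)) then of_nat (Suc (b l)) else 0)"
proof -
  have "(\<phi> \<circ> map F) u * (\<psi> \<circ> map F) v = 0" if uv: "ws \<in> shuffles u v" "length u \<noteq> 1" for u v
  proof -
    have "set u \<subseteq> {1..m}" "sorted u" "length u \<le> n"
      using set_shuffles[OF uv(1)] sorted_shuffles[OF uv(1)] length_shuffles[OF uv(1)] ws by auto
    moreover have "count_list u \<noteq> (\<lambda>j. if j = l then 1 else 0)"
    proof
      assume "count_list u = (\<lambda>j. if j = l then 1 else 0)"
      also have "\<dots> = count_list [l]"
        by auto
      finally show False
        using uv(2) count_list_eq_imp_mset_eq mset_eq_length by fastforce
    qed
    ultimately show ?thesis
      using \<phi> by simp
  qed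
  then have "conv \<phi> \<psi> (map F ws) =
      (\<Sum>i<length ws. (\<phi> \<circ> map F) [ws ! i] * (\<psi> \<circ> map F) (take i ws @ drop (Suc i) ws))"
    unfolding conv_map by (rule conv_only_singleton)
  also have "\<dots> = (if count_list ws = b(l := Suc (b l)) then of_nat (Suc (b l)) * 1 else 0)"
  proof (rule sum_delete_letter)
    fix x assume "x \<in> set ws"
    then have "x \<in> {1..m}" "length [x] \<le> n"
      using ws length_pos_if_in_set[OF \<open>x \<in> set ws\<close>] by (auto simp del: length_greater_0_conv)
    moreover have "count_list [x] = (\<lambda>j. if j = l then 1 else 0) \<longleftrightarrow> x = l"
      by (auto simp: fun_eq_iff)
    ultimately show "(\<phi> \<circ> map F) [x] = (if x = l then 1 else 0)"
      using \<phi>[of "[x]"] by simp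
  next
    fix i assume i: "i < length ws"
    have "set (take i ws @ drop (Suc i) ws) \<subseteq> {1..m}"
      using ws(1) set_take_subset[of i ws] set_drop_subset[of "Suc i" ws] by auto
    moreover have "length (take i ws @ drop (Suc i) ws) \<le> n"
      using i ws(3) by simp
    moreover have "sorted (take i ws @ ws ! i # drop (Suc i) ws)"
      using ws(2) id_take_nth_drop[OF i] by simp
    then have "sorted (take i ws @ drop (Suc i) ws)"
      by (auto simp: sorted_append)
    ultimately show "(\<psi> \<circ> map F) (take i ws @ drop (Suc i) ws) =
        (if count_list (take i ws @ drop (Suc i) ws) = b then 1 else 0)"
      using \<psi> unfolding o_apply by blast
  qed
  finally show ?thesis
    by simp
qed


section \<open>Root spaces\<close>

context lie_algebra
begin

lemma br_sum: "br x (sum f I) = (\<Sum>i \<in> I. br x (f i))" "br (sum f I) x = (\<Sum>i \<in> I. br (f i) x)"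
  by (induction I rule: infinite_finite_induct) (simp_all add: br_add_left br_add_right)

text \<open>Applying \<open>br y\<close> minus the scalar \<open>w n y\<close> kills the
  \<open>n\<close>-th vector and multiplies the others by differences of weights, which shortens the
  sum.\<close>

lemma weight_vectors_independent:
  assumes "finite I"
    and "\<And>i y. i \<in> I \<Longrightarrow> y \<in> H \<Longrightarrow> br y (v i) = scale (w i y) (v i)"
    and "\<And>i j. i \<in> I \<Longrightarrow> j \<in> I \<Longrightarrow> i \<noteq> j \<Longrightarrow> \<exists>y \<in> H. w i y \<noteq> w j y"
    and "(\<Sum>i \<in> I. v i) = 0" "i \<in> I"
  shows "v i = 0"
  using assms
proof (induction I arbitrary: v i rule: finite_induct)
  case (insert n I)
  have I: "v j = 0" if j: "j \<in> I" for j
  proof -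
    obtain y where y: "y \<in> H" "w j y \<noteq> w n y"
      using insert.prems(2)[of j n] insert.hyps j by auto
    let ?v = "\<lambda>i. scale (w i y - w n y) (v i)"
    have "?v j = 0"
    proof (rule insert.IH[of ?v])
      fix i z assume "i \<in> I" "z \<in> H"
      then show "br z (?v i) = scale (w i z) (?v i)"
        using insert.prems(1) by (simp add: br_scale_right mult.commute)
    next
      have "(\<Sum>i \<in> insert n I. ?v i) = br y (\<Sum>i \<in> insert n I. v i) - scale (w n y) (\<Sum>i \<in> insert n I. v i)"
        using insert.prems(1) y(1)
        by (simp only: br_sum scale_sum_right scale_left_diff_distrib sum_subtractf cong: sum.cong)
      then show "(\<Sum>i \<in> I. ?v i) = 0"
        unfolding insert.prems(3) using insert.hyps by simp
    qed (use insert.prems(2) j in auto)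
    then show ?thesis
      using y(2) by simp
  qed
  then have "v n = 0"
    using insert.prems(3) insert.hyps by simp
  then show ?case
    using I insert.prems(4) by auto
qed simp

text \<open>Commuting diagonalizable operators: a joint eigenvector for \<open>Y\<close> is split
  into its components under \<open>ad y\<close>, and these remain eigenvectors for
  \<open>Y\<close>.\<close>

lemma simultaneous_eigenvectors_span:
  assumes comm: "\<And>x y. x \<in> h \<Longrightarrow> y \<in> h \<Longrightarrow> br x y = 0"
    and diag: "\<And>y. y \<in> h \<Longrightarrow> span {x. \<exists>c. br y x = scale c x} = UNIV"
    and "finite Y" "Y \<subseteq> h"
  shows "span {x. \<forall>y \<in> Y. \<exists>c. br y x = scale c x} = UNIV"
  using assms(3,4)
proof (induction Y rule: finite_induct)
  case (insert y Y)
  let ?E = "\<lambda>Y. {x. \<forall>y \<in> Y. \<exists>c. br y x = scale c x}"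
  have "?E Y \<subseteq> span (?E (insert y Y))"
  proof
    fix x assume x: "x \<in> ?E Y"
    let ?Ey = "{x. \<exists>c. br y x = scale c x}"
    have "x \<in> span ?Ey"
      using diag insert.prems by simp
    then have "\<exists>T a. x = (\<Sum>v \<in> T. scale (a v) v) \<and> finite T \<and> T \<subseteq> ?Ey"
      unfolding span_explicit by (rule CollectD)
    then obtain T a where T: "x = (\<Sum>v \<in> T. scale (a v) v)" "finite T" "T \<subseteq> ?Ey"
      by (elim exE conjE)
    have "\<forall>v \<in> T. \<exists>c. br y v = scale c v"
      using T(3) by (simp only: subset_eq mem_Collect_eq)
    then obtain c where c: "\<And>v. v \<in> T \<Longrightarrow> br y v = scale (c v) v"
      by (elim bchoice[THEN exE]) blast
    define z where "z d = (\<Sum>v \<in> {v \<in> T. c v = d}. scale (a v) v)" for d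
    have xz: "x = (\<Sum>d \<in> c ` T. z d)"
      unfolding T(1) z_def by (rule sum.image_gen[OF T(2)])
    have yz: "br y (z d) = scale d (z d)" for d
      unfolding z_def br_sum scale_sum_right
      by (rule sum.cong) (auto simp: br_scale_right c mult.commute)
    have "z d \<in> ?E (insert y Y)" if d: "d \<in> c ` T" for d
    proof -
      have "\<exists>\<mu>. br y' (z d) = scale \<mu> (z d)" if y': "y' \<in> Y" for y'
      proof -
        obtain \<mu> where \<mu>: "br y' x = scale \<mu> x"
          using x y' by blast
        \<comment> \<open>\<open>?u d\<close> measures the failure of \<open>z d\<close> to be an
          eigenvector with eigenvalue \<open>\<mu>\<close>. By commutativity it stays in the
          eigenspace of \<open>ad y\<close> for \<open>d\<close>, and these vectors sum to
          zero.\<close>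
        let ?u = "\<lambda>d. br y' (z d) - scale \<mu> (z d)"
        have swap: "br y (br y' u) = br y' (br y u)" for u
          using br_br[of y y' u] comm[of y y'] insert.prems y' by auto
        have "?u d = 0"
        proof (rule weight_vectors_independent[where I = "c ` T" and H = "{y}" and w = "\<lambda>d _. d"])
          show "(\<Sum>d \<in> c ` T. ?u d) = 0"
            using \<mu> unfolding xz by (simp add: br_sum scale_sum_right sum_subtractf)
          show "br y'' (?u i) = scale i (?u i)" if "y'' \<in> {y}" for i y''
            using that by (simp add: br_diff br_scale_right swap yz scale_right_diff_distrib mult.commute)
        qed (use T d in auto)
        then show ?thesis
          by auto
      qed
      then show ?thesis
        using yz by blast
    qed
    then show "x \<in> span (?E (insert y Y))"
      unfolding xz by (intro span_sum span_base)
  qed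
  then have "span (?E Y) \<subseteq> span (?E (insert y Y))"
    by (intro span_minimal subspace_span)
  then show ?case
    using insert by auto
qed simp

lemma cartanD:
  assumes "cartan_subalgebra scale br h"
  shows "subspace h"
    and "\<And>x y. x \<in> h \<Longrightarrow> y \<in> h \<Longrightarrow> br x y = 0"
    and "\<And>y. y \<in> h \<Longrightarrow> span {x. \<exists>c. br y x = scale c x} = UNIV"
  using assms by (auto simp: cartan_subalgebra_def)

end

text \<open>A basis diagonalizing the whole Cartan subalgebra. Its coordinates supply linear
  functionals for matrix coefficients and traces for the Killing form.\<close>

locale weight_basis = simple_lie_algebra +
  fixes h B
  assumes cartan: "cartan_subalgebra scale br h"
    and finite_B: "finite B" and indep_B: "independent B" and span_B: "span B = UNIV"
    and weight_B: "b \<in> B \<Longrightarrow> \<forall>y \<in> h. \<exists>c. br y b = scale c b"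

context simple_lie_algebra
begin

text \<open>The centre is an ideal, and it is not everything because the bracket is not identically
  zero.\<close>

lemma center_trivial:
  assumes "\<And>v. br x v = 0"
  shows "x = 0"
proof -
  let ?Z = "{x. \<forall>v. br x v = 0}"
  have "?Z = {0} \<or> ?Z = UNIV"
  proof (rule only_trivial_ideals)
    show "subspace ?Z"
      by (rule subspaceI) (auto simp: br_add_left br_scale_left)
    show "br x y \<in> ?Z" if "y \<in> ?Z" for x y
      using that br_antisym[of x y] by auto
  qed
  then show ?thesis
    using assms nonabelian by auto
qed

text \<open>A finite basis \<open>Y\<close> of \<open>h\<close> is diagonalized simultaneously. The
  elements that act on a given vector by a scalar form a subspace, so the result extends from
  \<open>Y\<close> to \<open>h\<close>.\<close>

lemma weight_basis_exists:
  assumes "cartan_subalgebra scale br h"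
  shows "\<exists>B. weight_basis scale br h B"
proof -
  obtain S where S: "finite S" "span S = UNIV"
    using finite_dim by blast
  obtain Y where Y: "Y \<subseteq> h" "independent Y" "h \<subseteq> span Y"
    using maximal_independent_subset by blast
  have "finite Y"
    using independent_span_bound[OF S(1) Y(2)] S(2) by simp
  let ?W = "{x. \<forall>y \<in> h. \<exists>c. br y x = scale c x}"
  have "x \<in> ?W" if x: "\<forall>y \<in> Y. \<exists>c. br y x = scale c x" for x
  proof -
    have "subspace {y. \<exists>c. br y x = scale c x}"
    proof (rule subspaceI)
      show "0 \<in> {y. \<exists>c. br y x = scale c x}"
        by (auto intro: exI[of _ 0])
    next
      fix y y' assume "y \<in> {y. \<exists>c. br y x = scale c x}" "y' \<in> {y. \<exists>c. br y x = scale c x}"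
      then obtain c c' where "br y x = scale c x" "br y' x = scale c' x"
        by blast
      then show "y + y' \<in> {y. \<exists>c. br y x = scale c x}"
        by (auto simp: br_add_left scale_left_distrib intro!: exI[of _ "c + c'"])
    qed (auto simp: br_scale_left)
    then have "span Y \<subseteq> {y. \<exists>c. br y x = scale c x}"
      using x by (intro span_minimal) auto
    then show ?thesis
      using Y(3) by blast
  qed
  then have "{x. \<forall>y \<in> Y. \<exists>c. br y x = scale c x} \<subseteq> ?W"
    by blast
  from span_mono[OF this] have W: "span ?W = UNIV"
    using simultaneous_eigenvectors_span[OF cartanD(2,3)[OF assms] \<open>finite Y\<close> Y(1)] by blast
  obtain B where B: "B \<subseteq> ?W" "independent B" "?W \<subseteq> span B"
    using maximal_independent_subset by blast
  have "span ?W \<subseteq> span B"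
    using B(3) by (intro span_minimal subspace_span)
  then have span: "span B = UNIV"
    unfolding W by (rule top.extremum_uniqueI)
  have fin: "finite B"
    using independent_span_bound[OF S(1) B(2)] S(2) by simp
  have weights: "\<forall>y \<in> h. \<exists>c. br y b = scale c b" if "b \<in> B" for b
    using subsetD[OF B(1) that] by (simp only: mem_Collect_eq)
  show ?thesis
    by (intro exI[of _ B] weight_basis.intro weight_basis_axioms.intro simple_lie_algebra_axioms
        assms fin B(2) span weights)
qed

end

section \<open>Coordinates, traces and the Killing form\<close>

context weight_basis
begin

definition coord where
  "coord b v = representation B v b"

lemma coord_hom:
  shows coord_add: "coord b (u + v) = coord b u + coord b v"
    and coord_scale: "coord b (scale c v) = c * coord b v"
    and coord_diff: "coord b (u - v) = coord b u - coord b v"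
    and coord_sum: "coord b (sum f I) = (\<Sum>i \<in> I. coord b (f i))"
    and coord_zero: "coord b 0 = 0"
  using indep_B span_B
  by (simp_all add: coord_def representation_add representation_scale representation_diff
      representation_sum representation_zero)

lemma coord_expand: "(\<Sum>b \<in> B. scale (coord b v) b) = v"
  unfolding coord_def using indep_B span_B finite_B by (intro sum_representation_eq) auto

lemma coord_basis: "b \<in> B \<Longrightarrow> coord b b = 1"
  using indep_B by (simp add: coord_def representation_basis)

lemma coord_eq_0: "(\<And>b. b \<in> B \<Longrightarrow> coord b v = 0) \<Longrightarrow> v = 0"
  using coord_expand[of v] by simp

lemma basis_nonzero: "b \<in> B \<Longrightarrow> b \<noteq> 0"
  using coord_basis coord_zero by force

definition trace where
  "trace T = (\<Sum>b \<in> B. coord b (T b))"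

lemma trace_commute:
  assumes "\<And>u v. T (u + v) = T u + T v" "\<And>c u. T (scale c u) = scale c (T u)"
    and "\<And>u v. S (u + v) = S u + S v" "\<And>c u. S (scale c u) = scale c (S u)"
  shows "trace (\<lambda>v. S (T v)) = trace (\<lambda>v. T (S v))"
proof -
  have zero: "S 0 = 0" "T 0 = 0"
    using assms(2)[of 0 0] assms(4)[of 0 0] by simp_all
  have sum: "S (sum f I) = (\<Sum>i \<in> I. S (f i))" "T (sum f I) = (\<Sum>i \<in> I. T (f i))" for f and I :: "'a set"
    by (induction I rule: infinite_finite_induct) (simp_all add: assms zero)
  have S: "coord b (S (T b)) = (\<Sum>c \<in> B. coord c (T b) * coord b (S c))" for b
    by (subst coord_expand[of "T b", symmetric]) (simp only: sum assms coord_sum coord_scale)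
  have T: "coord b (T (S b)) = (\<Sum>c \<in> B. coord c (S b) * coord b (T c))" for b
    by (subst coord_expand[of "S b", symmetric]) (simp only: sum assms coord_sum coord_scale)
  have "trace (\<lambda>v. S (T v)) = (\<Sum>b \<in> B. \<Sum>c \<in> B. coord c (T b) * coord b (S c))"
    by (simp add: trace_def S)
  also have "\<dots> = (\<Sum>c \<in> B. \<Sum>b \<in> B. coord c (T b) * coord b (S c))"
    by (rule sum.swap)
  also have "\<dots> = trace (\<lambda>v. T (S v))"
    by (simp add: trace_def T mult.commute)
  finally show ?thesis .
qed

definition killing where
  "killing x z = trace (\<lambda>v. br x (br z v))"

lemma killing_hom:
  shows killing_add_left: "killing (x + y) z = killing x z + killing y z"
    and killing_scale_left: "killing (scale c x) z = c * killing x z"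
    and killing_sum_right: "killing x (sum f I) = (\<Sum>i \<in> I. killing x (f i))"
    and killing_scale_right: "killing x (scale c z) = c * killing x z"
  by (simp_all add: killing_def trace_def br_add_left br_add_right br_scale_left br_scale_right
      br_sum coord_hom sum.distrib sum_distrib_left)
    (rule sum.swap)

text \<open>After the nested brackets are expanded, the two sides differ in one term only, and there
  cyclicity of the trace moves \<open>br y\<close> from the front to the end.\<close>

lemma killing_invariant: "killing (br x y) z = killing x (br y z)"
proof -
  have "killing (br x y) z = trace (\<lambda>v. br x (br y (br z v))) - trace (\<lambda>v. br y (br x (br z v)))"
    by (simp add: killing_def trace_def br_br coord_diff sum_subtractf)
  moreover have "killing x (br y z) = trace (\<lambda>v. br x (br y (br z v))) - trace (\<lambda>v. br x (br z (br y v)))"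
    by (simp add: killing_def trace_def br_br br_diff coord_diff sum_subtractf)
  moreover have "trace (\<lambda>v. br y (br x (br z v))) = trace (\<lambda>v. br x (br z (br y v)))"
    by (rule trace_commute) (simp_all add: br_add_right br_scale_right)
  ultimately show ?thesis
    by simp
qed

lemma killing_minus_left: "killing (- x) z = - killing x z"
  using killing_scale_left[of "-1" x z] by simp

text \<open>An element on which all simple roots take the value \<open>1\<close> acts with integral eigenvalues, the
  heights, so its square has positive trace.\<close>

lemma killing_nonzero:
  assumes simple: "simple_roots scale br h r \<alpha>" and \<beta>: "\<beta> \<in> positive_roots scale br h r \<alpha>"
  shows "\<exists>\<rho>. killing \<rho> \<rho> \<noteq> 0"
proof -
  have dual: "\<alpha> i \<in> dual_space scale h" if "i \<in> {1..r}" for i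
    using simple that by (auto simp: simple_roots_def roots_def)
  \<comment> \<open>Linear independence of the simple roots makes evaluation at points of
    \<open>h\<close> surjective onto all tuples of values; here the constant tuple 1 is hit.\<close>
  have "\<exists>s \<in> (\<lambda>y i. if i \<in> {1..r} then \<alpha> i y else 0) ` h. \<forall>i \<in> {1..r}. s i = 1"
  proof (rule dual_family_exists)
    fix c i assume ann: "\<And>s. s \<in> (\<lambda>y i. if i \<in> {1..r} then \<alpha> i y else 0) ` h \<Longrightarrow> (\<Sum>i \<in> {1..r}. c i * s i) = 0"
    have "\<forall>y \<in> h. (\<Sum>i = 1..r. c i * \<alpha> i y) = 0"
    proof
      fix y assume "y \<in> h"
      have "(\<Sum>i = 1..r. c i * \<alpha> i y) = (\<Sum>i = 1..r. c i * (if i \<in> {1..r} then \<alpha> i y else 0))"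
        by (rule sum.cong) auto
      then show "(\<Sum>i = 1..r. c i * \<alpha> i y) = 0"
        using ann[OF imageI[OF \<open>y \<in> h\<close>]] by simp
    qed
    moreover assume "i \<in> {1..r}"
    ultimately show "c i = 0"
      using simple unfolding simple_roots_def by blast
  next
    have "\<alpha> i 0 = 0" if "i \<in> {1..r}" for i
    proof -
      have "\<alpha> i (scale 0 0) = 0 * \<alpha> i 0"
        using dual[OF that] subspace_0[OF cartanD(1)[OF cartan]] unfolding dual_space_def by blast
      then show ?thesis by simp
    qed
    then have "(\<lambda>i. if i \<in> {1..r} then \<alpha> i 0 else 0) = (\<lambda>i. 0)"
      by auto
    from this[symmetric] show "(\<lambda>i. 0) \<in> (\<lambda>y i. if i \<in> {1..r} then \<alpha> i y else 0) ` h"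
      by (rule image_eqI) (rule subspace_0[OF cartanD(1)[OF cartan]])
  next
    fix s t c
    assume "s \<in> (\<lambda>y i. if i \<in> {1..r} then \<alpha> i y else 0) ` h" "t \<in> (\<lambda>y i. if i \<in> {1..r} then \<alpha> i y else 0) ` h"
    then obtain y z where y: "y \<in> h" "s = (\<lambda>i. if i \<in> {1..r} then \<alpha> i y else 0)"
      and z: "z \<in> h" "t = (\<lambda>i. if i \<in> {1..r} then \<alpha> i z else 0)"
      by blast
    have cz: "scale c z \<in> h"
      using subspace_scale[OF cartanD(1)[OF cartan]] z(1) by blast
    have "\<alpha> i (y + scale c z) = \<alpha> i y + c * \<alpha> i z" if "i \<in> {1..r}" for i
      using dual[OF that] y(1) z(1) cz by (simp add: dual_space_def)
    then have "(\<lambda>i. s i + c * t i) = (\<lambda>i. if i \<in> {1..r} then \<alpha> i (y + scale c z) else 0)"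
      by (auto simp: y z)
    then show "(\<lambda>i. s i + c * t i) \<in> (\<lambda>y i. if i \<in> {1..r} then \<alpha> i y else 0) ` h"
      by (rule image_eqI) (rule subspace_add[OF cartanD(1)[OF cartan] y(1) cz])
  qed simp
  then obtain \<rho> where \<rho>: "\<rho> \<in> h" "\<And>i. i \<in> {1..r} \<Longrightarrow> \<alpha> i \<rho> = 1"
    by auto
  have "\<exists>n :: nat. br \<rho> (br \<rho> b) = scale (of_nat (n * n)) b \<and> (n = 0 \<longrightarrow> br \<rho> b = 0)" if b: "b \<in> B" for b
  proof -
    have b0: "b \<noteq> 0"
      using b by (rule basis_nonzero)
    obtain w where w: "\<And>y. y \<in> h \<Longrightarrow> br y b = scale (w y) b"
      using weight_B[OF b] by metis
    \<comment> \<open>Roots are extensional functions, so the weight is cut off outside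
      \<open>h\<close> to become comparable with them.\<close>
    let ?w = "restrict w h"
    have add: "w (x + y) = w x + w y" if xy: "x \<in> h" "y \<in> h" for x y
    proof -
      have "scale (w (x + y)) b = scale (w x + w y) b"
        using w[OF xy(1)] w[OF xy(2)] w[OF subspace_add[OF cartanD(1)[OF cartan] xy]]
        by (simp add: br_add_left scale_left_distrib)
      then show ?thesis
        using b0 by simp
    qed
    have scl: "w (scale c x) = c * w x" if x: "x \<in> h" for c x
    proof -
      have "scale (w (scale c x)) b = scale (c * w x) b"
        using w[OF x] w[OF subspace_scale[OF cartanD(1)[OF cartan] x, of c]] by (auto simp: br_scale_left)
      then show ?thesis
        using b0 by simp
    qed
    have "?w \<in> dual_space scale h"
      using add scl subspace_add[OF cartanD(1)[OF cartan]] subspace_scale[OF cartanD(1)[OF cartan]]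
      by (simp add: dual_space_def)
    moreover have "b \<in> root_space scale br h ?w"
      using w by (simp add: root_space_def)
    ultimately have root: "?w \<in> roots scale br h" if "\<exists>y \<in> h. w y \<noteq> 0"
      using that b0 by (auto simp: roots_def)
    \<comment> \<open>The weight is zero or a root; for a root, the value at \<open>\<rho>\<close>
      is up to sign the sum of its coefficients in the simple roots.\<close>
    have "\<exists>n :: nat. w \<rho> = of_nat n \<or> w \<rho> = - of_nat n"
    proof (cases "\<exists>y \<in> h. w y \<noteq> 0")
      case True
      then obtain c :: "nat \<Rightarrow> nat" where
        "(\<forall>y \<in> h. ?w y = (\<Sum>i = 1..r. of_nat (c i) * \<alpha> i y)) \<or>
         (\<forall>y \<in> h. ?w y = - (\<Sum>i = 1..r. of_nat (c i) * \<alpha> i y))"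
        using simple root unfolding simple_roots_def by blast
      then have "w \<rho> = of_nat (\<Sum>i = 1..r. c i) \<or> w \<rho> = - of_nat (\<Sum>i = 1..r. c i)"
        using \<rho> by auto
      then show ?thesis
        by blast
    next
      case False
      then show ?thesis
        using \<rho>(1) by (intro exI[of _ 0]) auto
    qed
    then obtain n :: nat where n: "w \<rho> = of_nat n \<or> w \<rho> = - of_nat n"
      by blast
    then show ?thesis
      using w[OF \<rho>(1)] by (intro exI[of _ n]) (auto simp: br_scale_right)
  qed
  then obtain n :: "'a \<Rightarrow> nat" where n: "\<And>b. b \<in> B \<Longrightarrow> br \<rho> (br \<rho> b) = scale (of_nat (n b * n b)) b"
    "\<And>b. b \<in> B \<Longrightarrow> n b = 0 \<Longrightarrow> br \<rho> b = 0"
    by metis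
  have K: "killing \<rho> \<rho> = of_nat (\<Sum>b \<in> B. n b * n b)"
    by (simp add: killing_def trace_def n(1) coord_scale coord_basis)
  \<comment> \<open>Otherwise \<open>\<rho>\<close> would act as zero, but on a root vector of
    \<open>\<beta>\<close> it acts by the sum of the coefficients of \<open>\<beta>\<close>, which
    is positive.\<close>
  have "\<exists>b \<in> B. n b \<noteq> 0"
  proof (rule ccontr)
    assume "\<not> ?thesis"
    then have zero: "br \<rho> v = 0" for v
      using n(2) by (subst coord_expand[of v, symmetric]) (simp add: br_sum br_scale_right)
    obtain c :: "nat \<Rightarrow> nat" where c: "\<And>y. y \<in> h \<Longrightarrow> \<beta> y = (\<Sum>i = 1..r. of_nat (c i) * \<alpha> i y)"
      and "\<beta> \<in> roots scale br h"
      using \<beta> unfolding positive_roots_def by blast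
    then obtain y x where y: "y \<in> h" "\<beta> y \<noteq> 0" and x: "x \<in> root_space scale br h \<beta>" "x \<noteq> 0"
      unfolding roots_def by blast
    have "scale (\<beta> \<rho>) x = 0"
      using x(1) \<rho>(1) zero[of x] by (simp add: root_space_def)
    then have "\<beta> \<rho> = 0"
      using x(2) by simp
    then have "(of_nat (\<Sum>i = 1..r. c i) :: complex) = 0"
      using c[OF \<rho>(1)] \<rho>(2) by simp
    then have "\<forall>i \<in> {1..r}. c i = 0"
      unfolding of_nat_eq_0_iff by simp
    then have "\<beta> y = 0"
      using c[OF y(1)] by simp
    then show False
      using y(2) by simp
  qed
  then have "(\<Sum>b \<in> B. n b * n b) \<noteq> 0"
    using finite_B by simp
  then show ?thesis
    unfolding K[symmetric] using K of_nat_eq_0_iff by metis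
qed

text \<open>The radical of the Killing form is a proper ideal, hence zero, so a root vector of
  \<open>\<beta>\<close> pairs nontrivially with some weight vector. By invariance that vector has
  the weight opposite to \<open>\<beta>\<close>.\<close>

lemma negative_root_space_nontrivial:
  assumes simple: "simple_roots scale br h r \<alpha>" and \<beta>: "\<beta> \<in> positive_roots scale br h r \<alpha>"
  shows "\<exists>z \<in> n_beta scale br h \<beta>. z \<noteq> 0"
proof -
  obtain x where x: "\<And>y. y \<in> h \<Longrightarrow> br y x = scale (\<beta> y) x" "x \<noteq> 0"
    using \<beta> by (auto simp: positive_roots_def roots_def root_space_def)
  let ?R = "{x. \<forall>z. killing x z = 0}"
  have "?R = {0} \<or> ?R = UNIV"
  proof (rule only_trivial_ideals)
    show "subspace ?R"
      using killing_scale_left[of 0 0]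
      by (intro subspaceI) (auto simp: killing_add_left killing_scale_left)
    show "br x y \<in> ?R" if "y \<in> ?R" for x y
      using that killing_invariant[of y x] killing_minus_left[of "br y x"] br_antisym[of x y] by simp
  qed
  moreover have "?R \<noteq> UNIV"
    using killing_nonzero[OF assms] by auto
  ultimately obtain z where z: "killing x z \<noteq> 0"
    using x(2) by blast
  have "killing x z = (\<Sum>b \<in> B. coord b z * killing x b)"
    by (subst coord_expand[of z, symmetric]) (simp add: killing_sum_right killing_scale_right)
  then have "\<exists>b \<in> B. killing x b \<noteq> 0"
    using z by (intro ccontr[of "\<exists>b \<in> B. killing x b \<noteq> 0"]) simp
  then obtain b where b: "b \<in> B" "killing x b \<noteq> 0"
    by blast
  have "br y b = scale (- \<beta> y) b" if y: "y \<in> h" for y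
  proof -
    obtain c where c: "br y b = scale c b"
      using weight_B[OF b(1)] y by blast
    have "\<beta> y * killing x b = killing (br y x) b"
      by (simp add: x(1)[OF y] killing_scale_left)
    also have "\<dots> = - killing x (br y b)"
      unfolding br_antisym[of y x] killing_minus_left killing_invariant ..
    also have "\<dots> = - c * killing x b"
      by (simp add: c killing_scale_right)
    finally have "\<beta> y = - c"
      by (rule mult_right_cancel[OF b(2), THEN iffD1])
    then show ?thesis
      using c by simp
  qed
  then have "b \<in> n_beta scale br h \<beta>"
    by (simp add: n_beta_def root_space_def)
  then show ?thesis
    using basis_nonzero[OF b(1)] by blast
qed

text \<open>A linear form annihilating all values of such functionals gives a combination of the
  \<open>F l\<close> that acts as zero in the adjoint representation. It is zero because the centre
  is trivial, and weight vectors of distinct weights are independent, so the form is zero and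
  duality applies.\<close>

lemma dual_functionals_exist:
  fixes F :: "nat \<Rightarrow> 'a"
  assumes "\<And>l y. l \<in> {1..m} \<Longrightarrow> y \<in> h \<Longrightarrow> br y (F l) = scale (w l y) (F l)"
    and "\<And>l. l \<in> {1..m} \<Longrightarrow> F l \<noteq> 0"
    and "\<And>l j. l \<in> {1..m} \<Longrightarrow> j \<in> {1..m} \<Longrightarrow> l \<noteq> j \<Longrightarrow> \<exists>y \<in> h. w l y \<noteq> w j y"
  shows "\<exists>\<phi>. uea_functional \<phi> \<and> \<phi> [] = 0 \<and> (\<forall>l \<in> {1..m}. \<phi> [F l] = t l)"
proof -
  let ?S = "(\<lambda>\<phi> l. \<phi> [F l]) ` {\<phi>. uea_functional \<phi> \<and> \<phi> [] = 0}"
  have "\<exists>s \<in> ?S. \<forall>l \<in> {1..m}. s l = t l"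
  proof (rule dual_family_exists)
    have "uea_functional (\<lambda>u. 0)"
      by (rule uea_functionalI) simp_all
    then show "(\<lambda>l. 0) \<in> ?S"
      by (intro image_eqI[of _ _ "\<lambda>u. 0"]) auto
  next
    fix s u c assume "s \<in> ?S" "u \<in> ?S"
    then obtain \<phi> \<psi> where \<phi>: "uea_functional \<phi>" "\<phi> [] = 0" "s = (\<lambda>l. \<phi> [F l])"
      and \<psi>: "uea_functional \<psi>" "\<psi> [] = 0" "u = (\<lambda>l. \<psi> [F l])"
      by auto
    show "(\<lambda>l. s l + c * u l) \<in> ?S"
      unfolding \<phi>(3) \<psi>(3) using \<phi>(2) \<psi>(2)
      by (intro image_eqI[of _ _ "\<lambda>w. \<phi> w + c * \<psi> w"])
        (auto intro: uea_functional_add[OF \<phi>(1) uea_functional_scale[OF \<psi>(1)]])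
  next
    fix c l
    assume ann: "\<And>s. s \<in> ?S \<Longrightarrow> (\<Sum>l \<in> {1..m}. c l * s l) = 0" and l: "l \<in> {1..m}"
    define x where "x = (\<Sum>l \<in> {1..m}. scale (c l) (F l))"
    have "br x v = 0" for v
    proof (rule coord_eq_0)
      fix b
      \<comment> \<open>The multiple of the counit removes the value of the matrix coefficient at
        the empty word.\<close>
      let ?\<phi> = "\<lambda>w. coord b (foldr br w v) + (- coord b v) * (if w = [] then 1 else 0)"
      have "uea_functional ?\<phi>"
        by (intro uea_functional_add uea_functional_scale uea_functional_counit uea_functional_adjoint)
          (simp_all add: coord_add coord_scale)
      then have "(\<Sum>l \<in> {1..m}. c l * ?\<phi> [F l]) = 0"
        by (intro ann image_eqI[of _ _ ?\<phi>]) auto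
      then show "coord b (br x v) = 0"
        by (simp add: x_def br_sum br_scale_left coord_sum coord_scale)
    qed
    then have "x = 0"
      by (rule center_trivial)
    have "scale (c l) (F l) = 0"
    proof (rule weight_vectors_independent[where I = "{1..m}" and H = h and w = w and v = "\<lambda>l. scale (c l) (F l)"])
      show "br y (scale (c i) (F i)) = scale (w i y) (scale (c i) (F i))" if "i \<in> {1..m}" "y \<in> h" for i y
        using assms(1)[OF that] by (simp add: br_scale_right mult.commute)
    qed (use assms(3) \<open>x = 0\<close> l in \<open>auto simp: x_def\<close>)
    then show "c l = 0"
      using assms(2)[OF l] by simp
  qed simp
  then show ?thesis
    by blast
qed

end


section \<open>Contents\<close>

lemma sum_list_count:
  fixes n :: nat and g :: "nat \<Rightarrow> 'k::semiring_1"
  assumes "set w \<subseteq> {1..n}"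
  shows "(\<Sum>x\<leftarrow>w. g x) = (\<Sum>x = 1..n. of_nat (count_list w x) * g x)"
  using assms
proof (induction w)
  case (Cons j w)
  have "(\<Sum>i = 1..n. of_nat (count_list (j # w) i) * g i) =
      (\<Sum>i = 1..n. of_nat (count_list w i) * g i + (if j = i then g i else 0))"
    by (rule sum.cong) (auto simp: distrib_right add.commute)
  also have "\<dots> = (\<Sum>i = 1..n. of_nat (count_list w i) * g i) + g j"
    using Cons.prems by (simp add: sum.distrib)
  finally show ?case
    using Cons by (simp add: add.commute)
qed simp

lemma map_letters_mult: "map_letters f (x * y) = map_letters f x * map_letters f (y :: ('a, 'k::comm_ring_1) falg)"
  unfolding map_letters_push
proof (rule push_mult)
  show "map_fmon f (a + b) = map_fmon f a + map_fmon f b" for a b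
    by (cases a; cases b) (simp add: plus_fmon_def)
qed

lemma letters_map_fmon: "letters (map_fmon f w) = map f (letters w)"
  by (cases w) simp

lemma multideg_mult:
  assumes "u \<in> multideg r k" "v \<in> multideg r l"
  shows "u * v \<in> multideg r (\<lambda>i. k i + l i)"
proof -
  have "set (letters w) \<subseteq> {1..r} \<and> (\<forall>i \<in> {1..r}. count_list (letters w) i = k i + l i)"
    if w: "w \<in> Poly_Mapping.keys (u * v)" for w
  proof -
    obtain a b where "w = a + b" "a \<in> Poly_Mapping.keys u" "b \<in> Poly_Mapping.keys v"
      using w keys_mult[of u v] by blast
    then show ?thesis
      using assms by (auto simp: multideg_def free_alg_def plus_fmon_def)
  qed
  then show ?thesis
    by (auto simp: multideg_def free_alg_def)
qed

lemma map_letters_free_alg: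
  assumes "u \<in> multideg r k" "\<And>i. i \<in> {1..r} \<Longrightarrow> f i \<in> N"
  shows "map_letters f u \<in> free_alg N"
  unfolding free_alg_def
proof (intro CollectI ballI subsetI)
  fix w x assume w: "w \<in> Poly_Mapping.keys (map_letters f u)" and x: "x \<in> set (letters w)"
  have "w \<in> map_fmon f ` Poly_Mapping.keys u"
    using w unfolding map_letters_push by (rule subsetD[OF keys_push])
  then obtain v where v: "v \<in> Poly_Mapping.keys u" "w = map_fmon f v"
    by (elim imageE)
  then have "set (letters v) \<subseteq> {1..r}"
    using assms(1) by (auto simp: multideg_def free_alg_def)
  then show "x \<in> N"
    using x v assms(2) by (auto simp: letters_map_fmon)
qed

lemma word_ext_map_letters:
  "word_ext \<phi> (map_letters f u) =
    (\<Sum>w \<in> Poly_Mapping.keys u. Poly_Mapping.lookup u w * \<phi> (map f (letters w)))"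
  by (simp add: map_letters_def word_ext_def word_ext.lin_ext_sum letters_map_fmon)

context lie_algebra
begin

lemma has_content_mult:
  assumes f: "\<And>i. i \<in> {1..r} \<Longrightarrow> f i \<in> N" and y: "y \<in> free_alg N"
    and "has_content scale br N r f x k" "has_content scale br N r f y l"
  shows "has_content scale br N r f (x * y) (\<lambda>i. k i + l i)"
proof -
  obtain u v where u: "u \<in> multideg r k" "x - map_letters f u \<in> uea_ideal scale br N"
    and v: "v \<in> multideg r l" "y - map_letters f v \<in> uea_ideal scale br N"
    using assms unfolding has_content_def by blast
  have "x * y - map_letters f (u * v) =
      (x - map_letters f u) * y + map_letters f u * (y - map_letters f v)"
    by (simp add: map_letters_mult algebra_simps)
  also have "\<dots> \<in> uea_ideal scale br N"
    using u(2) v(2) y map_letters_free_alg[OF u(1), of f N] f unfolding uea_ideal_def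
    by (simp add: ideal_add ideal_left ideal_right)
  finally show ?thesis
    using multideg_mult[OF u(1) v(1)] unfolding has_content_def by blast
qed

lemma has_content_one: "has_content scale br N r f 1 (\<lambda>i. 0)"
proof -
  have "1 \<in> multideg r (\<lambda>i. 0)"
    by (simp add: multideg_def free_alg_def zero_fmon_def)
  moreover have "map_letters f 1 = (1 :: (_, complex) falg)"
    by (simp add: map_letters_push push_single zero_fmon_def flip: single_one)
  ultimately show ?thesis
    unfolding has_content_def uea_ideal_def by (intro bexI[of _ 1]) (simp_all add: ideal_zero)
qed

lemma has_content_word:
  assumes f: "\<And>i. i \<in> {1..r} \<Longrightarrow> f i \<in> N" and F: "\<And>l. l \<in> set ls \<Longrightarrow> F l \<in> N"
    and "\<And>l. l \<in> set ls \<Longrightarrow> has_content scale br N r f (gen (F l)) (kk l)"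
  shows "has_content scale br N r f (Poly_Mapping.single (Wd (map F ls)) 1) (\<lambda>i. \<Sum>l\<leftarrow>ls. kk l i)"
  using assms(2,3)
proof (induction ls)
  case Nil
  then show ?case
    using has_content_one by (simp add: zero_fmon_def flip: single_one)
next
  case (Cons l ls)
  let ?w = "Poly_Mapping.single (Wd (map F ls)) (1 :: complex)"
  have "has_content scale br N r f (gen (F l) * ?w) (\<lambda>i. kk l i + (\<Sum>l\<leftarrow>ls. kk l i))"
    using Cons f by (intro has_content_mult) (auto simp: free_alg_def)
  then show ?case
    by (simp add: gen_def mult_single plus_fmon_def)
qed

lemma lie_deriv_map:
  assumes "uea_functional \<phi>" "\<And>l. l \<in> set ls \<Longrightarrow> br y (F l) = scale (c l) (F l)"
  shows "lie_deriv y \<phi> (map F ls) = (\<Sum>l\<leftarrow>ls. c l) * \<phi> (map F ls)"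
  using assms
proof (induction ls arbitrary: \<phi>)
  case (Cons l ls)
  then show ?case
    using uea_functional_hdD(2)[OF Cons.prems(1), of "c l" "F l" "map F ls"]
    by (simp add: uea_functional_Cons distrib_right)
qed simp

text \<open>The word in the \<open>F l\<close> and its representative of multidegree
  \<open>k\<close> in the \<open>f i\<close> agree modulo the ideal, so \<open>\<phi>\<close> and
  its Lie derivative take the same values on both. On each side the derivative multiplies by the
  total weight, and the nonzero value of \<open>\<phi>\<close> cancels.\<close>

lemma has_content_weight:
  assumes \<phi>: "uea_functional \<phi>" "\<phi> (map F ls) \<noteq> 0"
    and "has_content scale br N r f (Poly_Mapping.single (Wd (map F ls)) 1) k"
    and f: "\<And>i. i \<in> {1..r} \<Longrightarrow> br y (f i) = scale (a i) (f i)"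
    and F: "\<And>l. l \<in> set ls \<Longrightarrow> br y (F l) = scale (c l) (F l)"
  shows "(\<Sum>l\<leftarrow>ls. c l) = (\<Sum>i = 1..r. of_nat (k i) * a i)"
proof -
  let ?F = "Poly_Mapping.single (Wd (map F ls)) (1 :: complex)"
  let ?a = "\<Sum>i = 1..r. of_nat (k i) * a i"
  obtain u where u: "u \<in> multideg r k" "?F - map_letters f u \<in> uea_ideal scale br N"
    using assms(3) unfolding has_content_def by blast
  have eq: "\<psi> (map F ls) = word_ext \<psi> (map_letters f u)" if "uea_functional \<psi>" for \<psi>
    using word_ext_uea_ideal[OF that u(2)] by (simp add: word_ext_diff word_ext_single)
  have "lie_deriv y \<phi> (map f (letters w)) = ?a * \<phi> (map f (letters w))" if "w \<in> Poly_Mapping.keys u" for w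
  proof -
    have w: "set (letters w) \<subseteq> {1..r}" "\<And>i. i \<in> {1..r} \<Longrightarrow> count_list (letters w) i = k i"
      using u(1) that by (auto simp: multideg_def free_alg_def)
    have "lie_deriv y \<phi> (map f (letters w)) = (\<Sum>i\<leftarrow>letters w. a i) * \<phi> (map f (letters w))"
      using w(1) f by (intro lie_deriv_map[OF \<phi>(1)]) auto
    then show ?thesis
      using w by (simp add: sum_list_count)
  qed
  then have "word_ext (lie_deriv y \<phi>) (map_letters f u) = ?a * word_ext \<phi> (map_letters f u)"
    by (simp add: word_ext_map_letters sum_distrib_left mult.left_commute)
  then have "lie_deriv y \<phi> (map F ls) = ?a * \<phi> (map F ls)"
    using eq[OF \<phi>(1)] eq[OF uea_functional_lie_deriv[OF \<phi>(1)]] by simp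
  then show ?thesis
    using lie_deriv_map[OF \<phi>(1), of ls y F c] F \<phi>(2) by simp
qed

end


section \<open>The canonical form as a sum over orderings of the variables\<close>

lemma chain_prod:
  assumes "\<And>u. u > i \<Longrightarrow> t u = x (g u)"
  shows "(\<Prod>u \<in> {i<..i + n}. 1 / (t u - t (u - 1))) = chain x (t i) (map g [Suc i..<Suc (i + n)])"
  using assms
proof (induction n arbitrary: i)
  case (Suc n)
  have "{i<..i + Suc n} = insert (Suc i) {Suc i<..Suc i + n}"
    by auto
  then have "(\<Prod>u \<in> {i<..i + Suc n}. 1 / (t u - t (u - 1))) =
      1 / (t (Suc i) - t i) * (\<Prod>u \<in> {Suc i<..Suc i + n}. 1 / (t u - t (u - 1)))"
    by simp
  also have "(\<Prod>u \<in> {Suc i<..Suc i + n}. 1 / (t u - t (u - 1))) =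
      chain x (t (Suc i)) (map g [Suc (Suc i)..<Suc (Suc i + n)])"
    using Suc.prems by (intro Suc.IH) auto
  also have "1 / (t (Suc i) - t i) * \<dots> = chain x (t i) (map g (Suc i # [Suc (Suc i)..<Suc (Suc i + n)]))"
    using Suc.prems by (simp del: upt_Suc)
  also have "Suc i # [Suc (Suc i)..<Suc (Suc i + n)] = [Suc i..<Suc (i + Suc n)]"
    by (subst upt_conv_Cons[of "Suc i"]) simp_all
  finally show ?case .
qed simp

definition J_ordering :: "nat \<Rightarrow> (nat \<Rightarrow> nat) \<Rightarrow> var list" where
  "J_ordering n J = map (\<lambda>u. (J u, card {v \<in> {1..u}. J v = J u})) [1..<Suc n]"

lemma tvar_prod: "(\<Prod>u = 1..n. 1 / (tvar J u - tvar J (u - 1))) = chain rvar 0 (J_ordering n J)"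
proof -
  have "{1..n} = {0<..0 + n}"
    by auto
  moreover have "tvar J 0 = 0"
    by (simp add: tvar_def)
  ultimately show ?thesis
    using chain_prod[of 0 "tvar J" rvar "\<lambda>u. (J u, card {v \<in> {1..u}. J v = J u})" n]
    by (simp add: J_ordering_def tvar_def)
qed

lemma map_fst_J_ordering: "map fst (J_ordering n J) = map J [1..<Suc n]"
  by (simp add: J_ordering_def)

lemma card_vars: "card (vars r k) = size_of r k"
proof -
  have "vars r k = (SIGMA i:{1..r}. {1..k i})"
    by (auto simp: vars_def)
  then show ?thesis
    by (simp add: size_of_def)
qed

text \<open>Along a fibre of \<open>J\<close> the lower index strictly increases and is bounded by
  \<open>k\<close>, so the list has no repetitions and stays in \<open>vars r k\<close>; equal
  cardinalities give the rest.\<close>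

lemma J_ordering_permutation:
  assumes J: "J \<in> Js r k"
  shows "J_ordering (size_of r k) J \<in> permutations_of_set (vars r k)"
proof -
  let ?n = "size_of r k" and ?c = "\<lambda>u. card {v \<in> {1..u}. J v = J u}"
  have less: "?c u < ?c v" if "u < v" "J u = J v" "u \<ge> 1" for u v
  proof (rule psubset_card_mono)
    have "v \<in> {w \<in> {1..v}. J w = J v}" "v \<notin> {w \<in> {1..u}. J w = J u}"
      using that by auto
    moreover have "{w \<in> {1..u}. J w = J u} \<subseteq> {w \<in> {1..v}. J w = J v}"
      using that by auto
    ultimately show "{w \<in> {1..u}. J w = J u} \<subset> {w \<in> {1..v}. J w = J v}"
      by blast
  qed simp
  have "inj_on (\<lambda>u. (J u, ?c u)) (set [1..<Suc ?n])"
  proof (rule inj_onI)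
    fix u v assume "u \<in> set [1..<Suc ?n]" "v \<in> set [1..<Suc ?n]" "(J u, ?c u) = (J v, ?c v)"
    then show "u = v"
      using less[of u v] less[of v u] by (cases u v rule: linorder_cases) auto
  qed
  then have dist: "distinct (J_ordering ?n J)"
    by (simp add: J_ordering_def distinct_map del: upt_Suc)
  have "(J u, ?c u) \<in> vars r k" if u: "u \<in> {1..?n}" for u
  proof -
    have Ju: "J u \<in> {1..r}"
      using J u by (auto simp: Js_def)
    have "?c u \<le> card {v \<in> {1..?n}. J v = J u}"
      using u by (intro card_mono) auto
    also have "\<dots> = k (J u)"
      using J Ju by (simp add: Js_def)
    finally have "?c u \<le> k (J u)" .
    moreover have "?c u > 0"
      using u by (subst card_gt_0_iff) auto
    ultimately show ?thesis
      using Ju by (simp add: vars_def)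
  qed
  then have "set (J_ordering ?n J) \<subseteq> vars r k"
    by (auto simp: J_ordering_def simp del: upt_Suc)
  moreover have "card (set (J_ordering ?n J)) = card (vars r k)"
    using distinct_card[OF dist] by (simp add: card_vars J_ordering_def)
  ultimately have "set (J_ordering ?n J) = vars r k"
    by (intro card_subset_eq finite_vars)
  then show ?thesis
    using dist by (intro permutations_of_setI)
qed

lemma distinct_lists_permutation:
  assumes "distinct xs" "distinct ys" "set xs = set ys"
  obtains \<pi> where "\<pi> permutes set xs" "map \<pi> xs = ys"
proof -
  have len: "length xs = length ys"
    using assms by (metis distinct_card)
  define \<pi> where "\<pi> v = (case map_of (zip xs ys) v of Some w \<Rightarrow> w | None \<Rightarrow> v)" for v
  have map: "map \<pi> xs = ys"
    by (rule nth_equalityI) (auto simp: \<pi>_def len map_of_zip_nth[OF len assms(1)])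
  then have "distinct (map \<pi> xs)"
    using assms(2) by simp
  then have "inj_on \<pi> (set xs)"
    by (simp add: distinct_map)
  moreover have "\<pi> ` set xs = set xs"
    using arg_cong[OF map, of set] assms(3) by simp
  moreover have "\<pi> v = v" if "v \<notin> set xs" for v
    using that len by (simp add: \<pi>_def map_of_zip_is_None[THEN iffD2])
  ultimately have "\<pi> permutes set xs"
    by (intro bij_imp_permutes bij_betw_imageI)
  then show thesis
    using map by (rule that)
qed

text \<open>\<open>J\<close> is recovered from an ordering by reading upper indices, which
  permutations in \<open>G r k\<close> leave alone; the permutation is then forced since
  \<open>J_ordering\<close> lists every variable once.\<close>

lemma J_ordering_bij:
  assumes k: "k \<in> nvec r"
  shows "bij_betw (\<lambda>(J, \<pi>). map \<pi> (J_ordering (size_of r k) J)) (Js r k \<times> G r k)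
    (permutations_of_set (vars r k))"
proof (rule bij_betw_imageI)
  let ?n = "size_of r k" and ?b = "J_ordering (size_of r k)"
  have fst: "map fst (map \<pi> (?b J)) = map J [1..<Suc ?n]" if "\<pi> \<in> G r k" for J \<pi>
  proof -
    have "fst \<circ> \<pi> = fst"
      using that by (auto simp: G_def)
    then show ?thesis
      by (simp only: map_map map_fst_J_ordering)
  qed
  show "inj_on (\<lambda>(J, \<pi>). map \<pi> (?b J)) (Js r k \<times> G r k)"
  proof (rule inj_onI, clarify)
    fix J \<pi> J' \<pi>' assume J: "J \<in> Js r k" "J' \<in> Js r k" and \<pi>: "\<pi> \<in> G r k" "\<pi>' \<in> G r k"
      and eq: "map \<pi> (?b J) = map \<pi>' (?b J')"
    have "map J [1..<Suc ?n] = map J' [1..<Suc ?n]"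
      using fst[OF \<pi>(1), of J] fst[OF \<pi>(2), of J'] eq by simp
    then have "J u = J' u" if "u \<in> {1..?n}" for u
      using that by (auto simp del: upt_Suc)
    then have "J = J'"
      using J by (intro PiE_ext[of J "{1..?n}" _ J']) (auto simp: Js_def)
    moreover have "\<pi> v = \<pi>' v" for v
    proof (cases "v \<in> vars r k")
      case True
      then have "v \<in> set (?b J)"
        using J_ordering_permutation[OF J(1)] by (simp add: permutations_of_set_def)
      then show ?thesis
        using eq \<open>J = J'\<close> by (simp add: map_eq_conv)
    next
      case False
      then show ?thesis
        using \<pi> permutes_not_in[of \<pi> "vars r k" v] permutes_not_in[of \<pi>' "vars r k" v]
        by (simp add: G_def)
    qed
    ultimately show "J = J' \<and> \<pi> = \<pi>'"
      by auto
  qed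
  show "(\<lambda>(J, \<pi>). map \<pi> (?b J)) ` (Js r k \<times> G r k) = permutations_of_set (vars r k)"
  proof (intro subset_antisym subsetI)
    fix vs assume "vs \<in> (\<lambda>(J, \<pi>). map \<pi> (?b J)) ` (Js r k \<times> G r k)"
    then obtain J \<pi> where J: "J \<in> Js r k" and \<pi>: "\<pi> \<in> G r k" and vs: "vs = map \<pi> (?b J)"
      by auto
    have "set (?b J) = vars r k" "distinct (?b J)"
      using J_ordering_permutation[OF J] by (auto simp: permutations_of_set_def)
    then show "vs \<in> permutations_of_set (vars r k)"
      using \<pi> by (auto simp: vs G_def permutations_of_set_def distinct_map permutes_inj_on permutes_image)
  next
    fix vs assume "vs \<in> permutations_of_set (vars r k)"
    then have vs: "set vs = vars r k" "distinct vs"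
      by (auto simp: permutations_of_set_def)
    have len: "length vs = ?n"
      using distinct_card[OF vs(2)] vs(1) by (simp add: card_vars)
    have mem: "vs ! (u - 1) \<in> vars r k" if "u \<in> {1..?n}" for u
    proof -
      have "u - 1 < length vs"
        using that unfolding len atLeastAtMost_iff by linarith
      then show ?thesis
        unfolding vs(1)[symmetric] by (rule nth_mem)
    qed
    \<comment> \<open>List positions start at 0, the arguments of \<open>J\<close> at 1.\<close>
    define J where "J = restrict (\<lambda>u. fst (vs ! (u - 1))) {1..?n}"
    have bij: "bij_betw (\<lambda>u. vs ! (u - 1)) {u \<in> {1..?n}. J u = i} {v \<in> vars r k. fst v = i}" for i
    proof (rule bij_betw_imageI)
      show "inj_on (\<lambda>u. vs ! (u - 1)) {u \<in> {1..?n}. J u = i}"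
        using vs(2) by (auto intro!: inj_onI simp: nth_eq_iff_index_eq len)
      show "(\<lambda>u. vs ! (u - 1)) ` {u \<in> {1..?n}. J u = i} = {v \<in> vars r k. fst v = i}"
      proof (intro subset_antisym subsetI)
        fix v assume v: "v \<in> {v \<in> vars r k. fst v = i}"
        then obtain j where "j < ?n" "v = vs ! j"
          using vs(1) len by (metis (no_types, lifting) in_set_conv_nth mem_Collect_eq)
        then show "v \<in> (\<lambda>u. vs ! (u - 1)) ` {u \<in> {1..?n}. J u = i}"
          using v by (intro image_eqI[of _ _ "Suc j"]) (simp_all add: J_def)
      qed (use mem in \<open>auto simp: J_def\<close>)
    qed
    have "card {u \<in> {1..?n}. J u = i} = multiplicity_of (vars r k) i" for i
      unfolding multiplicity_of_def by (rule bij_betw_same_card[OF bij])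
    then have "card {u \<in> {1..?n}. J u = i} = k i" for i
      unfolding multiplicity_of_vars[OF k] .
    moreover have "fst (vs ! (u - 1)) \<in> {1..r}" if "u \<in> {1..?n}" for u
      using mem[OF that] by (auto simp: vars_def)
    ultimately have J: "J \<in> Js r k"
      by (auto simp: Js_def J_def)
    have b: "set (?b J) = vars r k" "distinct (?b J)"
      using J_ordering_permutation[OF J] by (auto simp: permutations_of_set_def)
    obtain \<pi> where \<pi>: "\<pi> permutes vars r k" "map \<pi> (?b J) = vs"
      using distinct_lists_permutation[OF b(2) vs(2)] b(1) vs(1) by metis
    have "map fst vs = map J [1..<Suc ?n]"
      by (rule nth_equalityI) (auto simp: len J_def nth_append simp del: upt_Suc)
    then have "map fst (map \<pi> (?b J)) = map fst (?b J)"
      unfolding \<pi>(2) map_fst_J_ordering .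
    then have "fst (\<pi> v) = fst v" if "v \<in> vars r k" for v
      using that b(1) by simp
    then have "fst (\<pi> v) = fst v" for v
      using permutes_not_in[OF \<pi>(1)] by metis
    then have "\<pi> \<in> G r k"
      using \<pi>(1) by (simp add: G_def)
    then show "vs \<in> (\<lambda>(J, \<pi>). map \<pi> (?b J)) ` (Js r k \<times> G r k)"
      using J \<pi>(2) by (intro image_eqI[of _ _ "(J, \<pi>)"]) auto
  qed
qed

text \<open>Under a functional, the sum over \<open>J\<close> and the symmetrization merge into one
  sum over all orderings, and the substitution \<open>f\<close> is absorbed into the
  functional.\<close>

lemma word_ext_Omega:
  assumes k: "k \<in> nvec r"
  shows "word_ext_rfun \<phi> (map_letters f (Omega r k)) = ordering_sum (vars r k) (\<phi> \<circ> map f)"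
proof -
  let ?n = "size_of r k" and ?b = "J_ordering (size_of r k)"
  let ?g = "\<lambda>vs. chain rvar 0 vs * rconst (\<phi> (map f (rev (map fst vs))))"
  have summand: "Sym r k (\<Prod>u = 1..?n. 1 / (tvar J u - tvar J (u - 1))) *
      rconst (\<phi> (map f (map J (rev [1..<Suc ?n])))) = (\<Sum>\<pi> \<in> G r k. ?g (map \<pi> (?b J)))" for J
    unfolding Sym_def tvar_prod sum_distrib_right
  proof (rule sum.cong[OF refl])
    fix \<pi> assume "\<pi> \<in> G r k"
    then have \<pi>: "inj \<pi>" "fst \<circ> \<pi> = fst"
      by (auto simp: G_def permutes_inj)
    have "map fst (map \<pi> (?b J)) = map J [1..<Suc ?n]"
      using \<pi>(2) by (simp add: map_fst_J_ordering del: upt_Suc)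
    then show "rename \<pi> (chain rvar 0 (?b J)) * rconst (\<phi> (map f (map J (rev [1..<Suc ?n])))) =
        ?g (map \<pi> (?b J))"
      using \<pi>(1) by (simp only: rename_chain rename_zero rev_map)
  qed
  have "word_ext_rfun \<phi> (map_letters f (Omega r k)) = (\<Sum>J \<in> Js r k. \<Sum>\<pi> \<in> G r k. ?g (map \<pi> (?b J)))"
    unfolding Omega_def map_letters_push push_sum push_single word_ext_rfun_sum word_ext_rfun_single
      letters_map_fmon fmon.sel summand ..
  also have "\<dots> = (\<Sum>(J, \<pi>) \<in> Js r k \<times> G r k. ?g (map \<pi> (?b J)))"
    by (rule sum.cartesian_product)
  also have "\<dots> = (\<Sum>p \<in> Js r k \<times> G r k. ?g ((\<lambda>(J, \<pi>). map \<pi> (?b J)) p))"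
    by (rule sum.cong) auto
  also have "\<dots> = (\<Sum>vs \<in> permutations_of_set (vars r k). ?g vs)"
    by (rule sum.reindex_bij_betw[OF J_ordering_bij[OF k]])
  finally show ?thesis
    by (simp add: ordering_sum_def)
qed


section \<open>The product formula\<close>

lemma inj_G: "\<pi> \<in> G r k \<Longrightarrow> inj \<pi>"
  by (auto simp: G_def permutes_inj)

lemma star_zero_left: "star r k l 0 g = 0"
  by (simp add: star_def Sym_def rename_zero inj_G)

text \<open>Used to pull the factorials accumulated in the right factor out of an iterated star
  product.\<close>

lemma star_of_nat_right: "star r k l f (of_nat c * g) = of_nat c * star r k l f g"
proof -
  let ?shift = "\<lambda>(i, j). (i, k i + j)"
  have of_nat: "rename \<sigma> (of_nat c) = of_nat c" if "inj \<sigma>" for \<sigma>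
    using rename_rconst[OF that, of "of_nat c"] by (simp add: rconst_of_nat)
  have "inj ?shift"
    by (auto simp: inj_on_def)
  then have "rename \<pi> (f * rename ?shift (of_nat c * g)) = of_nat c * rename \<pi> (f * rename ?shift g)"
    if "inj \<pi>" for \<pi>
    using that by (simp only: rename_mult of_nat mult.left_commute)
  then have "Sym r (\<lambda>i. k i + l i) (f * rename ?shift (of_nat c * g)) =
      of_nat c * Sym r (\<lambda>i. k i + l i) (f * rename ?shift g)"
    unfolding Sym_def sum_distrib_left by (intro sum.cong refl) (simp only: inj_G)
  then show ?thesis
    unfolding star_def by (simp only: times_divide_eq_right)
qed

lemma multiplicity_of_subset_vars:
  assumes "A \<subseteq> vars r k" "k \<in> nvec r"
  shows "multiplicity_of A \<in> nvec r" "multiplicity_of A i \<le> k i"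
proof -
  have le: "multiplicity_of A i \<le> k i" for i
  proof -
    have "multiplicity_of A i \<le> multiplicity_of (vars r k) i"
      unfolding multiplicity_of_def using assms(1) finite_vars[of r k] by (intro card_mono) auto
    then show ?thesis
      using multiplicity_of_vars[OF assms(2)] by simp
  qed
  then show "multiplicity_of A i \<le> k i" .
  have "multiplicity_of A i = 0" if "i \<notin> {1..r}" for i
    using le[of i] assms(2) that by (simp add: nvec_def)
  then show "multiplicity_of A \<in> nvec r"
    by (simp add: nvec_def)
qed

lemma size_of_mono: "(\<And>i. k i \<le> l i) \<Longrightarrow> size_of r k \<le> size_of r l"
  unfolding size_of_def by (rule sum_mono)

text \<open>Only one splitting of the multidegree survives when the left factor is supported in a single
  multidegree.\<close>

lemma ordering_sum_conv_star:
  assumes a: "a \<in> nvec r" and b: "b \<in> nvec r"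
  defines "k \<equiv> \<lambda>i. a i + b i"
  assumes zero: "\<And>k'. k' \<in> nvec r \<Longrightarrow> (\<And>i. k' i \<le> k i) \<Longrightarrow> k' \<noteq> a \<Longrightarrow> ordering_sum (vars r k') \<phi> = 0"
  shows "ordering_sum (vars r k) (conv \<phi> \<psi>) =
    star r a b (ordering_sum (vars r a) \<phi>) (ordering_sum (vars r b) \<psi>)"
proof -
  let ?V = "vars r k"
  let ?X = "\<lambda>A. ordering_sum A \<phi> * ordering_sum (?V - A) \<psi>"
  let ?Z = "star r a b (ordering_sum (vars r a) \<phi>) (ordering_sum (vars r b) \<psi>)"
  have k: "k \<in> nvec r"
    using a b by (simp add: k_def nvec_def)
  have fin: "finite (Pow ?V)"
    by (simp add: finite_vars)
  \<comment> \<open>The splittings of a fixed multidegree \<open>k'\<close> form one star product,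
    and its left factor vanishes by \<open>zero\<close> unless \<open>k' = a\<close>.\<close>
  have inner: "sum ?X {A \<in> Pow ?V. multiplicity_of A = k'} = (if k' = a then ?Z else 0)"
    if "k' \<in> multiplicity_of ` Pow ?V" for k'
  proof -
    have k': "k' \<in> nvec r" and le: "\<And>i. k' i \<le> k i"
      using that multiplicity_of_subset_vars[OF _ k] by auto
    define l where "l i = k i - k' i" for i
    have l: "l \<in> nvec r" and add: "(\<lambda>i. k' i + l i) = k"
      using k le by (auto simp: l_def nvec_def)
    have "sum ?X {A \<in> Pow ?V. multiplicity_of A = k'} =
        star r k' l (ordering_sum (vars r k') \<phi>) (ordering_sum (vars r l) \<psi>)"
      using star_ordering_sum[OF k' l, of \<phi> \<psi>] unfolding add by simp
    also have "\<dots> = (if k' = a then ?Z else 0)"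
    proof (cases "k' = a")
      case True
      then have "l = b"
        by (simp add: l_def k_def fun_eq_iff)
      then show ?thesis
        using True by simp
    next
      case False
      then show ?thesis
        using zero[OF k' le] by (simp add: star_zero_left)
    qed
    finally show ?thesis .
  qed
  have "a = multiplicity_of (vars r a)" "vars r a \<in> Pow ?V"
    using multiplicity_of_vars[OF a] by (auto simp: vars_def k_def)
  then have mem: "a \<in> multiplicity_of ` Pow ?V"
    by (rule image_eqI)
  have "ordering_sum ?V (conv \<phi> \<psi>) = sum ?X (Pow ?V)"
    by (rule ordering_sum_conv[OF finite_vars])
  also have "\<dots> = (\<Sum>k' \<in> multiplicity_of ` Pow ?V. sum ?X {A \<in> Pow ?V. multiplicity_of A = k'})"
    by (rule sum.image_gen[OF fin])
  also have "\<dots> = (\<Sum>k' \<in> multiplicity_of ` Pow ?V. if k' = a then ?Z else 0)"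
    by (rule sum.cong[OF refl inner])
  also have "\<dots> = ?Z"
    using mem fin by simp
  finally show ?thesis .
qed

theorem theorem6p3:
  fixes scale :: "complex \<Rightarrow> 'g::ab_group_add \<Rightarrow> 'g"
    and br :: "'g \<Rightarrow> 'g \<Rightarrow> 'g"
    and h :: "'g set"
    and r m :: nat
    and \<alpha> \<beta> :: "nat \<Rightarrow> 'g \<Rightarrow> complex"
    and e f F :: "nat \<Rightarrow> 'g"
    and kk :: "nat \<Rightarrow> nat \<Rightarrow> nat"
    and \<omega> :: "(nat \<Rightarrow> nat) \<Rightarrow> rfun"
  defines "N \<equiv> n_minus scale br h r \<alpha>"
  assumes "simple_lie_algebra scale br"
    and "cartan_subalgebra scale br h"
    and "vector_space.dim scale h = r"
    and "simple_roots scale br h r \<alpha>"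
    and "chevalley_generators scale br h r \<alpha> e f"
    and "bij_betw \<beta> {1..m} (positive_roots scale br h r \<alpha>)"
    and "\<And>l. l \<in> {1..m} \<Longrightarrow> module.span scale {F l} = n_beta scale br h (\<beta> l)"
    and "\<And>l. l \<in> {1..m} \<Longrightarrow> kk l \<in> nvec r"
    and "\<And>l. l \<in> {1..m} \<Longrightarrow> has_content scale br N r f (gen (F l)) (kk l)"
    and "pbw_expansion scale br N r f m F \<omega>"
  shows "\<exists>\<eta> :: nat \<Rightarrow> rfun.
    (\<forall>l \<in> {1..m}. \<eta> l \<in> ratfuns (vars r (kk l)) \<and>
                  (\<forall>\<pi> \<in> G r (kk l). rename \<pi> (\<eta> l) = \<eta> l)) \<and>
    (\<forall>p \<in> nvec m.
       \<omega> p = 1 / of_nat (\<Prod>l = 1..m. fact (p l)) *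
         star_list r (concat (map (\<lambda>l. replicate (p l) (kk l, \<eta> l)) [1..<Suc m])))"
proof -
  note cartan = assms(3) and simple = assms(5) and chevalley = assms(6) and \<beta> = assms(7)
    and spanF = assms(8) and kk = assms(9) and contF = assms(10) and expansion = assms(11)
  interpret simple_lie_algebra scale br
    by fact
  obtain B where "weight_basis scale br h B"
    using weight_basis_exists[OF cartan] ..
  then interpret weight_basis scale br h B .

  have \<beta>pos: "\<beta> l \<in> positive_roots scale br h r \<alpha>" if "l \<in> {1..m}" for l
    using bij_betwE[OF \<beta>] that by blast
  have \<beta>root: "\<beta> l \<in> dual_space scale h" "\<exists>y \<in> h. \<beta> l y \<noteq> 0" if "l \<in> {1..m}" for l
    using \<beta>pos[OF that] by (auto simp: positive_roots_def roots_def)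
  have Fn: "F l \<in> n_beta scale br h (\<beta> l)" if "l \<in> {1..m}" for l
    using span_base[of "F l" "{F l}"] spanF[OF that] by simp
  then have Fw: "br y (F l) = scale (- \<beta> l y) (F l)" if "l \<in> {1..m}" "y \<in> h" for l y
    using that by (simp add: n_beta_def root_space_def)
  have F0: "F l \<noteq> 0" if l: "l \<in> {1..m}" for l
  proof
    assume "F l = 0"
    then have "n_beta scale br h (\<beta> l) = {0}"
      using spanF[OF l] by simp
    then show False
      using negative_root_space_nontrivial[OF simple \<beta>pos[OF l]] by auto
  qed
  \<comment> \<open>Different roots are different extensional functions, so they differ at a point
    of \<open>h\<close>.\<close>
  have distinct: "\<exists>y \<in> h. - \<beta> l y \<noteq> - \<beta> j y" if "l \<in> {1..m}" "j \<in> {1..m}" "l \<noteq> j" for l j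
  proof (rule ccontr)
    assume "\<not> ?thesis"
    then have eq: "\<beta> l y = \<beta> j y" if "y \<in> h" for y
      using that by simp
    have ext: "\<beta> l \<in> extensional h" "\<beta> j \<in> extensional h"
      using \<beta>root(1) that unfolding dual_space_def by simp_all
    have "\<beta> l = \<beta> j"
      by (rule extensionalityI[OF ext eq])
    from inj_onD[OF bij_betw_imp_inj_on[OF \<beta>] this that(1,2)] show False
      using that(3) by simp
  qed
  have "\<exists>\<phi>. uea_functional \<phi> \<and> \<phi> [] = 0 \<and> (\<forall>j \<in> {1..m}. \<phi> [F j] = (if j = l then 1 else 0))" for l
    using dual_functionals_exist[of m F "\<lambda>l y. - \<beta> l y", OF Fw F0 distinct] .
  then obtain prim where "\<forall>l. uea_functional (prim l) \<and> prim l [] = 0 \<and>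
      (\<forall>j \<in> {1..m}. prim l [F j] = (if j = l then 1 else 0))"
    by metis
  then have prim: "uea_functional (prim l)" "prim l [] = 0"
    "j \<in> {1..m} \<Longrightarrow> prim l [F j] = (if j = l then 1 else 0)" for l j
    by auto
  note pbw_dual = pbw_dual_exists[of m prim F, OF prim(1,2) prim(3)]

  have \<alpha>pos: "\<alpha> i \<in> positive_roots scale br h r \<alpha>" if i: "i \<in> {1..r}" for i
  proof -
    have eq: "\<alpha> i y = (\<Sum>j = 1..r. of_nat (if j = i then 1 else 0) * \<alpha> j y)" for y
    proof -
      have "(\<Sum>j = 1..r. of_nat (if j = i then 1 else 0) * \<alpha> j y) = (\<Sum>j = 1..r. if j = i then \<alpha> j y else 0)"
        by (rule sum.cong) auto
      then show ?thesis
        using i by simp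
    qed
    have "\<forall>i \<in> {1..r}. \<alpha> i \<in> roots scale br h"
      using simple unfolding simple_roots_def by (rule conjunct1)
    then show ?thesis
      unfolding positive_roots_def using i eq
      by (intro CollectI conjI exI[of _ "\<lambda>j. if j = i then 1 else 0"] ballI) (simp_all only:)
  qed
  have fn: "f i \<in> n_beta scale br h (\<alpha> i)" if "i \<in> {1..r}" for i
    using chevalley that by (simp add: chevalley_generators_def n_beta_def)
  then have fw: "br y (f i) = scale (- \<alpha> i y) (f i)" if "i \<in> {1..r}" "y \<in> h" for i y
    using that by (simp add: n_beta_def root_space_def)
  have fN: "f i \<in> N" if "i \<in> {1..r}" for i
    unfolding N_def n_minus_def by (rule span_base) (use fn \<alpha>pos that in blast)
  have FN: "F l \<in> N" if "l \<in> {1..m}" for l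
    unfolding N_def n_minus_def by (rule span_base) (use Fn \<beta>pos that in blast)

  \<comment> \<open>The multidegree that additivity of contents predicts for the monomial of
    \<open>p\<close>.\<close>
  define cont where "cont p i = (\<Sum>l = 1..m. p l * kk l i)" for p i
  \<comment> \<open>Comparing weights on the one-letter word shows that the content of
    \<open>F l\<close> lists the coefficients of \<open>\<beta> l\<close> in the simple
    roots.\<close>
  have \<beta>kk: "\<beta> l y = (\<Sum>i = 1..r. of_nat (kk l i) * \<alpha> i y)" if l: "l \<in> {1..m}" and y: "y \<in> h" for l y
  proof -
    have "(\<Sum>l\<leftarrow>[l]. - \<beta> l y) = (\<Sum>i = 1..r. of_nat (kk l i) * - \<alpha> i y)"
    proof (rule has_content_weight[OF prim(1)[of l], of F _ N])
      show "has_content scale br N r f (Poly_Mapping.single (Wd (map F [l])) 1) (kk l)"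
        using contF[OF l] by (simp add: gen_def)
    qed (use l y prim(3)[of l l] fw Fw in auto)
    then show ?thesis
      by (simp add: sum_negf)
  qed
  have cont_nvec: "cont p \<in> nvec r" for p
    using kk by (auto simp: cont_def nvec_def)
  \<comment> \<open>Uniqueness of the content is the substantial direction: a dual functional shows
    that the monomial is nonzero, so any content has its weight, and the simple roots are
    independent.\<close>
  have content_iff: "has_content scale br N r f (pbw_monomial m F p) k \<longleftrightarrow> cont p = k"
    if p: "p \<in> nvec m" and k: "k \<in> nvec r" for p k
  proof
    have "(\<Sum>l\<leftarrow>pbw_word m p. kk l i) = cont p i" for i
      using sum_list_count[OF set_pbw_word, of "\<lambda>l. kk l i" m p] by (simp add: cont_def count_list_pbw_word[OF p])
    moreover have "has_content scale br N r f (pbw_monomial m F p) (\<lambda>i. \<Sum>l\<leftarrow>pbw_word m p. kk l i)"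
      unfolding pbw_monomial_word
    proof (rule has_content_word)
      show "F l \<in> N" "has_content scale br N r f (gen (F l)) (kk l)" if "l \<in> set (pbw_word m p)" for l
        using FN contF set_pbw_word that by blast+
    qed (rule fN)
    ultimately show "has_content scale br N r f (pbw_monomial m F p) k" if "cont p = k"
      using that by (simp add: fun_eq_iff[symmetric])
  next
    assume cont: "has_content scale br N r f (pbw_monomial m F p) k"
    obtain \<phi> where \<phi>: "uea_functional \<phi>" "\<phi> (map F (pbw_word m p)) = 1"
      using pbw_dual[of "length (pbw_word m p)" p] set_pbw_word sorted_pbw_word count_list_pbw_word[OF p] by auto
    have "(\<Sum>i = 1..r. (of_nat (cont p i) - of_nat (k i)) * \<alpha> i y) = 0" if y: "y \<in> h" for y
    proof -
      have "(\<Sum>l\<leftarrow>pbw_word m p. - \<beta> l y) = (\<Sum>i = 1..r. of_nat (k i) * - \<alpha> i y)"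
      proof (rule has_content_weight[OF \<phi>(1)])
        show "has_content scale br N r f (Poly_Mapping.single (Wd (map F (pbw_word m p))) 1) k"
          using cont by (simp add: pbw_monomial_word)
        show "br y (F l) = scale (- \<beta> l y) (F l)" if "l \<in> set (pbw_word m p)" for l
          using Fw set_pbw_word that y by blast
      qed (use \<phi>(2) fw y in auto)
      moreover have "(\<Sum>l\<leftarrow>pbw_word m p. - \<beta> l y) = (\<Sum>l = 1..m. of_nat (p l) * - \<beta> l y)"
        using sum_list_count[OF set_pbw_word, of "\<lambda>l. - \<beta> l y" m p] by (simp add: count_list_pbw_word[OF p])
      moreover have "(\<Sum>l = 1..m. of_nat (p l) * \<beta> l y) = (\<Sum>i = 1..r. of_nat (cont p i) * \<alpha> i y)"
      proof -
        have "(\<Sum>l = 1..m. of_nat (p l) * \<beta> l y) =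
            (\<Sum>l = 1..m. \<Sum>i = 1..r. of_nat (p l * kk l i) * \<alpha> i y)"
          by (rule sum.cong) (simp_all add: \<beta>kk y sum_distrib_left mult.assoc)
        also have "\<dots> = (\<Sum>i = 1..r. \<Sum>l = 1..m. of_nat (p l * kk l i) * \<alpha> i y)"
          by (rule sum.swap)
        finally show ?thesis
          by (simp add: cont_def sum_distrib_right)
      qed
      ultimately show ?thesis
        by (simp add: sum_negf left_diff_distrib sum_subtractf)
    qed
    then have zero: "\<forall>y \<in> h. (\<Sum>i = 1..r. (of_nat (cont p i) - of_nat (k i)) * \<alpha> i y) = 0" ..
    have "\<forall>c :: nat \<Rightarrow> complex. (\<forall>y \<in> h. (\<Sum>i = 1..r. c i * \<alpha> i y) = 0) \<longrightarrow> (\<forall>i \<in> {1..r}. c i = 0)"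
      using simple unfolding simple_roots_def by (elim conjE)
    from mp[OF spec[OF this] zero] have "cont p i = k i" if "i \<in> {1..r}" for i
      using that by simp
    moreover have "cont p i = k i" if "i \<notin> {1..r}" for i
      using cont_nvec[of p] k that by (simp add: nvec_def)
    ultimately show "cont p = k"
      by blast
  qed
  \<comment> \<open>Roots are nonzero, so every factor contributes at least 1 to the total degree.
    This bounds the length of PBW words by \<open>size_of r k\<close> and makes the sums over
    \<open>p\<close> finite.\<close>
  have size_cont: "(\<Sum>l = 1..m. p l) \<le> size_of r (cont p)" for p
  proof -
    have pos: "1 \<le> size_of r (kk l)" if l: "l \<in> {1..m}" for l
    proof (rule ccontr)
      assume "\<not> ?thesis"
      then have "size_of r (kk l) = 0"
        by simp
      then have "\<forall>i \<in> {1..r}. kk l i = 0"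
        by (simp add: size_of_def)
      then have "\<beta> l y = 0" if "y \<in> h" for y
        using \<beta>kk[OF l that] by simp
      then show False
        using \<beta>root(2)[OF l] by blast
    qed
    have "(\<Sum>l = 1..m. p l) \<le> (\<Sum>l = 1..m. p l * size_of r (kk l))"
      by (rule sum_mono) (use pos in force)
    also have "\<dots> = size_of r (cont p)"
      unfolding size_of_def cont_def sum_distrib_left by (rule sum.swap)
    finally show ?thesis .
  qed
  let ?P = "\<lambda>k. {p \<in> nvec m. cont p = k}"
  have finP: "finite (?P k)" for k
    by (rule finite_subset[OF _ finite_nvec_bounded[of m "size_of r k"]]) (use size_cont in auto)

  have eval: "ordering_sum (vars r k) (\<phi> \<circ> map f) =
      (\<Sum>p \<in> ?P k. \<omega> p * rconst (\<phi> (map F (pbw_word m p))))"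
    if k: "k \<in> nvec r" and \<phi>: "uea_functional \<phi>" for k \<phi>
  proof -
    have "{p \<in> nvec m. has_content scale br N r f (pbw_monomial m F p) k} = ?P k"
      using content_iff k by blast
    then have "word_ext_rfun \<phi> (map_letters f (Omega r k) -
        (\<Sum>p \<in> ?P k. tens (\<omega> p) (pbw_monomial m F p))) = 0"
      using expansion k unfolding pbw_expansion_def
      by (intro word_ext_rfun_uea_ideal[OF \<phi>, of _ N]) auto
    then show ?thesis
      by (simp add: word_ext_rfun_diff word_ext_rfun_sum word_ext_rfun_tens word_ext_Omega[OF k]
          pbw_monomial_word word_ext_single)
  qed
  \<comment> \<open>All monomials of multidegree \<open>k\<close> have length at most
    \<open>size_of r k\<close>, so duality up to length \<open>n\<close> isolates a single
    coefficient.\<close>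
  have eval_dual: "ordering_sum (vars r k) (\<phi> \<circ> map f) = (if cont b = k then \<omega> b else 0)"
    if k: "k \<in> nvec r" "size_of r k \<le> n" and \<phi>: "uea_functional \<phi>" and b: "b \<in> nvec m"
      and dual: "\<And>ws. set ws \<subseteq> {1..m} \<Longrightarrow> sorted ws \<Longrightarrow> length ws \<le> n \<Longrightarrow>
        \<phi> (map F ws) = (if count_list ws = b then 1 else 0)" for k \<phi> b n
  proof -
    have "ordering_sum (vars r k) (\<phi> \<circ> map f) = (\<Sum>p \<in> ?P k. if p = b then \<omega> b else 0)"
      unfolding eval[OF k(1) \<phi>]
    proof (rule sum.cong[OF refl])
      fix p assume p: "p \<in> ?P k"
      then have "length (pbw_word m p) \<le> n"
        using size_cont[of p] k(2) by (simp add: length_pbw_word)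
      then have "\<phi> (map F (pbw_word m p)) = (if p = b then 1 else 0)"
        using dual[OF set_pbw_word sorted_pbw_word, of p] p by (simp add: count_list_pbw_word)
      then show "\<omega> p * rconst (\<phi> (map F (pbw_word m p))) = (if p = b then \<omega> b else 0)"
        by (simp add: rconst_one rconst_zero)
    qed
    then show ?thesis
      using finP[of k] b by auto
  qed

  define unit where "unit l = (\<lambda>j :: nat. if j = l then 1 else 0 :: nat)" for l
  have unit: "unit l \<in> nvec m" "cont (unit l) = kk l" if "l \<in> {1..m}" for l
  proof -
    show "unit l \<in> nvec m"
      using that by (auto simp: unit_def nvec_def)
    have "cont (unit l) i = (\<Sum>j = 1..m. if j = l then kk j i else 0)" for i
      unfolding cont_def by (rule sum.cong) (auto simp: unit_def)
    then show "cont (unit l) = kk l"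
      using that by (simp add: fun_eq_iff)
  qed
  \<comment> \<open>The convolution of the functionals dual to \<open>unit l\<close> and to
    \<open>b\<close> is evaluated on the canonical form in two ways: through orderings it is a star
    product, through the PBW expansion a multiple of one coefficient.\<close>
  have mult: "star r (kk l) (cont b) (\<omega> (unit l)) (\<omega> b) = of_nat (Suc (b l)) * \<omega> (b(l := Suc (b l)))"
    if l: "l \<in> {1..m}" and b: "b \<in> nvec m" for l b
  proof -
    let ?b = "b(l := Suc (b l))"
    let ?k = "\<lambda>i. kk l i + cont b i"
    have k: "?k \<in> nvec r"
      using kk[OF l] cont_nvec[of b] by (simp add: nvec_def)
    have b': "?b \<in> nvec m" "cont ?b = ?k"
    proof -
      show "?b \<in> nvec m"
        using b l by (auto simp: nvec_def)
      have "cont ?b i = (\<Sum>j = 1..m. b j * kk j i + (if j = l then kk j i else 0))" for i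
        unfolding cont_def by (rule sum.cong) auto
      then show "cont ?b = ?k"
        using l by (simp add: sum.distrib fun_eq_iff cont_def)
    qed
    \<comment> \<open>This bound serves all multidegrees below \<open>?k\<close> at once, in
      particular those of both parts of a splitting.\<close>
    let ?n = "size_of r ?k"
    obtain \<phi> where \<phi>: "uea_functional \<phi>" "\<And>ws. set ws \<subseteq> {1..m} \<Longrightarrow> sorted ws \<Longrightarrow> length ws \<le> ?n \<Longrightarrow>
        \<phi> (map F ws) = (if count_list ws = unit l then 1 else 0)"
      using pbw_dual[of ?n "unit l"] by blast
    obtain \<psi> where \<psi>: "uea_functional \<psi>" "\<And>ws. set ws \<subseteq> {1..m} \<Longrightarrow> sorted ws \<Longrightarrow> length ws \<le> ?n \<Longrightarrow>
        \<psi> (map F ws) = (if count_list ws = b then 1 else 0)"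
      using pbw_dual[of ?n b] by blast
    \<comment> \<open>Vanishing in all other multidegrees below \<open>?k\<close> is the hypothesis
      that leaves only one splitting in \<open>ordering_sum_conv_star\<close>.\<close>
    have os\<phi>: "ordering_sum (vars r k') (\<phi> \<circ> map f) = (if kk l = k' then \<omega> (unit l) else 0)"
      if "k' \<in> nvec r" "\<And>i. k' i \<le> ?k i" for k'
      using eval_dual[OF that(1) size_of_mono[OF that(2)] \<phi>(1) unit(1)[OF l] \<phi>(2)] unit(2)[OF l] by simp
    have os\<psi>: "ordering_sum (vars r (cont b)) (\<psi> \<circ> map f) = \<omega> b"
    proof -
      have "size_of r (cont b) \<le> ?n"
        by (rule size_of_mono) simp
      from eval_dual[OF cont_nvec this \<psi>(1) b \<psi>(2)] show ?thesis
        by simp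
    qed
    have "ordering_sum (vars r ?k) (conv \<phi> \<psi> \<circ> map f) = star r (kk l) (cont b) (\<omega> (unit l)) (\<omega> b)"
    proof -
      have "conv \<phi> \<psi> \<circ> map f = conv (\<phi> \<circ> map f) (\<psi> \<circ> map f)"
        by (auto simp: conv_map)
      then show ?thesis
        using ordering_sum_conv_star[OF kk[OF l] cont_nvec[of b], of "\<phi> \<circ> map f" "\<psi> \<circ> map f"]
          os\<phi> os\<phi>[OF kk[OF l]] os\<psi> by simp
    qed
    moreover have "ordering_sum (vars r ?k) (conv \<phi> \<psi> \<circ> map f) =
        (\<Sum>p \<in> ?P ?k. if p = ?b then of_nat (Suc (b l)) * \<omega> ?b else 0)"
      unfolding eval[OF k uea_functional_conv[OF \<phi>(1) \<psi>(1)]]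
    proof (rule sum.cong[OF refl])
      fix p assume p: "p \<in> ?P ?k"
      then have len: "length (pbw_word m p) \<le> ?n"
        using size_cont[of p] by (simp add: length_pbw_word)
      have "conv \<phi> \<psi> (map F (pbw_word m p)) = (if p = ?b then of_nat (Suc (b l)) else 0)"
        using conv_pbw_dual[OF l \<phi>(2)[unfolded unit_def] \<psi>(2) set_pbw_word sorted_pbw_word len] p
        by (simp add: count_list_pbw_word)
      then show "\<omega> p * rconst (conv \<phi> \<psi> (map F (pbw_word m p))) =
          (if p = ?b then of_nat (Suc (b l)) * \<omega> ?b else 0)"
        by (simp only: rconst_of_nat rconst_zero mult.commute mult_zero_right split: if_split) simp
    qed
    ultimately show ?thesis
      using finP[of ?k] b' by simp
  qed

  \<comment> \<open>In multidegree zero there is only the empty ordering, whose \<open>chain\<close>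
    is the empty product.\<close>
  have \<omega>0: "\<omega> (\<lambda>_. 0) = 1"
  proof -
    obtain \<phi> where \<phi>: "uea_functional \<phi>" "\<And>ws. set ws \<subseteq> {1..m} \<Longrightarrow> sorted ws \<Longrightarrow> length ws \<le> 0 \<Longrightarrow>
        \<phi> (map F ws) = (if count_list ws = (\<lambda>_. 0) then 1 else 0)"
      using pbw_dual[of 0 "\<lambda>_. 0"] by blast
    have "count_list [] = (\<lambda>_ :: nat. 0)"
      by auto
    then have "\<phi> [] = 1"
      using \<phi>(2)[of "[]"] by simp
    moreover have "vars r (\<lambda>_. 0) = {}"
      by (auto simp: vars_def)
    moreover have "cont (\<lambda>_. 0) = (\<lambda>_. 0)"
      by (auto simp: cont_def)
    ultimately show ?thesis
      using eval_dual[of "\<lambda>_. 0" 0 \<phi> "\<lambda>_. 0", OF _ _ \<phi>(1) _ \<phi>(2)]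
      by (simp add: nvec_def size_of_def ordering_sum_def rconst_one)
  qed

  define \<eta> where "\<eta> l = \<omega> (unit l)" for l
  \<comment> \<open>For arbitrary index words, sorted or not: prepending a letter is one application
    of \<open>mult\<close>, whose factor \<open>Suc (count_list ls l)\<close> updates the product of
    factorials.\<close>
  have list: "star_list r (map (\<lambda>l. (kk l, \<eta> l)) ls) =
      of_nat (\<Prod>l = 1..m. fact (count_list ls l)) * \<omega> (count_list ls)" if "set ls \<subseteq> {1..m}" for ls
    using that
  proof (induction ls)
    case Nil
    have "count_list [] = (\<lambda>_ :: nat. 0)"
      by auto
    then show ?case
      using \<omega>0 by simp
  next
    case (Cons l ls)
    then have l: "l \<in> {1..m}" and ls: "set ls \<subseteq> {1..m}"
      by auto
    have "(\<Sum>(k, g)\<leftarrow>map (\<lambda>l. (kk l, \<eta> l)) ls. k i) = cont (count_list ls) i" for i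
      using sum_list_count[OF ls, of "\<lambda>l. kk l i"] by (simp add: cont_def o_def)
    then have "star_list r (map (\<lambda>l. (kk l, \<eta> l)) (l # ls)) =
        of_nat (\<Prod>l = 1..m. fact (count_list ls l)) *
        star r (kk l) (cont (count_list ls)) (\<omega> (unit l)) (\<omega> (count_list ls))"
      using Cons.IH[OF ls] by (simp add: \<eta>_def star_of_nat_right del: of_nat_prod)
    also have "\<dots> = of_nat ((\<Prod>l = 1..m. fact (count_list ls l)) * Suc (count_list ls l)) *
        \<omega> ((count_list ls)(l := Suc (count_list ls l)))"
      by (simp only: mult[OF l count_list_nvec[OF ls]] of_nat_mult mult.assoc)
    also have "(count_list ls)(l := Suc (count_list ls l)) = count_list (l # ls)"
      by (auto simp: fun_eq_iff)
    also have "(\<Prod>j = 1..m. fact (count_list ls j)) * Suc (count_list ls l) =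
        (\<Prod>j = 1..m. fact (count_list (l # ls) j))"
    proof -
      have rest: "(\<Prod>j \<in> {1..m} - {l}. fact (count_list (l # ls) j)) =
          (\<Prod>j \<in> {1..m} - {l}. fact (count_list ls j) :: nat)"
        by (rule prod.cong) auto
      have "(\<Prod>j = 1..m. fact (count_list (l # ls) j)) =
          fact (Suc (count_list ls l)) * (\<Prod>j \<in> {1..m} - {l}. fact (count_list ls j) :: nat)"
        unfolding rest[symmetric] using l by (subst prod.remove[of _ l]) simp_all
      moreover have "(\<Prod>j = 1..m. fact (count_list ls j)) =
          fact (count_list ls l) * (\<Prod>j \<in> {1..m} - {l}. fact (count_list ls j) :: nat)"
        using l by (intro prod.remove) simp_all
      ultimately show ?thesis
        by (simp only: fact_Suc of_nat_id mult_ac)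
    qed
    finally show ?case .
  qed
  \<comment> \<open>A dual functional exhibits \<open>\<eta> l\<close> as an ordering sum over
    \<open>vars r (kk l)\<close>, from which rationality in these variables and symmetry are
    inherited.\<close>
  have "\<eta> l \<in> ratfuns (vars r (kk l)) \<and> (\<forall>\<pi> \<in> G r (kk l). rename \<pi> (\<eta> l) = \<eta> l)" if l: "l \<in> {1..m}" for l
  proof -
    obtain \<phi> where \<phi>: "uea_functional \<phi>" "\<And>ws. set ws \<subseteq> {1..m} \<Longrightarrow> sorted ws \<Longrightarrow>
        length ws \<le> size_of r (kk l) \<Longrightarrow> \<phi> (map F ws) = (if count_list ws = unit l then 1 else 0)"
      using pbw_dual[of "size_of r (kk l)" "unit l"] by blast
    have \<eta>l: "\<eta> l = ordering_sum (vars r (kk l)) (\<phi> \<circ> map f)"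
      using eval_dual[OF kk[OF l] order.refl \<phi>(1) unit(1)[OF l] \<phi>(2)] unit(2)[OF l] by (simp add: \<eta>_def)
    have "rename \<pi> (\<eta> l) = \<eta> l" if \<pi>: "\<pi> \<in> G r (kk l)" for \<pi>
      unfolding \<eta>l using \<pi> by (subst rename_ordering_sum) (auto simp: G_def permutes_inj permutes_image)
    then show ?thesis
      using ratfuns_ordering_sum \<eta>l by simp
  qed
  moreover have "\<omega> p = 1 / of_nat (\<Prod>l = 1..m. fact (p l)) *
      star_list r (concat (map (\<lambda>l. replicate (p l) (kk l, \<eta> l)) [1..<Suc m]))" if p: "p \<in> nvec m" for p
  proof -
    have eq: "concat (map (\<lambda>l. replicate (p l) (kk l, \<eta> l)) [1..<Suc m]) =
        map (\<lambda>l. (kk l, \<eta> l)) (pbw_word m p)"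
      by (simp only: pbw_word_def map_concat map_map o_def map_replicate)
    have "of_nat (\<Prod>l = 1..m. fact (p l)) \<noteq> (0 :: rfun)"
      unfolding of_nat_eq_0_iff by simp
    then show ?thesis
      unfolding eq list[OF set_pbw_word] count_list_pbw_word[OF p] by (simp del: of_nat_prod)
  qed
  ultimately show ?thesis
    by blast
qed

end
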